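(* Let $p$ and $q$ be primes such that $p\equiv 1\pmod{q^2}$ and let $r\in\mathbb{Z}_p^*$ have order $q^t$, with $t\ge 2$. Let $Y(q,p)$ and $Z(q,p)$ be the graphs defined in the context. Then $\kappa(Y(q,p))=\kappa(Z(q,p))=1$.
   Context: $\mathbb{Z}_n$ is the ring of residue classes modulo $n$ and $\mathbb{Z}_n^*$ its group of units. Hamilton compression: let $X$ be a graph of order $n$. A Hamilton cycle $C=v_0,v_1,\ldots,v_{n-1},v_0$ in $X$ is $k$-symmetric if there exists an automorphism $\alpha$ of $X$ such that $\alpha(v_i)=v_{i+n/k}$ for each $i\in\mathbb{Z}_n$. The compression factor $\kappa(X,C)$ is the maximum $k$ for which $C$ is $k$-symmetric. The Hamilton compression of $X$ is $\kappa(X)=\max\{\kappa(X,C)\mid C \text{ is a Hamilton cycle in } X\}$, and $\kappa(X)=0$ if $X$ has no Hamilton cycle. The graphs $Y(q,p)$ and $Z(q,p)$: write $p=1+Nq^t$ with $p,q$ primes, $t\ge 2$ and $\gcd(N,q)=1$. Let $\lambda$ be a generator of $\mathbb{Z}_p^*$ and set $r=\lambda^N$, so that $r$ has order $q^t$ in $\mathbb{Z}_p^*$. For $a\in\mathbb{Z}_p^*$ let $\langle a\rangle$ be the subgroup of $\mathbb{Z}_p^*$ generated by $a$. Put $R=\langle r^q\rangle\cup -\langle r^q\rangle$ and $Q=\langle r^{q^{t-1}}\rangle\cup -\langle r^{q^{t-1}}\rangle$. Both graphs have vertex set $\{v_i^j : i\in\mathbb{Z}_q,\ j\in\mathbb{Z}_p\}$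 (subscript and superscript are both indices). Their edge sets are $$E(Y(q,p))=\{v_i^jv_{i+1}^j\mid i\in\mathbb{Z}_q,\ j\in\mathbb{Z}_p\}\cup\{v_i^jv_i^{j+x}\mid i\in\mathbb{Z}_q,\ j\in\mathbb{Z}_p,\ x\in r^iR\},$$ $$E(Z(q,p))=\{v_i^jv_{i+1}^j\mid i\in\mathbb{Z}_q,\ j\in\mathbb{Z}_p\}\cup\{v_i^jv_i^{j+x}\mid i\in\mathbb{Z}_q,\ j\in\mathbb{Z}_p,\ x\in r^iQ\}.$$
   Formalization: The pair q = 2, p = 5 is excluded: there Y(2,5) and Z(2,5) are both the Petersen graph, which has no Hamilton cycle, so its Hamilton compression is 0 and the claim fails. *)

theory Defs
  imports "HOL-Number_Theory.Residues" "HOL-Algebra.Generated_Groups"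
begin

record 'a ugraph =
  verts :: "'a set"
  edges :: "'a set set"

definition graph_automorphism :: "'a ugraph \<Rightarrow> ('a \<Rightarrow> 'a) \<Rightarrow> bool" where
  "graph_automorphism X \<alpha> \<longleftrightarrow>
     bij_betw \<alpha> (verts X) (verts X) \<and>
     (\<forall>u\<in>verts X. \<forall>v\<in>verts X. {u, v} \<in> edges X \<longleftrightarrow> {\<alpha> u, \<alpha> v} \<in> edges X)"

text \<open>The list \<open>[v_0, \<dots>, v_(n-1)]\<close> stands for the cycle \<open>v_0, \<dots>, v_(n-1), v_0\<close>.\<close>

definition hamilton_cycle :: "'a ugraph \<Rightarrow> 'a list \<Rightarrow> bool" where
  "hamilton_cycle X C \<longleftrightarrow>
     3 \<le> length C \<and> distinct C \<and> set C = verts X \<and>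
     (\<forall>i<length C. {C ! i, C ! ((i + 1) mod length C)} \<in> edges X)"

definition k_symmetric :: "'a ugraph \<Rightarrow> 'a list \<Rightarrow> nat \<Rightarrow> bool" where
  "k_symmetric X C k \<longleftrightarrow>
     k dvd length C \<and>
     (\<exists>\<alpha>. graph_automorphism X \<alpha> \<and>
        (\<forall>i<length C. \<alpha> (C ! i) = C ! ((i + length C div k) mod length C)))"

text \<open>If \<open>C\<close> is a Hamilton cycle, then the set of all \<open>k\<close> for which \<open>C\<close> is \<open>k\<close>-symmetric
  consists of divisors of \<open>length C > 0\<close> and contains 1, so that \<open>Max\<close> is meaningful here and
  in the next definition.\<close>

definition compression_factor :: "'a ugraph \<Rightarrow> 'a list \<Rightarrow> nat" where
  "compression_factor X C = Max {k. k_symmetric X C k}"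

definition hamilton_compression :: "'a ugraph \<Rightarrow> nat" where
  "hamilton_compression X =
     (if \<exists>C. hamilton_cycle X C
      then Max {compression_factor X C | C. hamilton_cycle X C}
      else 0)"

abbreviation Zmod :: "nat \<Rightarrow> int ring" where
  "Zmod n \<equiv> residue_ring (int n)"

abbreviation Zstar :: "nat \<Rightarrow> int monoid" where
  "Zstar n \<equiv> units_of (Zmod n)"

text \<open>\<open>pm_generate p a\<close> is the union of \<open>\<langle>a\<rangle>\<close> and \<open>-\<langle>a\<rangle>\<close>, with \<open>\<langle>a\<rangle>\<close> the multiplicative
  subgroup generated by \<open>a\<close>.\<close>

definition pm_generate :: "nat \<Rightarrow> int \<Rightarrow> int set" where
  "pm_generate p a =
     generate (Zstar p) {a} \<union> a_inv (Zmod p) ` generate (Zstar p) {a}"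

text \<open>The common shape of \<open>Y(q,p)\<close> and \<open>Z(q,p)\<close>: the pair \<open>(i, j)\<close> is the vertex with lower
  index \<open>i\<close> and upper index \<open>j\<close>, and the connection set of layer \<open>i\<close> is \<open>r^i S\<close>. In the exponent
  the residue class \<open>i\<close> is read as its representative in \<open>{0, \<dots>, q - 1}\<close>. For \<open>Y(q,p)\<close> any other
  representative gives the same set; for \<open>Z(q,p)\<close> this is so only when \<open>t = 2\<close>.\<close>

definition layered_graph :: "nat \<Rightarrow> nat \<Rightarrow> int \<Rightarrow> int set \<Rightarrow> (int \<times> int) ugraph" where
  "layered_graph q p r S =
     \<lparr> verts = carrier (Zmod q) \<times> carrier (Zmod p),
       edges =
         {{(i, j), (i \<oplus>\<^bsub>Zmod q\<^esub> \<one>\<^bsub>Zmod q\<^esub>, j)} | i j.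
            i \<in> carrier (Zmod q) \<and> j \<in> carrier (Zmod p)} \<union>
         {{(i, j), (i, j \<oplus>\<^bsub>Zmod p\<^esub> x)} | i j x.
            i \<in> carrier (Zmod q) \<and> j \<in> carrier (Zmod p) \<and>
            x \<in> (\<lambda>s. (r [^]\<^bsub>Zmod p\<^esub> nat i) \<otimes>\<^bsub>Zmod p\<^esub> s) ` S} \<rparr>"

definition Y_graph :: "nat \<Rightarrow> nat \<Rightarrow> int \<Rightarrow> (int \<times> int) ugraph" where
  "Y_graph q p r = layered_graph q p r (pm_generate p (r [^]\<^bsub>Zmod p\<^esub> q))"

definition Z_graph :: "nat \<Rightarrow> nat \<Rightarrow> int \<Rightarrow> nat \<Rightarrow> (int \<times> int) ugraph" where
  "Z_graph q p r t = layered_graph q p r (pm_generate p (r [^]\<^bsub>Zmod p\<^esub> (q ^ (t - 1))))"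

end

theory Submission
  imports Defs "HOL-Computational_Algebra.Polynomial"
begin

text \<open>
  Write \<open>(i, j)\<close> for the vertex in layer \<open>i\<close> with upper index \<open>j\<close>, call the edges between layers
  spokes, and let \<open>S\<close> be the subgroup of the units modulo \<open>p\<close> from which the connection sets
  \<open>r\<^sup>i S\<close> of the layers are made.

  \<^bold>\<open>Automorphisms.\<close> Every automorphism permutes the spokes. If \<open>S\<close> has more than two elements, this
  is because spokes are the edges that lie in no 4-cycle. Otherwise \<open>q = 2\<close> and \<open>S = {1, -1}\<close>, the
  graph is the generalised Petersen graph \<open>GP(p,r)\<close>, and the spokes are recognised by the cycles of
  length eight, or of length seven if \<open>p = 13\<close>, through the paths around an edge. An automorphism
  that permutes the spokes is a product map \<open>(i, j) \<mapsto> (\<sigma> i, f j)\<close>. Up to a factor \<open>r\<^sup>c\<close> the map \<open>f\<close>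
  preserves the relation "the difference lies in \<open>S\<close>" on the field with \<open>p\<close> elements, and such a
  map is affine, \<open>f j = a j + b\<close>; this is the heart of Burnside's theorem on permutation groups of
  prime degree, and \<open>difference_preserving_imp_affine\<close> gives it the polynomial proof of P. Mueller.

  \<^bold>\<open>No symmetry.\<close> If a Hamilton cycle is \<open>k\<close>-symmetric with \<open>k \<ge> 2\<close>, then it is \<open>l\<close>-symmetric for
  a prime \<open>l\<close> dividing the order \<open>p q\<close>, by an automorphism \<open>\<alpha>\<close> of order \<open>l\<close> without fixed vertices.
  Let \<open>\<alpha>\<close> be given by \<open>\<sigma>\<close>, \<open>a\<close> and \<open>b\<close> as above; then \<open>a\<^sup>l = 1\<close>. If \<open>l = p\<close>, then \<open>a = 1\<close> and \<open>\<alpha>\<close>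
  is a translation inside the layers. Any \<open>q\<close> consecutive vertices of the cycle then lie in distinct
  layers, so the whole cycle would consist of spokes, along which the upper index does not change.
  If \<open>l = q\<close> and \<open>\<sigma> 0 = 0\<close>, then \<open>f\<close> has a fixed point, hence \<open>\<alpha>\<close> has a fixed vertex. If \<open>l = q\<close> and
  \<open>\<sigma> 0 = c \<noteq> 0\<close>, then \<open>a\<close> lies in \<open>r\<^sup>c S\<close> and has order \<open>q\<close>, which is impossible because the order
  of \<open>r\<close> is divisible by \<open>q\<^sup>2\<close> and \<open>S\<close> is contained in the group generated by \<open>r\<^sup>q\<close> and \<open>-1\<close>. This is
  \<open>no_symmetric_hamilton_cycle\<close>.

  \<^bold>\<open>Hamilton cycles.\<close> For odd \<open>q\<close> there is a cycle that passes through every layer twice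
  (\<open>hamilton_cycle_odd\<close>). For \<open>q = 2\<close> the graph contains \<open>GP(p,r)\<close>, and \<open>GP(p,\<kappa>)\<close> with \<open>p\<close> prime is
  hamiltonian unless \<open>\<kappa>\<close> is one of \<open>1\<close>, \<open>2\<close>, \<open>1/2\<close> up to sign (\<open>gp_hamiltonian_prime\<close>, a
  theorem of Bannai and Alspach in the case of prime order). The number \<open>r\<close> avoids these values: it is not a
  square modulo \<open>p\<close>, whereas \<open>-1\<close> is a square, and \<open>2\<close> is one as soon as 8 divides \<open>p - 1\<close>; if only
  4 divides \<open>p - 1\<close>, then \<open>r\<^sup>2 = -1\<close> and \<open>r = \<plusminus> 2\<close> or \<open>r = \<plusminus> 1/2\<close> would give \<open>p = 5\<close>.
\<close>

section \<open>Polynomials modulo a prime\<close>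

lemma int_poly_vanishing_mod_prime:
  fixes P :: "int poly" and p :: int
  assumes "prime p" and "finite A"
    and "\<And>a. a \<in> A \<Longrightarrow> p dvd poly P a"
    and "\<And>a b. a \<in> A \<Longrightarrow> b \<in> A \<Longrightarrow> p dvd a - b \<Longrightarrow> a = b"
    and "degree P < card A"
  shows "p dvd coeff P i"
  using assms(2-5)
proof (induction "degree P" arbitrary: P A i)
  case 0
  then obtain a where a: "a \<in> A"
    by fastforce
  from 0 obtain c where c: "P = [:c:]"
    using degree_eq_zeroE by metis
  have "p dvd c"
    using 0(3)[OF a] by (simp add: c)
  then show ?case
    by (simp add: c coeff_pCons split: nat.split)
next
  case (Suc d)
  then obtain a where a: "a \<in> A"
    by fastforce
  define Q where "Q = synthetic_div P a"
  have P: "P = [:-a, 1:] * Q + [:poly P a:]"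
    unfolding Q_def by (rule synthetic_div_correct'[symmetric])
  have dQ: "d = degree Q"
    unfolding Q_def using Suc(2) by (simp add: degree_synthetic_div)
  have Q: "p dvd poly Q b" if b: "b \<in> A - {a}" for b
  proof -
    have "poly P b = (b - a) * poly Q b + poly P a"
      by (subst P) (simp add: algebra_simps)
    then have "p dvd (b - a) * poly Q b"
      using Suc(4)[OF a] Suc(4)[of b] b by (metis DiffD1 dvd_add_left_iff)
    moreover have "\<not> p dvd b - a"
      using Suc(5)[of b a] a b by blast
    ultimately show ?thesis
      using \<open>prime p\<close> prime_dvd_mult_iff by blast
  qed
  have IH: "p dvd coeff Q j" for j
  proof (rule Suc(1)[OF dQ, of "A - {a}"])
    show "finite (A - {a})"
      using Suc(3) by simp
    show "p dvd poly Q b" if "b \<in> A - {a}" for b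
      using Q that .
    show "b = c" if "b \<in> A - {a}" "c \<in> A - {a}" "p dvd b - c" for b c
      using Suc(5) that by blast
    show "degree Q < card (A - {a})"
      using Suc(2,3,6) a dQ by simp
  qed
  have "p dvd poly P a"
    using Suc(4) a .
  then show ?case
    using IH by (subst P) (auto simp: coeff_pCons split: nat.split)
qed

lemma int_poly_zero_on_residues:
  fixes P :: "int poly" and p :: nat
  assumes "prime p" and "\<And>x. int p dvd poly P x" and "degree P < p"
  shows "int p dvd coeff P i"
proof (rule int_poly_vanishing_mod_prime[of "int p" "{0..<int p}"])
  show "a = b" if "a \<in> {0..<int p}" "b \<in> {0..<int p}" "int p dvd a - b" for a b
    using that by (simp add: mod_eq_dvd_iff[symmetric])
qed (use assms in auto)

lemma fermat_int:
  fixes x :: int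
  assumes "prime p" and "\<not> int p dvd x"
  shows "[x ^ (p - 1) = 1] (mod int p)"
proof -
  interpret residues_prime p "residue_ring (int p)"
    by unfold_locales (use assms(1) in auto)
  have "coprime x (int p)"
    using assms prime_imp_coprime[of "int p" x] by (simp add: ac_simps)
  then show ?thesis
    using euler_theorem[of x] \<open>prime p\<close> by (simp add: totient_prime)
qed

text \<open>The reduced polynomial of a function on the residues modulo \<open>p\<close> is handled through integer
  polynomials that take the right values modulo \<open>p\<close>; its degree is that of a representative with
  degree below \<open>p\<close> and leading coefficient prime to \<open>p\<close>.\<close>

definition represents :: "nat \<Rightarrow> int poly \<Rightarrow> (int \<Rightarrow> int) \<Rightarrow> bool" where
  "represents p H h \<longleftrightarrow> (\<forall>x. [poly H x = h x] (mod int p))"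

lemma lagrange_mod_prime:
  assumes "prime p" and per: "\<And>x y. [x = y] (mod int p) \<Longrightarrow> [h x = h y] (mod int p)"
  shows "\<exists>H. represents p H h"
proof -
  define H where "H = (\<Sum>a\<in>{0..<int p}. [:h a:] * (1 - [:-a, 1:] ^ (p - 1)))"
  have p1: "p > 1"
    using \<open>prime p\<close> prime_gt_1_nat by blast
  have "[poly H x = h x] (mod int p)" for x
  proof -
    define z where "z = x mod int p"
    have z: "z \<in> {0..<int p}"
      using p1 by (simp add: z_def)
    have "poly H x = (\<Sum>a\<in>{0..<int p}. h a * (1 - (x - a) ^ (p - 1)))"
      by (simp add: H_def poly_sum)
    also have "[\<dots> = (\<Sum>a\<in>{0..<int p}. if a = z then h a else 0)] (mod int p)"
    proof (rule cong_sum)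
      fix a assume a: "a \<in> {0..<int p}"
      show "[h a * (1 - (x - a) ^ (p - 1)) = (if a = z then h a else 0)] (mod int p)"
      proof (cases "a = z")
        case True
        then have "int p dvd x - a"
          by (simp add: z_def minus_mod_eq_mult_div)
        then have "int p dvd (x - a) ^ (p - 1)"
          using p1 dvd_power[of "p - 1" "x - a"] by (meson dvd_trans zero_less_diff)
        then have "int p dvd h a * (x - a) ^ (p - 1)" by simp
        then show ?thesis
          using True by (simp add: cong_iff_dvd_diff right_diff_distrib)
      next
        case False
        have "\<not> int p dvd x - a"
          using False a by (auto simp: z_def mod_eq_dvd_iff[symmetric])
        then have "[(x - a) ^ (p - 1) = 1] (mod int p)"
          using fermat_int[OF \<open>prime p\<close>] by blast
        then have "[h a * (1 - (x - a) ^ (p - 1)) = h a * (1 - 1)] (mod int p)"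
          by (intro cong_mult cong_diff cong_refl)
        then show ?thesis
          using False by simp
      qed
    qed
    also have "(\<Sum>a\<in>{0..<int p}. if a = z then h a else 0) = h z"
      using z by simp
    also have "[h z = h x] (mod int p)"
      by (rule per) (simp add: z_def)
    finally show ?thesis .
  qed
  then show ?thesis
    unfolding represents_def by blast
qed

text \<open>A representative of least degree will do: a leading coefficient divisible by \<open>p\<close> could be
  dropped, and a leading power \<open>x\<^sup>d\<close> with \<open>d \<ge> p\<close> could be replaced by \<open>x\<close> to the power \<open>d - p + 1\<close>.\<close>

lemma reduced_representative:
  assumes "prime p" and per: "\<And>x y. [x = y] (mod int p) \<Longrightarrow> [h x = h y] (mod int p)"
  obtains H where "represents p H h" "degree H < p" "H \<noteq> 0 \<Longrightarrow> \<not> int p dvd lead_coeff H"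
proof -
  have p1: "p > 1"
    using \<open>prime p\<close> prime_gt_1_nat by blast
  obtain H where H: "represents p H h"
    and min: "\<And>K. represents p K h \<Longrightarrow> length (coeffs H) \<le> length (coeffs K)"
    using lagrange_mod_prime[of p h, OF assms]
      ex_has_least_nat[of "\<lambda>H. represents p H h" _ "\<lambda>H. length (coeffs H)"]
    by blast
  have smaller: "length (coeffs H) \<le> length (coeffs (H - (monom (lead_coeff H) (degree H) - M)))"
    if "\<And>x. int p dvd poly (monom (lead_coeff H) (degree H) - M) x" for M
  proof (rule min)
    show "represents p (H - (monom (lead_coeff H) (degree H) - M)) h"
      unfolding represents_def
    proof
      fix x
      have "[poly H x - poly (monom (lead_coeff H) (degree H) - M) x = h x - 0] (mod int p)"
        using H that[of x] unfolding represents_def by (intro cong_diff) (auto simp: cong_0_iff)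
      then show "[poly (H - (monom (lead_coeff H) (degree H) - M)) x = h x] (mod int p)"
        by simp
    qed
  qed
  have drop: "length (coeffs (H - (monom (lead_coeff H) (degree H) - M))) < length (coeffs H)"
    if "H \<noteq> 0" "M = 0 \<or> degree M < degree H" for M
  proof -
    define K where "K = H - (monom (lead_coeff H) (degree H) - M)"
    have "coeff K i = 0" if i: "i \<ge> degree H" for i
      using i \<open>M = 0 \<or> degree M < degree H\<close>
      by (cases "i = degree H") (auto simp: K_def coeff_eq_0 coeff_monom)
    then have "K = 0 \<or> degree K < degree H"
      by (metis leading_coeff_0_iff not_le)
    then show ?thesis
      using \<open>H \<noteq> 0\<close> by (cases "K = 0") (auto simp: K_def[symmetric] length_coeffs)
  qed
  have lead: "\<not> int p dvd lead_coeff H" if "H \<noteq> 0"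
  proof
    assume d: "int p dvd lead_coeff H"
    have "length (coeffs H) \<le> length (coeffs (H - (monom (lead_coeff H) (degree H) - 0)))"
      by (rule smaller) (use d in \<open>simp add: poly_monom\<close>)
    then show False
      using drop[OF that, of 0] by simp
  qed
  have deg: "degree H < p"
  proof (rule ccontr)
    assume "\<not> degree H < p"
    then have dH: "p \<le> degree H" by simp
    then have "H \<noteq> 0" using p1 by auto
    define M where "M = monom (lead_coeff H) (degree H - p + 1)"
    have fer: "[x ^ p = x] (mod int p)" for x :: int
    proof (cases "int p dvd x")
      case True
      then have "int p dvd x ^ p" using p1 dvd_power[of p x] by (meson dvd_trans less_trans zero_less_one)
      then show ?thesis using True by (simp add: cong_iff_dvd_diff)
    next
      case False
      have "[x * x ^ (p - 1) = x * 1] (mod int p)"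
        using fermat_int[OF \<open>prime p\<close> False] by (intro cong_mult cong_refl)
      then show ?thesis using p1 by (simp add: power_eq_if[of x p])
    qed
    have "int p dvd poly (monom (lead_coeff H) (degree H) - M) x" for x
    proof -
      have "[lead_coeff H * (x ^ (degree H - p) * x ^ p) = lead_coeff H * (x ^ (degree H - p) * x)] (mod int p)"
        by (intro cong_mult cong_refl fer)
      moreover have "x ^ (degree H - p) * x ^ p = x ^ degree H"
        using dH by (simp add: power_add[symmetric])
      ultimately show ?thesis
        by (simp add: M_def poly_monom cong_iff_dvd_diff mult.commute)
    qed
    then have "length (coeffs H) \<le> length (coeffs (H - (monom (lead_coeff H) (degree H) - M)))"
      by (rule smaller)
    moreover have "degree M < degree H"
      using dH p1 degree_monom_le[of "lead_coeff H" "degree H - p + 1"] by (simp add: M_def)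
    ultimately show False
      using drop[OF \<open>H \<noteq> 0\<close>, of M] by simp
  qed
  show thesis
    using that[OF H deg lead] .
qed

lemma represents_power: "represents p H h \<Longrightarrow> represents p (H ^ k) (\<lambda>x. h x ^ k)"
  unfolding represents_def by (simp add: cong_pow)

lemma represents_unique_coeff:
  assumes "prime p" "represents p H h" "represents p K h" "degree H < p" "degree K < p"
  shows "[coeff H i = coeff K i] (mod int p)"
proof -
  have "int p dvd coeff (H - K) i"
  proof (rule int_poly_zero_on_residues[OF \<open>prime p\<close>])
    show "int p dvd poly (H - K) x" for x
    proof -
      have "[poly H x = poly K x] (mod int p)"
        using assms(2,3) unfolding represents_def by (meson cong_sym cong_trans)
      then show ?thesis
        by (simp add: cong_iff_dvd_diff)
    qed
    show "degree (H - K) < p"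
      using assms(4,5) degree_diff_less by blast
  qed
  then show ?thesis
    by (simp add: cong_iff_dvd_diff)
qed

section \<open>Maps that preserve differences in a multiplicative subgroup\<close>

locale unit_subgroup =
  fixes p :: nat and S :: "int set"
  assumes p_prime: "prime p"
    and S_sub: "S \<subseteq> {1..<int p}"
    and S_one: "1 \<in> S"
    and S_mult: "\<And>x y. x \<in> S \<Longrightarrow> y \<in> S \<Longrightarrow> (x * y) mod int p \<in> S"
begin

lemma p_gt_1: "1 < p"
  using p_prime prime_gt_1_nat by blast

lemma prime_int_p: "prime (int p)"
  using p_prime by simp

lemma finite_S [simp]: "finite S"
  using S_sub finite_subset by blast

lemma S_not_dvd: "s \<in> S \<Longrightarrow> \<not> int p dvd s"
  using S_sub zdvd_imp_le by fastforce

lemma S_mod: "s \<in> S \<Longrightarrow> s mod int p = s"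
  using S_sub by auto

lemma S_cong_eq: "s \<in> S \<Longrightarrow> s' \<in> S \<Longrightarrow> [s = s'] (mod int p) \<Longrightarrow> s = s'"
  by (metis S_mod cong_def)

lemma card_S_pos: "0 < card S"
  using S_one by (auto simp: card_gt_0_iff)

lemma bij_mult_S:
  assumes t: "t \<in> S"
  shows "bij_betw (\<lambda>s. (t * s) mod int p) S S"
proof -
  have "inj_on (\<lambda>s. (t * s) mod int p) S"
  proof (rule inj_onI)
    fix x y assume "x \<in> S" "y \<in> S" "(t * x) mod int p = (t * y) mod int p"
    moreover have "coprime t (int p)"
      using S_not_dvd[OF t] prime_int_p prime_imp_coprime coprime_commute by blast
    ultimately show "x = y"
      by (metis S_cong_eq cong_def cong_mult_lcancel)
  qed
  moreover have "(\<lambda>s. (t * s) mod int p) ` S \<subseteq> S"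
    using S_mult[OF t] by auto
  ultimately show ?thesis
    by (simp add: bij_betw_def endo_inj_surj)
qed

lemma sum_mult_S:
  assumes "t \<in> S"
  shows "[(\<Sum>s\<in>S. (t * s) ^ w) = (\<Sum>s\<in>S. s ^ w)] (mod int p)"
proof -
  have "(\<Sum>s\<in>S. s ^ w) = (\<Sum>s\<in>S. ((t * s) mod int p) ^ w)"
    using sum.reindex_bij_betw[OF bij_mult_S[OF assms], of "\<lambda>s. s ^ w"] by simp
  moreover have "[(\<Sum>s\<in>S. (t * s) ^ w) = (\<Sum>s\<in>S. ((t * s) mod int p) ^ w)] (mod int p)"
    by (intro cong_sum cong_pow) (simp add: cong_def)
  ultimately show ?thesis by simp
qed

lemma S_power_card:
  assumes t: "t \<in> S"
  shows "[t ^ card S = 1] (mod int p)"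
proof -
  have "(\<Prod>s\<in>S. s) = (\<Prod>s\<in>S. (t * s) mod int p)"
    using prod.reindex_bij_betw[OF bij_mult_S[OF t], of "\<lambda>s. s"] by simp
  moreover have "[(\<Prod>s\<in>S. (t * s) mod int p) = (\<Prod>s\<in>S. t * s)] (mod int p)"
    by (intro cong_prod) (simp add: cong_def)
  ultimately have "[1 * (\<Prod>s\<in>S. s) = t ^ card S * (\<Prod>s\<in>S. s)] (mod int p)"
    by (simp add: prod.distrib)
  moreover have "\<not> int p dvd (\<Prod>s\<in>S. s)"
    using S_not_dvd prime_int_p by (simp add: prime_dvd_prod_iff)
  then have "coprime (\<Prod>s\<in>S. s) (int p)"
    using prime_int_p prime_imp_coprime coprime_commute by blast
  ultimately show ?thesis
    using cong_mult_rcancel cong_sym by blast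
qed

text \<open>Multiplication by \<open>t\<close> permutes \<open>S\<close> and multiplies the power sum by \<open>t\<^sup>w\<close>. As \<open>x\<^sup>w - 1\<close> has at most
  \<open>w < |S|\<close> roots, some \<open>t\<close> in \<open>S\<close> has \<open>t\<^sup>w \<noteq> 1\<close>.\<close>

lemma power_sum_vanishes:
  assumes w: "0 < w" "w < card S"
  shows "int p dvd (\<Sum>s\<in>S. s ^ w)"
proof -
  have "\<exists>t\<in>S. \<not> int p dvd t ^ w - 1"
  proof (rule ccontr)
    assume none: "\<not> ?thesis"
    define P :: "int poly" where "P = monom 1 w - 1"
    have "int p dvd coeff P w"
    proof (rule int_poly_vanishing_mod_prime[OF prime_int_p finite_S])
      show "int p dvd poly P a" if "a \<in> S" for a
        using none that by (auto simp: P_def poly_monom)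
      show "a = b" if "a \<in> S" "b \<in> S" "int p dvd a - b" for a b
        using S_cong_eq that by (simp add: cong_iff_dvd_diff)
      have "degree P \<le> w"
        unfolding P_def by (rule degree_diff_le) (auto simp: degree_monom_le)
      then show "degree P < card S"
        using w by simp
    qed
    moreover have "coeff P w = 1"
      using w by (simp add: P_def)
    ultimately show False
      using prime_int_p not_prime_unit by fastforce
  qed
  then obtain t where t: "t \<in> S" "\<not> int p dvd t ^ w - 1"
    by blast
  have "[t ^ w * (\<Sum>s\<in>S. s ^ w) = (\<Sum>s\<in>S. s ^ w)] (mod int p)"
    using sum_mult_S[OF t(1), of w] by (simp add: power_mult_distrib sum_distrib_left)
  then have "int p dvd (t ^ w - 1) * (\<Sum>s\<in>S. s ^ w)"
    by (simp add: cong_iff_dvd_diff algebra_simps)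
  then show ?thesis
    using t(2) prime_int_p prime_dvd_mult_iff by blast
qed

lemma power_sum_card: "[(\<Sum>s\<in>S. s ^ card S) = int (card S)] (mod int p)"
proof -
  have "[(\<Sum>s\<in>S. s ^ card S) = (\<Sum>s\<in>S. 1)] (mod int p)"
    by (intro cong_sum S_power_card)
  then show ?thesis by simp
qed

lemma card_S_less: "card S < p"
proof -
  have "card S \<le> card {1..<int p}"
    using S_sub by (intro card_mono) auto
  then show ?thesis
    using p_gt_1 by simp
qed

text \<open>Let \<open>m = |S|\<close> and let \<open>H\<close> have degree \<open>e\<close>. In \<open>\<Sum>s\<in>S. H (x + s)\<close> the power sums of exponents
  \<open>1, \<dots>, m - 1\<close> vanish, so that the operation \<open>H \<mapsto> (\<Sum>s\<in>S. H (x + s)) - m H\<close> lowers the degree by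
  exactly \<open>m\<close> when \<open>m \<le> e < p\<close>. Hence it can annihilate only polynomials of degree below \<open>m\<close>.\<close>

lemma fixed_by_averaging_imp_degree_less:
  assumes H: "represents p H h" "degree H < p" "H \<noteq> 0 \<Longrightarrow> \<not> int p dvd lead_coeff H"
    and avg: "\<And>x. [(\<Sum>s\<in>S. h (x + s)) = int (card S) * h x] (mod int p)"
  shows "degree H < card S"
proof (rule ccontr)
  define m e where "m = card S" and "e = degree H"
  assume "\<not> degree H < card S"
  then have me: "m \<le> e" by (simp add: m_def e_def)
  then have "H \<noteq> 0"
    using card_S_pos by (auto simp: m_def e_def)
  then have lead: "\<not> int p dvd coeff H e"
    using H(3) by (simp add: e_def)
  define \<sigma> where "\<sigma> w = (\<Sum>s\<in>S. s ^ w)" for w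
  define N where "N = (\<Sum>j\<le>e. \<Sum>i\<le>j. monom (coeff H j * of_nat (j choose i) * \<sigma> (j - i)) i) - smult (int m) H"
  have polyN: "poly N x = (\<Sum>s\<in>S. poly H (x + s)) - int m * poly H x" for x
  proof -
    have "(\<Sum>s\<in>S. poly H (x + s)) = (\<Sum>s\<in>S. \<Sum>j\<le>e. coeff H j * (x + s) ^ j)"
      by (simp add: poly_altdef e_def)
    also have "\<dots> = (\<Sum>s\<in>S. \<Sum>j\<le>e. \<Sum>i\<le>j. coeff H j * (of_nat (j choose i) * x ^ i * s ^ (j - i)))"
      by (simp add: binomial_ring sum_distrib_left)
    also have "\<dots> = (\<Sum>j\<le>e. \<Sum>s\<in>S. \<Sum>i\<le>j. coeff H j * (of_nat (j choose i) * x ^ i * s ^ (j - i)))"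
      by (rule sum.swap)
    also have "\<dots> = (\<Sum>j\<le>e. \<Sum>i\<le>j. \<Sum>s\<in>S. coeff H j * (of_nat (j choose i) * x ^ i * s ^ (j - i)))"
      by (intro sum.cong refl sum.swap)
    also have "\<dots> = (\<Sum>j\<le>e. \<Sum>i\<le>j. coeff H j * of_nat (j choose i) * \<sigma> (j - i) * x ^ i)"
      by (simp add: \<sigma>_def sum_distrib_left sum_distrib_right algebra_simps)
    finally show ?thesis
      by (simp add: N_def poly_sum poly_monom)
  qed
  have "int p dvd coeff N (e - m)"
  proof (rule int_poly_zero_on_residues[OF p_prime])
    show "int p dvd poly N x" for x
    proof -
      have "[(\<Sum>s\<in>S. poly H (x + s)) = (\<Sum>s\<in>S. h (x + s))] (mod int p)"
        using H(1) by (intro cong_sum) (simp add: represents_def)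
      moreover have "[int m * poly H x = int m * h x] (mod int p)"
        using H(1) by (intro cong_mult cong_refl) (simp add: represents_def)
      ultimately have "[(\<Sum>s\<in>S. poly H (x + s)) = int m * poly H x] (mod int p)"
        using avg[of x] unfolding m_def by (meson cong_sym cong_trans)
      then show ?thesis
        by (simp add: polyN cong_iff_dvd_diff)
    qed
    have "degree N \<le> e"
      unfolding N_def
    proof (intro degree_diff_le degree_sum_le)
      fix j i assume "j \<in> {..e}" "i \<in> {..j}"
      then show "degree (monom (coeff H j * of_nat (j choose i) * \<sigma> (j - i)) i) \<le> e"
        using degree_monom_le[of "coeff H j * of_nat (j choose i) * \<sigma> (j - i)" i] by simp
    qed (auto simp: e_def)
    then show "degree N < p"
      using H(2) by (simp add: e_def)
  qed
  \<comment> \<open>In the coefficient of degree \<open>e - m\<close> only the power sums of exponents \<open>0\<close> and \<open>m\<close> survive,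
    and the former is cancelled by \<open>int m * H\<close>.\<close>
  moreover have "[coeff N (e - m) = coeff H e * int (e choose (e - m)) * int m] (mod int p)"
  proof -
    define c where "c = coeff H e * int (e choose (e - m)) * int m"
    define A where "A j = (if e - m \<le> j then coeff H j * int (j choose (e - m)) * \<sigma> (j - (e - m)) else 0)" for j
    define B where "B j = (if j = e - m then coeff H j * int m else 0) + (if j = e then c else 0)" for j
    have m0: "0 < m"
      using card_S_pos by (simp add: m_def)
    have N: "coeff N (e - m) = (\<Sum>j\<le>e. A j) - int m * coeff H (e - m)"
      by (simp add: N_def A_def coeff_sum)
    have AB: "[(\<Sum>j\<le>e. A j) = (\<Sum>j\<le>e. B j)] (mod int p)"
    proof (rule cong_sum)
      fix j assume j: "j \<in> {..e}"
      consider "j < e - m" | "j = e - m" | "e - m < j" "j < e" | "j = e"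
        using j by fastforce
      then show "[A j = B j] (mod int p)"
      proof cases
        case 3
        then have "int p dvd \<sigma> (j - (e - m))"
          unfolding \<sigma>_def by (intro power_sum_vanishes) (auto simp: m_def)
        then show ?thesis
          using 3 by (simp add: A_def B_def cong_0_iff)
      next
        case 4
        have "[\<sigma> m = int m] (mod int p)"
          unfolding \<sigma>_def m_def by (rule power_sum_card)
        then show ?thesis
          using 4 me m0 by (auto simp: A_def B_def c_def intro!: cong_mult)
      qed (use me m0 in \<open>auto simp: A_def B_def \<sigma>_def m_def\<close>)
    qed
    have B: "(\<Sum>j\<le>e. B j) = coeff H (e - m) * int m + c"
    proof -
      have 1: "(\<Sum>j\<le>e. if j = e - m then coeff H j * int m else 0) = coeff H (e - m) * int m"
        by (subst sum.delta) auto
      have 2: "(\<Sum>j\<le>e. if j = e then c else 0) = c"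
        by (subst sum.delta) auto
      show ?thesis
        unfolding B_def sum.distrib 1 2 ..
    qed
    have "[coeff N (e - m) = c] (mod int p)"
      using cong_diff[OF AB cong_refl[of "int m * coeff H (e - m)"]] by (simp add: N B)
    then show ?thesis
      by (simp add: c_def)
  qed
  ultimately have "int p dvd coeff H e * int (e choose (e - m)) * int m"
    by (metis cong_dvd_iff)
  moreover have "\<not> int p dvd int m"
    using card_S_pos card_S_less by (auto simp: m_def dest: nat_dvd_not_less)
  moreover have "\<not> p dvd (e choose (e - m))"
  proof
    assume "p dvd (e choose (e - m))"
    then have "p dvd fact e"
      by (metis binomial_fact_lemma diff_le_self dvd_mult)
    then show False
      using H(2) p_prime by (simp add: prime_dvd_fact_iff e_def)
  qed
  ultimately show False
    using lead prime_int_p by (auto simp: prime_dvd_mult_iff)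
qed

text \<open>For fixed \<open>x\<close> the differences \<open>g (x + s) - g x\<close> run through \<open>S\<close>. Therefore the sum of
  \<open>g (x + s)\<^sup>k\<close> over \<open>s \<in> S\<close> equals that of \<open>(g x + s)\<^sup>k\<close>, which is \<open>m (g x)\<^sup>k\<close> for \<open>k < m = |S|\<close>. By the
  preceding lemma all the powers \<open>g\<^sup>k\<close> with \<open>k < m\<close> have reduced degree below \<open>m\<close>. If \<open>g\<close> had degree
  \<open>d \<ge> 2\<close>, then the least \<open>k\<close> with \<open>d k \<ge> m\<close> would satisfy \<open>k < m\<close> and \<open>d k < 2 m < p\<close>, so that \<open>g\<^sup>k\<close>
  would have reduced degree \<open>d k \<ge> m\<close>.\<close>

theorem difference_preserving_imp_affine:
  assumes g: "\<And>x y. [g x = g y] (mod int p) \<longleftrightarrow> [x = y] (mod int p)"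
    and diff: "\<And>x s. s \<in> S \<Longrightarrow> (g (x + s) - g x) mod int p \<in> S"
    and m2: "2 \<le> card S" "2 * card S < p"
  obtains a b where "\<And>x. [g x = a * x + b] (mod int p)"
proof -
  define m where "m = card S"
  have avg: "[(\<Sum>s\<in>S. g (x + s) ^ k) = int m * g x ^ k] (mod int p)" if k: "k < m" for x k
  proof -
    define \<phi> where "\<phi> s = (g (x + s) - g x) mod int p" for s
    have "inj_on \<phi> S"
    proof (rule inj_onI)
      fix s s' assume s: "s \<in> S" "s' \<in> S" "\<phi> s = \<phi> s'"
      then have "[g (x + s) - g x = g (x + s') - g x] (mod int p)"
        by (simp add: \<phi>_def cong_def)
      then have "[g (x + s) - g x + g x = g (x + s') - g x + g x] (mod int p)"
        by (rule cong_add[OF _ cong_refl])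
      then have "[g (x + s) = g (x + s')] (mod int p)"
        by simp
      then have "[s = s'] (mod int p)"
        using g cong_add_lcancel by blast
      then show "s = s'"
        using s S_cong_eq by blast
    qed
    moreover have "\<phi> ` S \<subseteq> S"
      using diff by (auto simp: \<phi>_def)
    ultimately have bij: "bij_betw \<phi> S S"
      by (simp add: bij_betw_def endo_inj_surj)
    have "[(\<Sum>s\<in>S. g (x + s) ^ k) = (\<Sum>s\<in>S. (g x + \<phi> s) ^ k)] (mod int p)"
    proof (intro cong_sum cong_pow)
      fix s
      have "[g (x + s) - g x = \<phi> s] (mod int p)"
        by (simp add: \<phi>_def cong_def)
      then have "[g x + (g (x + s) - g x) = g x + \<phi> s] (mod int p)"
        by (rule cong_add[OF cong_refl])
      then show "[g (x + s) = g x + \<phi> s] (mod int p)"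
        by simp
    qed
    also have "(\<Sum>s\<in>S. (g x + \<phi> s) ^ k) = (\<Sum>s\<in>S. (g x + s) ^ k)"
      using sum.reindex_bij_betw[OF bij, of "\<lambda>s. (g x + s) ^ k"] .
    also have "\<dots> = (\<Sum>s\<in>S. \<Sum>i\<le>k. of_nat (k choose i) * g x ^ i * s ^ (k - i))"
      by (simp add: binomial_ring)
    also have "\<dots> = (\<Sum>i\<le>k. \<Sum>s\<in>S. of_nat (k choose i) * g x ^ i * s ^ (k - i))"
      by (rule sum.swap)
    also have "\<dots> = (\<Sum>i\<le>k. of_nat (k choose i) * g x ^ i * (\<Sum>s\<in>S. s ^ (k - i)))"
      by (simp add: sum_distrib_left)
    also have "[\<dots> = (\<Sum>i\<le>k. if i = k then int m * g x ^ k else 0)] (mod int p)"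
    proof (rule cong_sum)
      fix i assume i: "i \<in> {..k}"
      show "[of_nat (k choose i) * g x ^ i * (\<Sum>s\<in>S. s ^ (k - i)) = (if i = k then int m * g x ^ k else 0)] (mod int p)"
      proof (cases "i = k")
        case True
        then show ?thesis by (simp add: m_def mult.commute)
      next
        case False
        then have "int p dvd (\<Sum>s\<in>S. s ^ (k - i))"
          using i k by (intro power_sum_vanishes) (auto simp: m_def)
        then show ?thesis
          using False by (simp add: cong_0_iff)
      qed
    qed
    also have "(\<Sum>i\<le>k. if i = k then int m * g x ^ k else 0) = int m * g x ^ k"
      by simp
    finally show ?thesis .
  qed
  have per: "[g x ^ k = g y ^ k] (mod int p)" if "[x = y] (mod int p)" for x y k
    using g that by (blast intro: cong_pow)
  obtain G where G: "represents p G g" "degree G < p" "G \<noteq> 0 \<Longrightarrow> \<not> int p dvd lead_coeff G"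
    using reduced_representative[OF p_prime, of g] per[of _ _ 1] by auto
  define d where "d = degree G"
  have bound: "d * k < m" if k: "k < m" and dk: "d * k < p" for k
  proof -
    obtain H where H: "represents p H (\<lambda>x. g x ^ k)" "degree H < p" "H \<noteq> 0 \<Longrightarrow> \<not> int p dvd lead_coeff H"
      using reduced_representative[OF p_prime, of "\<lambda>x. g x ^ k"] per by blast
    have Hm: "degree H < m"
      using fixed_by_averaging_imp_degree_less[OF H] avg[OF k] by (auto simp: m_def)
    show ?thesis
    proof (cases "G = 0")
      case True
      then show ?thesis using k by (simp add: d_def)
    next
      case False
      have deg: "degree (G ^ k) = d * k"
        using False by (simp add: degree_power_eq d_def mult.commute)
      have "[coeff (G ^ k) (d * k) = coeff H (d * k)] (mod int p)"
        using represents_unique_coeff[OF p_prime represents_power[OF G(1)] H(1)] deg dk H(2) by simp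
      moreover have "\<not> int p dvd coeff (G ^ k) (d * k)"
      proof -
        have "coeff (G ^ k) (d * k) = lead_coeff G ^ k"
          using deg lead_coeff_power[of G k] by simp
        then show ?thesis
          using G(3)[OF False] prime_int_p prime_dvd_power by metis
      qed
      ultimately have "coeff H (d * k) \<noteq> 0"
        by (metis cong_dvd_iff dvd_0_right)
      then show ?thesis
        using Hm le_degree le_less_trans by blast
    qed
  qed
  have dm: "d < m"
    using bound[of 1] m2 G(2) by (simp add: m_def d_def)
  have "d < 2"
  proof (rule ccontr)
    assume "\<not> d < 2"
    then have d2: "2 \<le> d" by simp
    define k where "k = (m - 1) div d + 1"
    have "(m - 1) div d \<le> (m - 1) div 2"
      using d2 by (simp add: div_le_mono2)
    then have "k < m"
      using m2 unfolding k_def m_def by linarith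
    have "d * ((m - 1) div d) + (m - 1) mod d = m - 1"
      by (rule mult_div_mod_eq)
    moreover have "(m - 1) mod d < d"
      using d2 by simp
    moreover have "d * k = d * ((m - 1) div d) + d"
      by (simp add: k_def)
    ultimately have "m \<le> d * k" "d * k \<le> m - 1 + d"
      by linarith+
    then show False
      using bound[OF \<open>k < m\<close>] dm m2 unfolding m_def by linarith
  qed
  then have "coeff G i = 0" if "i \<ge> 2" for i
    using that by (simp add: coeff_eq_0 d_def)
  then have "G = [:coeff G 0, coeff G 1:]"
    by (intro poly_eqI) (auto simp: coeff_pCons split: nat.split)
  then have "poly G x = coeff G 1 * x + coeff G 0" for x
    by (metis add.commute add_0_right mult.commute mult_zero_left poly_0 poly_pCons)
  then show thesis
    using that[of "coeff G 1" "coeff G 0"] G(1) unfolding represents_def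
    by (metis cong_sym)
qed

end

section \<open>Layered graphs and their automorphisms\<close>

text \<open>The last assumption is the only arithmetic of \<open>r\<close> that the symmetry argument needs. It implies
  in particular that the cosets \<open>r\<^sup>0 S, \<dots>, r\<close> to the power \<open>q - 1\<close> times \<open>S\<close> are distinct.\<close>

locale layered = unit_subgroup p S for p :: nat and S :: "int set" +
  fixes q :: nat and r :: int
  assumes q_prime: "prime q"
    and q_less_p: "q < p"
    and r_range: "r \<in> {1..<int p}"
    and S_neg: "\<And>x. x \<in> S \<Longrightarrow> (- x) mod int p \<in> S"
    and r_power_S: "\<And>c s. 0 < c \<Longrightarrow> c < q \<Longrightarrow> s \<in> S \<Longrightarrow> \<not> [(r ^ c * s) ^ q = 1] (mod int p)"
begin

lemma q_gt_1: "1 < q"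
  using q_prime prime_gt_1_nat by blast

abbreviation X :: "(int \<times> int) ugraph" where
  "X \<equiv> layered_graph q p r S"

definition V :: "(int \<times> int) set" where
  "V = {0..<int q} \<times> {0..<int p}"

lemma mem_V [simp]: "(i, j) \<in> V \<longleftrightarrow> i \<in> {0..<int q} \<and> j \<in> {0..<int p}"
  by (simp add: V_def)

definition connects :: "int \<Rightarrow> int \<Rightarrow> bool" where
  "connects i d \<longleftrightarrow> (\<exists>s\<in>S. [d = r ^ nat i * s] (mod int p))"

definition adj :: "int \<times> int \<Rightarrow> int \<times> int \<Rightarrow> bool" where
  "adj u v \<longleftrightarrow> u \<in> V \<and> v \<in> V \<and> {u, v} \<in> edges X"

lemma r_not_dvd: "\<not> int p dvd r ^ n"
proof
  assume "int p dvd r ^ n"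
  then have "int p dvd r"
    using prime_int_p prime_dvd_power by blast
  then show False
    using r_range zdvd_imp_le[of "int p" r] by auto
qed

lemma coprime_r: "coprime (r ^ n) (int p)"
  using r_not_dvd prime_int_p prime_imp_coprime coprime_commute by blast

lemma S_inverse:
  assumes "s \<in> S"
  obtains s' where "s' \<in> S" "[s * s' = 1] (mod int p)"
proof -
  have "1 \<in> (\<lambda>t. (s * t) mod int p) ` S"
    using bij_mult_S[OF assms] S_one by (simp add: bij_betw_def)
  then obtain t where "t \<in> S" "1 = (s * t) mod int p"
    by blast
  then show thesis
    using that[of t] p_gt_1 by (simp add: cong_def)
qed

lemma r_power_notin_S:
  assumes "0 < c" "c < q" "s \<in> S"
  shows "\<not> [r ^ c = s] (mod int p)" "\<not> [r ^ c * s = 1] (mod int p)"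
proof -
  have *: "\<not> [r ^ c * s = 1] (mod int p)" if "s \<in> S" for s
    using r_power_S[OF assms(1,2) that] cong_pow[of "r ^ c * s" 1 "int p" q] by auto
  then show "\<not> [r ^ c * s = 1] (mod int p)"
    using assms(3) .
  show "\<not> [r ^ c = s] (mod int p)"
  proof
    assume "[r ^ c = s] (mod int p)"
    obtain s' where s': "s' \<in> S" "[s * s' = 1] (mod int p)"
      using S_inverse[OF assms(3)] .
    have "[r ^ c * s' = 1] (mod int p)"
      using cong_mult[OF \<open>[r ^ c = s] (mod int p)\<close> cong_refl[of s']] s'(2) by (rule cong_trans)
    then show False
      using *[OF s'(1)] by blast
  qed
qed

lemma connects_cong: "[d = d'] (mod int p) \<Longrightarrow> connects i d \<longleftrightarrow> connects i d'"
  unfolding connects_def by (metis cong_def)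

lemma connects_uminus_imp: "connects i d \<Longrightarrow> connects i (- d)"
proof -
  assume "connects i d"
  then obtain s where s: "s \<in> S" "[d = r ^ nat i * s] (mod int p)"
    by (auto simp: connects_def)
  have "[- d = - (r ^ nat i * s)] (mod int p)"
    using s(2) by (simp add: cong_minus_minus_iff)
  also have "- (r ^ nat i * s) = r ^ nat i * (- s)"
    by simp
  also have "[r ^ nat i * (- s) = r ^ nat i * ((- s) mod int p)] (mod int p)"
    by (intro cong_mult cong_refl) (simp add: cong_def)
  finally show ?thesis
    using S_neg[OF s(1)] by (auto simp: connects_def)
qed

lemma connects_uminus: "connects i (- d) \<longleftrightarrow> connects i d"
  using connects_uminus_imp[of i d] connects_uminus_imp[of i "- d"] by auto

lemma connects_minus_commute: "connects i (x - y) \<longleftrightarrow> connects i (y - x)"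
  using connects_uminus[of i "x - y"] by simp

lemma not_connects_0: "\<not> connects i 0"
proof
  assume "connects i 0"
  then obtain s where s: "s \<in> S" "[0 = r ^ nat i * s] (mod int p)"
    by (auto simp: connects_def)
  then have "int p dvd r ^ nat i * s"
    by (metis cong_0_iff cong_sym)
  then show False
    using r_not_dvd S_not_dvd[OF s(1)] prime_int_p by (simp add: prime_dvd_mult_iff)
qed

lemma connects_power: "connects i (r ^ nat i * s)" if "s \<in> S"
  using that cong_refl unfolding connects_def by blast

lemma verts_X: "verts X = V"
proof -
  interpret P: residues "int p" "Zmod p"
    by unfold_locales (use p_gt_1 in auto)
  interpret Q: residues "int q" "Zmod q"
    by unfold_locales (use q_gt_1 in auto)
  show ?thesis
    by (auto simp: layered_graph_def P.res_carrier_eq Q.res_carrier_eq V_def)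
qed

lemma edge_X_iff:
  assumes "(i, j) \<in> V" "(i', j') \<in> V"
  shows "{(i, j), (i', j')} \<in> edges X \<longleftrightarrow>
    j = j' \<and> ((i + 1) mod int q = i' \<or> (i' + 1) mod int q = i) \<or> i = i' \<and> connects i (j' - j)"
proof -
  interpret P: residues "int p" "Zmod p"
    by unfold_locales (use p_gt_1 in auto)
  interpret Q: residues "int q" "Zmod q"
    by unfold_locales (use q_gt_1 in auto)
  have pw: "r [^]\<^bsub>Zmod p\<^esub> n = r ^ n mod int p" for n :: nat
    using P.pow_cong[of r n] r_range by simp
  have mult: "(\<otimes>\<^bsub>Zmod p\<^esub>) (r [^]\<^bsub>Zmod p\<^esub> nat i) = (\<lambda>s. (r ^ nat i * s) mod int p)" for i
    by (rule ext) (simp add: pw P.res_mult_eq mod_mult_left_eq)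
  have cp: "carrier (Zmod p) = {0..<int p}" and cq: "carrier (Zmod q) = {0..<int q}"
    by (auto simp: P.res_carrier_eq Q.res_carrier_eq)
  have E: "edges X = {{(i, j), ((i + 1) mod int q, j)} | i j. i \<in> {0..<int q} \<and> j \<in> {0..<int p}} \<union>
      {{(i, j), (i, (j + x) mod int p)} | i j x. i \<in> {0..<int q} \<and> j \<in> {0..<int p} \<and>
        x \<in> (\<lambda>s. (r ^ nat i * s) mod int p) ` S}"
    unfolding layered_graph_def by (simp only: ugraph.select_convs cp cq mult Q.res_add_eq P.res_add_eq Q.res_one_eq)
  have step: "(j + x) mod int p = j' \<longleftrightarrow> [j' - j = x] (mod int p)"
    if "j \<in> {0..<int p}" "j' \<in> {0..<int p}" for j j' x
  proof -
    have "(j + x) mod int p = j' \<longleftrightarrow> [j + x = j'] (mod int p)"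
      using that by (simp add: cong_def)
    also have "\<dots> \<longleftrightarrow> [j' - j = x] (mod int p)"
      by (simp add: cong_iff_dvd_diff) (metis (no_types, opaque_lifting) add_diff_eq diff_diff_eq dvd_minus_iff minus_diff_eq add.commute)
    finally show ?thesis .
  qed
  have layer: "(\<exists>x\<in>(\<lambda>s. (r ^ nat i * s) mod int p) ` S. (j + x) mod int p = j') \<longleftrightarrow> connects i (j' - j)"
    if "j \<in> {0..<int p}" "j' \<in> {0..<int p}" for i j j'
    using step[OF that] by (simp add: connects_def)
  have ij: "i \<in> {0..<int q}" "j \<in> {0..<int p}" "i' \<in> {0..<int q}" "j' \<in> {0..<int p}"
    using assms by auto
  have "{(i, j), (i', j')} \<in> edges X \<longleftrightarrow>
    j = j' \<and> ((i + 1) mod int q = i' \<or> (i' + 1) mod int q = i) \<or>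
    i = i' \<and> ((\<exists>x\<in>(\<lambda>s. (r ^ nat i * s) mod int p) ` S. (j + x) mod int p = j') \<or>
       (\<exists>x\<in>(\<lambda>s. (r ^ nat i * s) mod int p) ` S. (j' + x) mod int p = j))"
    unfolding E using ij by (fastforce simp: doubleton_eq_iff)
  then show ?thesis
    unfolding layer[OF ij(2,4)] layer[OF ij(4,2)] using connects_minus_commute by blast
qed

lemma adj_iff:
  "adj (i, j) (i', j') \<longleftrightarrow> (i, j) \<in> V \<and> (i', j') \<in> V \<and>
    (j = j' \<and> ((i + 1) mod int q = i' \<or> (i' + 1) mod int q = i) \<or> i = i' \<and> connects i (j' - j))"
  unfolding adj_def using edge_X_iff by blast

lemma adj_sym: "adj u v \<longleftrightarrow> adj v u"
  unfolding adj_def by (auto simp: insert_commute)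

lemma adj_D: "adj u v \<Longrightarrow> u \<in> V" "adj u v \<Longrightarrow> v \<in> V"
  by (auto simp: adj_def)

definition spoke :: "int \<times> int \<Rightarrow> int \<times> int \<Rightarrow> bool" where
  "spoke u v \<longleftrightarrow> adj u v \<and> snd u = snd v"

lemma spoke_sym: "spoke u v \<longleftrightarrow> spoke v u"
  unfolding spoke_def using adj_sym by auto

lemma succ_mod_q_neq: "i \<in> {0..<int q} \<Longrightarrow> (i + 1) mod int q \<noteq> i"
  using q_gt_1 by (cases "i + 1 = int q") auto

lemma spoke_iff:
  "spoke (i, j) (i', j') \<longleftrightarrow> (i, j) \<in> V \<and> (i', j') \<in> V \<and> j = j' \<and>
    ((i + 1) mod int q = i' \<or> (i' + 1) mod int q = i)"
  unfolding spoke_def adj_iff using not_connects_0 by auto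

lemma adj_not_spoke_iff:
  "adj (i, j) (i', j') \<and> \<not> spoke (i, j) (i', j') \<longleftrightarrow>
    (i, j) \<in> V \<and> (i', j') \<in> V \<and> i = i' \<and> connects i (j' - j)"
  unfolding spoke_iff adj_iff using not_connects_0 succ_mod_q_neq by auto

lemma spoke_layers_differ: "spoke u v \<Longrightarrow> fst u \<noteq> fst v"
  using succ_mod_q_neq by (cases u, cases v) (force simp: spoke_iff)

definition rigid :: "(int \<times> int \<Rightarrow> int \<times> int) \<Rightarrow> bool" where
  "rigid \<alpha> \<longleftrightarrow> bij_betw \<alpha> V V \<and>
     (\<forall>u\<in>V. \<forall>v\<in>V. (adj u v \<longleftrightarrow> adj (\<alpha> u) (\<alpha> v)) \<and> (spoke u v \<longleftrightarrow> spoke (\<alpha> u) (\<alpha> v)))"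

lemma r_multiples_cover:
  assumes "j \<in> {0..<int p}"
  obtains k :: nat where "j = (int k * r ^ n) mod int p"
proof -
  obtain y where y: "[r ^ n * y = 1] (mod int p)"
    using coprime_r cong_solve_coprime_int by blast
  define k where "k = nat ((y * j) mod int p)"
  have "[int k * r ^ n = (y * j) * r ^ n] (mod int p)"
    using p_gt_1 by (intro cong_mult cong_refl) (simp add: k_def cong_def)
  also have "(y * j) * r ^ n = (r ^ n * y) * j"
    by simp
  also have "[(r ^ n * y) * j = 1 * j] (mod int p)"
    using y by (intro cong_mult cong_refl)
  finally have "(int k * r ^ n) mod int p = j"
    using assms by (simp add: cong_def)
  then show thesis
    using that by metis
qed

text \<open>A layer is connected by its own edges, and these are mapped to edges inside a layer; so the
  layer of the image depends only on the layer. Spokes leave the upper index unchanged, and the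
  spokes with the same upper index form a connected column; so the upper index of the image depends
  only on the upper index.\<close>

lemma rigid_product:
  assumes "rigid \<alpha>"
  obtains \<sigma> f where "\<And>i j. (i, j) \<in> V \<Longrightarrow> \<alpha> (i, j) = (\<sigma> i, f j)"
proof -
  have img: "\<alpha> u \<in> V" if "u \<in> V" for u
    using assms that by (auto simp: rigid_def bij_betw_def)
  have spoke: "spoke u v \<longleftrightarrow> spoke (\<alpha> u) (\<alpha> v)" if "u \<in> V" "v \<in> V" for u v
    using assms that by (auto simp: rigid_def)
  have adj: "adj u v \<longleftrightarrow> adj (\<alpha> u) (\<alpha> v)" if "u \<in> V" "v \<in> V" for u v
    using assms that by (auto simp: rigid_def)
  have layer: "fst (\<alpha> (i, j)) = fst (\<alpha> (i, 0))" if ij: "(i, j) \<in> V" for i j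
  proof -
    have "fst (\<alpha> (i, (int k * r ^ nat i) mod int p)) = fst (\<alpha> (i, 0))" for k
    proof (induction k)
      case (Suc k)
      define x y where "x = (int k * r ^ nat i) mod int p" and "y = (int (Suc k) * r ^ nat i) mod int p"
      have V: "(i, x) \<in> V" "(i, y) \<in> V"
        using ij p_gt_1 by (auto simp: x_def y_def)
      have "[y - x = int (Suc k) * r ^ nat i - int k * r ^ nat i] (mod int p)"
        unfolding x_def y_def by (intro cong_diff) (simp_all add: cong_def)
      then have "connects i (y - x)"
        using connects_power[OF S_one, of i] connects_cong[of "y - x" "r ^ nat i * 1" i]
        by (simp add: algebra_simps)
      then have "adj (i, x) (i, y) \<and> \<not> spoke (i, x) (i, y)"
        using V by (subst adj_not_spoke_iff) simp
      then have "adj (\<alpha> (i, x)) (\<alpha> (i, y)) \<and> \<not> spoke (\<alpha> (i, x)) (\<alpha> (i, y))"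
        using adj spoke V by blast
      then have "fst (\<alpha> (i, x)) = fst (\<alpha> (i, y))"
        by (cases "\<alpha> (i, x)", cases "\<alpha> (i, y)") (simp add: adj_not_spoke_iff)
      then show ?case
        using Suc by (simp add: x_def y_def)
    qed simp
    moreover obtain k where "j = (int k * r ^ nat i) mod int p"
      using r_multiples_cover ij by auto
    ultimately show ?thesis
      by metis
  qed
  have column: "snd (\<alpha> (int k, j)) = snd (\<alpha> (0, j))" if "(int k, j) \<in> V" for k j
    using that
  proof (induction k)
    case (Suc k)
    have V: "(int k, j) \<in> V" "(int (Suc k), j) \<in> V"
      using Suc(2) by auto
    have "spoke (int k, j) (int (Suc k), j)"
      using V by (auto simp: spoke_iff)
    then have "spoke (\<alpha> (int k, j)) (\<alpha> (int (Suc k), j))"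
      using spoke[OF V] by blast
    then have "snd (\<alpha> (int k, j)) = snd (\<alpha> (int (Suc k), j))"
      by (simp add: spoke_def)
    then show ?case
      using Suc V by simp
  qed simp
  have "\<alpha> (i, j) = (fst (\<alpha> (i, 0)), snd (\<alpha> (0, j)))" if "(i, j) \<in> V" for i j
    using layer[OF that] column[of "nat i" j] that by (auto simp: prod_eq_iff)
  then show thesis
    using that[of "\<lambda>i. fst (\<alpha> (i, 0))" "\<lambda>j. snd (\<alpha> (0, j))"] by blast
qed

text \<open>The second bound holds because \<open>S\<close> and \<open>r S\<close> are disjoint sets of units.\<close>

lemma card_S_bounds: "2 \<le> card S" "2 * card S < p"
proof -
  have "p \<noteq> 2"
    using q_gt_1 q_less_p by simp
  then have "(-1) mod int p \<noteq> 1"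
    using p_gt_1 by (simp add: zmod_minus1)
  then have "card {1, (-1) mod int p} = 2"
    by simp
  moreover have "{1, (-1) mod int p} \<subseteq> S"
    using S_one S_neg by blast
  ultimately show "2 \<le> card S"
    by (metis card_mono finite_S)
  define T where "T = (\<lambda>s. (r * s) mod int p) ` S"
  have "inj_on (\<lambda>s. (r * s) mod int p) S"
  proof (rule inj_onI)
    fix x y assume "x \<in> S" "y \<in> S" "(r * x) mod int p = (r * y) mod int p"
    then show "x = y"
      using coprime_r[of 1] by (metis S_cong_eq cong_def cong_mult_lcancel power_one_right)
  qed
  then have cT: "card T = card S"
    by (simp add: T_def card_image)
  have disj: "S \<inter> T = {}"
  proof (rule ccontr)
    assume "S \<inter> T \<noteq> {}"
    then obtain s where s: "s \<in> S" "(r * s) mod int p \<in> S"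
      by (auto simp: T_def)
    obtain s' where s': "s' \<in> S" "[s * s' = 1] (mod int p)"
      using S_inverse[OF s(1)] .
    have "((r * s) mod int p * s') mod int p = (r * (s * s')) mod int p"
      by (simp add: mod_mult_left_eq mult.assoc)
    also have "\<dots> = (r * 1) mod int p"
      using s'(2) by (metis cong_def mod_mult_right_eq)
    finally have "[r ^ 1 = ((r * s) mod int p * s') mod int p] (mod int p)"
      by (simp add: cong_def)
    then show False
      using r_power_notin_S(1)[OF zero_less_one q_gt_1 S_mult[OF s(2) s'(1)]] by contradiction
  qed
  have "T \<subseteq> {1..<int p}"
  proof
    fix x assume "x \<in> T"
    then obtain s where s: "s \<in> S" "x = (r * s) mod int p"
      by (auto simp: T_def)
    have "\<not> int p dvd r * s"
      using r_not_dvd[of 1] S_not_dvd[OF s(1)] prime_int_p by (simp add: prime_dvd_mult_iff)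
    then have "x \<noteq> 0"
      using s(2) by (simp add: dvd_eq_mod_eq_0)
    moreover have "0 \<le> x" "x < int p"
      using s(2) p_gt_1 by auto
    ultimately show "x \<in> {1..<int p}"
      by simp
  qed
  then have "card (S \<union> T) \<le> card {1..<int p}"
    using S_sub by (intro card_mono) auto
  moreover have "card (S \<union> T) = 2 * card S"
    using disj cT by (simp add: card_Un_disjoint T_def)
  ultimately show "2 * card S < p"
    using p_gt_1 by simp
qed

text \<open>The map \<open>f\<close> sends differences in \<open>S\<close> to differences in \<open>r\<^sup>c S\<close> with \<open>c = \<sigma> 0\<close>. Divided by \<open>r\<^sup>c\<close> it
  preserves differences in \<open>S\<close>, so it is affine.\<close>

lemma rigid_affine:
  assumes "rigid \<alpha>"
  obtains \<sigma> f a b where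
    "\<And>i j. (i, j) \<in> V \<Longrightarrow> \<alpha> (i, j) = (\<sigma> i, f j)"
    "\<And>j. j \<in> {0..<int p} \<Longrightarrow> [f j = a * j + b] (mod int p)"
    "\<And>i. i \<in> {0..<int q} \<Longrightarrow> \<exists>s\<in>S. [a * r ^ nat i = r ^ nat (\<sigma> i) * s] (mod int p)"
proof -
  obtain \<sigma> f where prod: "\<And>i j. (i, j) \<in> V \<Longrightarrow> \<alpha> (i, j) = (\<sigma> i, f j)"
    using rigid_product[OF assms] by blast
  have spoke: "spoke u v \<longleftrightarrow> spoke (\<alpha> u) (\<alpha> v)" if "u \<in> V" "v \<in> V" for u v
    using assms that by (auto simp: rigid_def)
  have adj: "adj u v \<longleftrightarrow> adj (\<alpha> u) (\<alpha> v)" if "u \<in> V" "v \<in> V" for u v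
    using assms that by (auto simp: rigid_def)
  have bij: "bij_betw \<alpha> V V"
    using assms by (simp add: rigid_def)
  have zq: "(0::int) \<in> {0..<int q}"
    using q_gt_1 by simp
  have fV: "f j \<in> {0..<int p}" if "j \<in> {0..<int p}" for j
  proof -
    have "(0, j) \<in> V"
      using that zq by simp
    then have "\<alpha> (0, j) \<in> V"
      using bij by (rule bij_betwE[rule_format, rotated])
    then show ?thesis
      using prod[of 0 j] that zq by simp
  qed
  have conn: "connects (\<sigma> i) (f y - f x)" if "connects i (y - x)" "(i, x) \<in> V" "(i, y) \<in> V" for i x y
  proof -
    have "adj (i, x) (i, y) \<and> \<not> spoke (i, x) (i, y)"
      using that by (subst adj_not_spoke_iff) simp
    then have "adj (\<alpha> (i, x)) (\<alpha> (i, y)) \<and> \<not> spoke (\<alpha> (i, x)) (\<alpha> (i, y))"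
      using adj spoke that(2,3) by blast
    then show ?thesis
      using prod that(2,3) by (simp add: adj_not_spoke_iff)
  qed
  obtain z where z: "[r ^ nat (\<sigma> 0) * z = 1] (mod int p)"
    using coprime_r cong_solve_coprime_int by blast
  define g where "g x = z * f (x mod int p)" for x
  have zc: "coprime z (int p)"
    using z by (metis cong_imp_coprime cong_sym coprime_1_left coprime_mult_left_iff)
  have g_inj: "[g x = g y] (mod int p) \<longleftrightarrow> [x = y] (mod int p)" for x y
  proof -
    have m: "x mod int p \<in> {0..<int p}" "y mod int p \<in> {0..<int p}"
      using p_gt_1 by auto
    have "[g x = g y] (mod int p) \<longleftrightarrow> [f (x mod int p) = f (y mod int p)] (mod int p)"
      unfolding g_def using zc cong_mult_lcancel by blast
    also have "\<dots> \<longleftrightarrow> f (x mod int p) = f (y mod int p)"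
      using fV[OF m(1)] fV[OF m(2)] by (simp add: cong_def)
    also have "\<dots> \<longleftrightarrow> \<alpha> (0, x mod int p) = \<alpha> (0, y mod int p)"
      using prod m zq by simp
    also have "\<dots> \<longleftrightarrow> x mod int p = y mod int p"
      using bij m zq inj_on_eq_iff[of \<alpha> V "(0, x mod int p)" "(0, y mod int p)"] by (simp add: bij_betw_def)
    finally show ?thesis
      by (simp add: cong_def)
  qed
  have g_diff: "(g (x + s) - g x) mod int p \<in> S" if s: "s \<in> S" for x s
  proof -
    define x0 x1 where "x0 = x mod int p" and "x1 = (x + s) mod int p"
    have "[x1 - x0 = (x + s) - x] (mod int p)"
      unfolding x0_def x1_def by (intro cong_diff) (simp_all add: cong_def)
    then have "connects 0 (x1 - x0)"
      using connects_power[OF s, of 0] connects_cong[of "x1 - x0" s 0] by simp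
    then have "connects (\<sigma> 0) (f x1 - f x0)"
      using conn zq p_gt_1 by (simp add: x0_def x1_def)
    then obtain s' where s': "s' \<in> S" "[f x1 - f x0 = r ^ nat (\<sigma> 0) * s'] (mod int p)"
      by (auto simp: connects_def)
    have "g (x + s) - g x = z * (f x1 - f x0)"
      by (simp add: g_def x0_def x1_def right_diff_distrib)
    also have "[z * (f x1 - f x0) = z * (r ^ nat (\<sigma> 0) * s')] (mod int p)"
      by (intro cong_mult cong_refl s'(2))
    also have "z * (r ^ nat (\<sigma> 0) * s') = r ^ nat (\<sigma> 0) * z * s'"
      by simp
    also have "[r ^ nat (\<sigma> 0) * z * s' = 1 * s'] (mod int p)"
      by (intro cong_mult cong_refl z)
    finally show ?thesis
      using s'(1) S_mod by (simp add: cong_def)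
  qed
  obtain a' b' where ab': "\<And>x. [g x = a' * x + b'] (mod int p)"
    using difference_preserving_imp_affine[of g, OF g_inj g_diff card_S_bounds] by blast
  define a b where "a = r ^ nat (\<sigma> 0) * a'" and "b = r ^ nat (\<sigma> 0) * b'"
  have aff: "[f j = a * j + b] (mod int p)" if j: "j \<in> {0..<int p}" for j
  proof -
    have "[r ^ nat (\<sigma> 0) * z * f j = 1 * f j] (mod int p)"
      by (intro cong_mult cong_refl z)
    then have "[f j = r ^ nat (\<sigma> 0) * g j] (mod int p)"
      using j by (simp add: g_def mult.assoc cong_sym)
    also have "[r ^ nat (\<sigma> 0) * g j = r ^ nat (\<sigma> 0) * (a' * j + b')] (mod int p)"
      by (intro cong_mult cong_refl ab')
    finally show ?thesis
      by (simp add: a_def b_def algebra_simps)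
  qed
  have "\<exists>s\<in>S. [a * r ^ nat i = r ^ nat (\<sigma> i) * s] (mod int p)" if i: "i \<in> {0..<int q}" for i
  proof -
    define y where "y = r ^ nat i mod int p"
    have y: "y \<in> {0..<int p}" "[y = r ^ nat i] (mod int p)"
      using p_gt_1 by (auto simp: y_def cong_def)
    have z0: "(0::int) \<in> {0..<int p}"
      using p_gt_1 by simp
    have "connects i (y - 0)"
      using connects_power[OF S_one, of i] connects_cong[of "y - 0" "r ^ nat i * 1" i] y(2) by simp
    then have "connects (\<sigma> i) (f y - f 0)"
      using conn i y(1) z0 by simp
    moreover have "[f y - f 0 = (a * y + b) - (a * 0 + b)] (mod int p)"
      by (intro cong_diff aff y z0)
    then have "[f y - f 0 = a * y] (mod int p)"
      by simp
    then have "[f y - f 0 = a * r ^ nat i] (mod int p)"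
      using cong_mult[OF cong_refl[of a] y(2)] by (rule cong_trans)
    ultimately have "connects (\<sigma> i) (a * r ^ nat i)"
      using connects_cong by blast
    then show ?thesis
      by (simp add: connects_def)
  qed
  then show thesis
    using that[of \<sigma> f a b] prod aff by blast
qed

end

section \<open>Symmetric Hamilton cycles\<close>

lemma graph_automorphism_funpow:
  assumes "graph_automorphism X \<alpha>"
  shows "graph_automorphism X (\<alpha> ^^ k)"
proof (induction k)
  case 0
  then show ?case
    using bij_betw_id[unfolded id_def] by (simp add: graph_automorphism_def)
next
  case (Suc k)
  define \<beta> where "\<beta> = \<alpha> ^^ k"
  have \<beta>: "graph_automorphism X \<beta>"
    using Suc by (simp add: \<beta>_def)
  then have "bij_betw (\<alpha> \<circ> \<beta>) (verts X) (verts X)"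
    using assms bij_betw_trans unfolding graph_automorphism_def by blast
  moreover have "{u, v} \<in> edges X \<longleftrightarrow> {\<alpha> (\<beta> u), \<alpha> (\<beta> v)} \<in> edges X"
    if "u \<in> verts X" "v \<in> verts X" for u v
    using assms \<beta> that bij_betwE unfolding graph_automorphism_def by metis
  ultimately show ?case
    by (simp add: graph_automorphism_def \<beta>_def comp_def)
qed

lemma funpow_cycle_shift:
  fixes C :: "'a list"
  assumes "\<And>i. i < length C \<Longrightarrow> \<alpha> (C ! i) = C ! ((i + d) mod length C)" and "i < length C"
  shows "(\<alpha> ^^ k) (C ! i) = C ! ((i + k * d) mod length C)"
proof (induction k)
  case 0
  then show ?case using assms(2) by simp
next
  case (Suc k)
  have "(i + k * d) mod length C < length C"
    using assms(2) by (intro mod_less_divisor) auto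
  then show ?case
    using Suc assms(1)[of "(i + k * d) mod length C"] by (simp add: mod_add_right_eq algebra_simps)
qed

lemma k_symmetric_prime_factor:
  assumes "k_symmetric X C k" "prime l" "l dvd k" "C \<noteq> []"
  shows "k_symmetric X C l"
proof -
  obtain \<alpha> where k: "k dvd length C" and aut: "graph_automorphism X \<alpha>"
    and shift: "\<And>i. i < length C \<Longrightarrow> \<alpha> (C ! i) = C ! ((i + length C div k) mod length C)"
    using assms(1) by (auto simp: k_symmetric_def)
  obtain m c where m: "k = l * m" and c: "length C = k * c"
    using k assms(3) by (auto simp: dvd_def)
  have pos: "0 < l" "0 < m" "0 < c"
    using m c assms(4) by (auto intro!: Nat.gr0I)
  then have "m * (length C div k) = length C div l"
    using m c by simp
  then have "(\<alpha> ^^ m) (C ! i) = C ! ((i + length C div l) mod length C)" if "i < length C" for i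
    using funpow_cycle_shift[of C \<alpha>, OF shift that, of m] by simp
  then show ?thesis
    using graph_automorphism_funpow[OF aut, of m] m c by (auto simp: k_symmetric_def)
qed

context layered
begin

lemma affine_funpow:
  assumes V: "\<And>j. j \<in> {0..<int p} \<Longrightarrow> f j \<in> {0..<int p}"
    and aff: "\<And>j. j \<in> {0..<int p} \<Longrightarrow> [f j = a * j + b] (mod int p)"
    and j: "j \<in> {0..<int p}"
  shows "(f ^^ k) j \<in> {0..<int p} \<and> [(f ^^ k) j = a ^ k * j + b * (\<Sum>i<k. a ^ i)] (mod int p)"
proof (induction k)
  case 0
  then show ?case using j by simp
next
  case (Suc k)
  have "[f ((f ^^ k) j) = a * (f ^^ k) j + b] (mod int p)"
    using aff Suc by blast
  also have "[a * (f ^^ k) j + b = a * (a ^ k * j + b * (\<Sum>i<k. a ^ i)) + b] (mod int p)"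
    using Suc by (intro cong_add cong_mult cong_refl) auto
  also have "a * (a ^ k * j + b * (\<Sum>i<k. a ^ i)) + b = a ^ Suc k * j + b * (\<Sum>i<Suc k. a ^ i)"
    by (subst sum.lessThan_Suc_shift) (simp add: sum_distrib_left algebra_simps)
  finally show ?case
    using V Suc by simp
qed

text \<open>The automorphism \<open>\<alpha>\<close> below moves every vertex of the cycle by the fraction \<open>1/l\<close> of its length.
  Hence it has no fixed vertex, and its \<open>l\<close>-th power is the identity; for the affine map in \<open>\<alpha>\<close> the
  latter means \<open>a\<^sup>l = 1\<close>.\<close>

lemma no_symmetric_hamilton_cycle:
  assumes rigid: "\<And>\<alpha>. graph_automorphism X \<alpha> \<Longrightarrow> rigid \<alpha>"
    and ham: "hamilton_cycle X C" and sym: "k_symmetric X C k" and k: "2 \<le> k"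
  shows False
proof -
  define n where "n = length C"
  have setC: "set C = V" and dist: "distinct C"
    and step: "\<And>i. i < n \<Longrightarrow> {C ! i, C ! ((i + 1) mod n)} \<in> edges X"
    using ham by (auto simp: hamilton_cycle_def verts_X n_def)
  have n: "n = p * q"
    using distinct_card[OF dist] setC by (simp add: n_def V_def card_cartesian_product mult.commute)
  have n0: "0 < n"
    using n p_gt_1 q_gt_1 by simp
  have nth_V: "C ! i \<in> V" if "i < n" for i
    using that nth_mem[of i C] unfolding setC n_def by blast
  have ex_nth: "\<exists>i<n. v = C ! i" if "v \<in> V" for v
  proof -
    have "v \<in> set C"
      using that by (simp only: setC)
    then obtain i where "i < length C" "C ! i = v"
      unfolding in_set_conv_nth by blast
    then show ?thesis
      by (auto simp: n_def)
  qed
  have nth_inj: "C ! i = C ! j \<longleftrightarrow> i = j" if "i < n" "j < n" for i j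
    using dist that by (simp add: nth_eq_iff_index_eq n_def)
  obtain l where l: "prime l" "l dvd k"
    using prime_factor_nat[of k] k by auto
  then have "k_symmetric X C l"
    using k_symmetric_prime_factor[OF sym l] n0 n_def by auto
  then obtain \<alpha> where ln: "l dvd n" and aut: "graph_automorphism X \<alpha>"
    and shift: "\<And>i. i < n \<Longrightarrow> \<alpha> (C ! i) = C ! ((i + n div l) mod n)"
    by (auto simp: k_symmetric_def n_def)
  have lpq: "l = p \<or> l = q"
    using l(1) ln n p_prime q_prime by (metis prime_dvd_mult_iff primes_dvd_imp_eq)
  have "n div l < n"
    using l(1) n0 prime_gt_1_nat by simp
  moreover have "0 < n div l"
    using ln n0 l(1) by (simp add: div_greater_zero_iff dvd_imp_le prime_gt_0_nat)
  ultimately have nofix: "\<alpha> v \<noteq> v" if v: "v \<in> V" for v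
  proof -
    obtain i where i: "i < n" "v = C ! i"
      using ex_nth[OF v] by blast
    have "(i + n div l) mod n \<noteq> i"
    proof
      assume "(i + n div l) mod n = i"
      then have "[i + n div l = i + 0] (mod n)"
        using i(1) by (simp add: cong_def)
      then have "[n div l = 0] (mod n)"
        using cong_add_lcancel_nat by blast
      then show False
        using \<open>n div l < n\<close> \<open>0 < n div l\<close> by (simp add: cong_def)
    qed
    moreover have "(i + n div l) mod n < n"
      using n0 by simp
    ultimately show ?thesis
      using shift[OF i(1)] i nth_inj by metis
  qed
  have period: "(\<alpha> ^^ l) v = v" if v: "v \<in> V" for v
  proof -
    obtain i where i: "i < n" "v = C ! i"
      using ex_nth[OF v] by blast
    have "l * (n div l) = n"
      using ln by simp
    then show ?thesis
      using funpow_cycle_shift[of C \<alpha> "n div l" i l] shift i by (simp add: n_def)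
  qed
  obtain \<sigma> f a b where prod: "\<And>i j. (i, j) \<in> V \<Longrightarrow> \<alpha> (i, j) = (\<sigma> i, f j)"
    and aff: "\<And>j. j \<in> {0..<int p} \<Longrightarrow> [f j = a * j + b] (mod int p)"
    and rel: "\<And>i. i \<in> {0..<int q} \<Longrightarrow> \<exists>s\<in>S. [a * r ^ nat i = r ^ nat (\<sigma> i) * s] (mod int p)"
    using rigid_affine[OF rigid[OF aut]] by metis
  have img: "\<alpha> v \<in> V" if "v \<in> V" for v
    using rigid[OF aut] that by (auto simp: rigid_def bij_betw_def)
  have zq: "(0::int) \<in> {0..<int q}" and zp: "(0::int) \<in> {0..<int p}" "(1::int) \<in> {0..<int p}"
    using q_gt_1 p_gt_1 by auto
  have sV: "\<sigma> i \<in> {0..<int q}" if "i \<in> {0..<int q}" for i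
    using img[of "(i, 0)"] prod[of i 0] that zp by simp
  have fV: "f j \<in> {0..<int p}" if "j \<in> {0..<int p}" for j
    using img[of "(0, j)"] prod[of 0 j] that zq by simp
  have pw: "(\<alpha> ^^ t) (0, j) \<in> V \<and> snd ((\<alpha> ^^ t) (0, j)) = (f ^^ t) j" if "j \<in> {0..<int p}" for j t
  proof (induction t)
    case (Suc t)
    then show ?case
      using img prod[of "fst ((\<alpha> ^^ t) (0, j))" "(f ^^ t) j"] by (metis funpow.simps(2) o_apply prod.collapse snd_conv)
  qed (use that zq in auto)
  have fl: "[a ^ l * j + b * (\<Sum>i<l. a ^ i) = j] (mod int p)" if j: "j \<in> {0..<int p}" for j
  proof -
    have "(f ^^ l) j = j"
      using pw[OF j, of l] period[of "(0, j)"] j zq by simp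
    then have "[j = a ^ l * j + b * (\<Sum>i<l. a ^ i)] (mod int p)"
      using affine_funpow[of f a b j l, OF fV aff j] by simp
    then show ?thesis
      by (rule cong_sym)
  qed
  have al: "[a ^ l = 1] (mod int p)"
  proof -
    have "[(a ^ l * 1 + b * (\<Sum>i<l. a ^ i)) - (a ^ l * 0 + b * (\<Sum>i<l. a ^ i)) = 1 - 0] (mod int p)"
      by (intro cong_diff fl zp)
    then show ?thesis by simp
  qed
  have a_dvd: "\<not> int p dvd a"
  proof
    assume "int p dvd a"
    then have "int p dvd a ^ l"
      using prime_gt_0_nat[OF l(1)] dvd_power dvd_trans by blast
    then have "int p dvd 1"
      using al cong_dvd_iff by blast
    then show False
      using p_gt_1 by simp
  qed
  have fixpoint: False if "\<sigma> 0 = 0" "\<not> [a = 1] (mod int p)"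
  proof -
    have "\<not> int p dvd a - 1"
      using that(2) by (simp add: cong_iff_dvd_diff)
    then have "coprime (a - 1) (int p)"
      using prime_int_p prime_imp_coprime coprime_commute by blast
    then obtain y where y: "[(a - 1) * y = 1] (mod int p)"
      using cong_solve_coprime_int by blast
    define x where "x = (- b * y) mod int p"
    have x: "x \<in> {0..<int p}"
      using p_gt_1 by (simp add: x_def)
    have "[(a - 1) * x = (a - 1) * (- b * y)] (mod int p)"
      by (intro cong_mult cong_refl) (simp add: x_def cong_def)
    also have "(a - 1) * (- b * y) = - b * ((a - 1) * y)"
      by simp
    also have "[- b * ((a - 1) * y) = - b * 1] (mod int p)"
      by (intro cong_mult cong_refl y)
    finally have "[(a - 1) * x + (x + b) = - b * 1 + (x + b)] (mod int p)"
      by (intro cong_add cong_refl)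
    moreover have "(a - 1) * x + (x + b) = a * x + b" "- b * 1 + (x + b) = x"
      by (simp_all add: algebra_simps)
    ultimately have "[a * x + b = x] (mod int p)"
      by simp
    then have "[f x = x] (mod int p)"
      using aff[OF x] cong_trans by blast
    then have "f x = x"
      using x fV[OF x] by (simp add: cong_def)
    then show False
      using nofix[of "(0, x)"] prod[of 0 x] that(1) x zq by simp
  qed
  show False
  proof (cases "l = p")
    case True
    have "[a * a ^ (p - 1) = a * 1] (mod int p)"
      by (intro cong_mult cong_refl fermat_int[OF p_prime a_dvd])
    then have "[a ^ l = a] (mod int p)"
      using True p_gt_1 by (simp add: power_eq_if[of a p])
    then have a1: "[a = 1] (mod int p)"
      using al by (metis cong_sym cong_trans)
    have sid: "\<sigma> i = i" if i: "i \<in> {0..<int q}" for i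
    proof (rule ccontr)
      assume ne: "\<sigma> i \<noteq> i"
      obtain s where s: "s \<in> S" "[a * r ^ nat i = r ^ nat (\<sigma> i) * s] (mod int p)"
        using rel[OF i] by blast
      have "[1 * r ^ nat i = a * r ^ nat i] (mod int p)"
        using cong_mult[OF cong_sym[OF a1] cong_refl] .
      then have *: "[r ^ nat i = r ^ nat (\<sigma> i) * s] (mod int p)"
        using s(2) cong_trans by (metis mult_1)
      consider "\<sigma> i < i" | "i < \<sigma> i"
        using ne by linarith
      then show False
      proof cases
        case 1
        define c where "c = nat i - nat (\<sigma> i)"
        have "nat i = nat (\<sigma> i) + c" and c: "0 < c" "c < q"
          using 1 i sV[OF i] by (auto simp: c_def)
        then have "[r ^ nat (\<sigma> i) * r ^ c = r ^ nat (\<sigma> i) * s] (mod int p)"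
          using * by (simp add: power_add)
        then have "[r ^ c = s] (mod int p)"
          using coprime_r cong_mult_lcancel by blast
        then show False
          using r_power_notin_S(1)[OF c s(1)] by contradiction
      next
        case 2
        define c where "c = nat (\<sigma> i) - nat i"
        have "nat (\<sigma> i) = nat i + c" and c: "0 < c" "c < q"
          using 2 i sV[OF i] by (auto simp: c_def)
        then have "[r ^ nat i * 1 = r ^ nat i * (r ^ c * s)] (mod int p)"
          using * by (simp add: power_add mult.assoc)
        then have "[1 = r ^ c * s] (mod int p)"
          using coprime_r cong_mult_lcancel by blast
        then show False
          using r_power_notin_S(2)[OF c s(1)] cong_sym by blast
      qed
    qed
    have nl: "n div l = q"
      using True n p_gt_1 by simp
    have qn: "q < n"
      using n p_gt_1 q_gt_1 by simp
    have layer_shift: "fst (C ! ((i + q) mod n)) = fst (C ! i)" if i: "i < n" for i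
      using shift[OF i] nl prod[of "fst (C ! i)" "snd (C ! i)"] sid[of "fst (C ! i)"] nth_V[OF i]
      by (metis fst_conv mem_V prod.collapse)
    \<comment> \<open>Hence the layers met by the cycle repeat with period \<open>q\<close>, and the first \<open>q\<close> vertices
      lie in distinct layers.\<close>
    have layer_mod: "fst (C ! i) = fst (C ! (i mod q))" if "i < n" for i
      using that
    proof (induction i rule: less_induct)
      case (less i)
      show ?case
      proof (cases "i < q")
        case False
        then have "fst (C ! i) = fst (C ! (i - q))"
          using layer_shift[of "i - q"] less(2) by simp
        also have "\<dots> = fst (C ! ((i - q) mod q))"
          using less False q_gt_1 by simp
        finally show ?thesis
          using False by (simp add: le_mod_geq)
      qed simp
    qed
    have "(\<lambda>i. fst (C ! i)) ` {..<q} = {0..<int q}"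
    proof (intro equalityI subsetI)
      fix x assume "x \<in> (\<lambda>i. fst (C ! i)) ` {..<q}"
      then obtain i where i: "i < q" "x = fst (C ! i)"
        by blast
      then show "x \<in> {0..<int q}"
        using nth_V[of i] qn by (cases "C ! i") simp
    next
      fix x assume x: "x \<in> {0..<int q}"
      then have "(x, 0) \<in> V"
        using zp by simp
      then obtain i where "i < n" "C ! i = (x, 0)"
        using ex_nth by metis
      then have "x = fst (C ! (i mod q))"
        using layer_mod[of i] by simp
      then show "x \<in> (\<lambda>i. fst (C ! i)) ` {..<q}"
        using q_gt_1 by (intro image_eqI[of _ _ "i mod q"]) auto
    qed
    then have "card ((\<lambda>i. fst (C ! i)) ` {..<q}) = card {..<q}"
      by simp
    then have inj: "inj_on (\<lambda>i. fst (C ! i)) {..<q}"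
      by (intro eq_card_imp_inj_on) auto
    have Cq: "fst (C ! q) = fst (C ! 0)"
      using layer_shift[of 0] qn n0 by simp
    have neq: "fst (C ! i) \<noteq> fst (C ! Suc i)" if "i < q" for i
    proof (cases "Suc i < q")
      case True
      then show ?thesis
        using inj_onD[OF inj, of i "Suc i"] that by auto
    next
      case False
      then have "Suc i = q" using that by simp
      then show ?thesis
        using inj_onD[OF inj, of i 0] that q_gt_1 Cq by auto
    qed
    have "snd (C ! i) = snd (C ! 0)" if "i \<le> q" for i
      using that
    proof (induction i)
      case (Suc i)
      have "adj (C ! i) (C ! Suc i)"
        using step[of i] nth_V[of i] nth_V[of "Suc i"] Suc(2) qn by (simp add: adj_def)
      then have "snd (C ! i) = snd (C ! Suc i)"
        using neq[of i] Suc(2) by (cases "C ! i", cases "C ! Suc i") (auto simp: adj_iff)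
      then show ?case
        using Suc by simp
    qed simp
    from this[of q] have "C ! q = C ! 0"
      using Cq by (simp add: prod_eq_iff)
    then show False
      using nth_inj[OF qn n0] q_gt_1 by simp
  next
    case False
    then have lq: "l = q"
      using lpq by simp
    obtain s where s: "s \<in> S" "[a * r ^ nat 0 = r ^ nat (\<sigma> 0) * s] (mod int p)"
      using rel[OF zq] by blast
    show False
    proof (cases "\<sigma> 0 = 0")
      case True
      then have a1: "[a = 1] (mod int p)"
        using fixpoint by blast
      have "[b * (\<Sum>i<l. a ^ i) = b * (\<Sum>i<l. 1 ^ i)] (mod int p)"
        by (intro cong_mult cong_sum cong_pow cong_refl a1)
      moreover have "[b * (\<Sum>i<l. a ^ i) = 0] (mod int p)"
        using fl[OF zp(1)] by simp
      ultimately have "int p dvd b * int q"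
        using lq by (simp add: cong_dvd_iff cong_0_iff)
      moreover have "\<not> int p dvd int q"
        using q_less_p q_gt_1 by (auto dest: nat_dvd_not_less)
      ultimately have "int p dvd b"
        using prime_int_p prime_dvd_mult_iff by blast
      then have "[f 0 = 0] (mod int p)"
        using aff[OF zp(1)] by (simp add: cong_0_iff cong_dvd_iff)
      then have "f 0 = 0"
        using fV[OF zp(1)] by (simp add: cong_def)
      then show False
        using nofix[of "(0, 0)"] prod[of 0 0] True zp zq by simp
    next
      case ne: False
      have "[a = r ^ nat (\<sigma> 0) * s] (mod int p)"
        using s(2) by simp
      then have "[(r ^ nat (\<sigma> 0) * s) ^ q = a ^ l] (mod int p)"
        unfolding lq by (intro cong_pow) (rule cong_sym)
      then have "[(r ^ nat (\<sigma> 0) * s) ^ q = 1] (mod int p)"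
        using al cong_trans by blast
      moreover have "0 < nat (\<sigma> 0)" "nat (\<sigma> 0) < q"
        using sV[OF zq] ne by auto
      ultimately show False
        using r_power_S s(1) by blast
    qed
  qed
qed

end

section \<open>Automorphisms preserve the spokes\<close>

lemma graph_automorphism_inverse:
  assumes "graph_automorphism X \<alpha>"
  obtains \<beta> where "graph_automorphism X \<beta>" "\<And>v. v \<in> verts X \<Longrightarrow> \<beta> (\<alpha> v) = v"
    "\<And>v. v \<in> verts X \<Longrightarrow> \<alpha> (\<beta> v) = v"
proof -
  define \<beta> where "\<beta> = inv_into (verts X) \<alpha>"
  have bij: "bij_betw \<alpha> (verts X) (verts X)"
    and edge: "\<And>u v. u \<in> verts X \<Longrightarrow> v \<in> verts X \<Longrightarrow> {u, v} \<in> edges X \<longleftrightarrow> {\<alpha> u, \<alpha> v} \<in> edges X"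
    using assms by (auto simp: graph_automorphism_def)
  have bij': "bij_betw \<beta> (verts X) (verts X)"
    unfolding \<beta>_def using bij by (rule bij_betw_inv_into)
  have l: "\<beta> (\<alpha> v) = v" if "v \<in> verts X" for v
    unfolding \<beta>_def using bij that by (rule bij_betw_inv_into_left)
  have r: "\<alpha> (\<beta> v) = v" if "v \<in> verts X" for v
    unfolding \<beta>_def using bij that by (rule bij_betw_inv_into_right)
  have "graph_automorphism X \<beta>"
    unfolding graph_automorphism_def
  proof (intro conjI ballI bij')
    fix u v assume uv: "u \<in> verts X" "v \<in> verts X"
    then have "\<beta> u \<in> verts X" "\<beta> v \<in> verts X"
      using bij' by (auto dest: bij_betwE)
    then show "{u, v} \<in> edges X \<longleftrightarrow> {\<beta> u, \<beta> v} \<in> edges X"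
      using edge[of "\<beta> u" "\<beta> v"] r uv by simp
  qed
  then show thesis
    using that l r by blast
qed

context layered
begin

lemma aut_V: "graph_automorphism X \<alpha> \<Longrightarrow> v \<in> V \<Longrightarrow> \<alpha> v \<in> V"
  unfolding graph_automorphism_def verts_X using bij_betwE by blast

lemma aut_adj: "graph_automorphism X \<alpha> \<Longrightarrow> u \<in> V \<Longrightarrow> v \<in> V \<Longrightarrow> adj u v \<longleftrightarrow> adj (\<alpha> u) (\<alpha> v)"
  using aut_V[of \<alpha> u] aut_V[of \<alpha> v] unfolding graph_automorphism_def adj_def verts_X by blast

lemma aut_inj: "graph_automorphism X \<alpha> \<Longrightarrow> u \<in> V \<Longrightarrow> v \<in> V \<Longrightarrow> \<alpha> u = \<alpha> v \<longleftrightarrow> u = v"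
proof (rule inj_on_eq_iff)
  assume "graph_automorphism X \<alpha>"
  then have "bij_betw \<alpha> V V"
    unfolding graph_automorphism_def verts_X by (rule conjunct1)
  then show "inj_on \<alpha> V"
    by (rule bij_betw_imp_inj_on)
qed

lemma aut_inverse:
  assumes "graph_automorphism X \<alpha>"
  shows "\<exists>\<beta>. graph_automorphism X \<beta> \<and> (\<forall>v\<in>V. \<beta> (\<alpha> v) = v \<and> \<alpha> (\<beta> v) = v)"
proof (rule graph_automorphism_inverse[OF assms])
  fix \<beta> assume "graph_automorphism X \<beta>" "\<And>v. v \<in> verts X \<Longrightarrow> \<beta> (\<alpha> v) = v"
    "\<And>v. v \<in> verts X \<Longrightarrow> \<alpha> (\<beta> v) = v"
  then show ?thesis
    unfolding verts_X by metis
qed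

text \<open>One implication suffices: applied to the inverse automorphism it gives the other.\<close>

definition invariant :: "(int \<times> int \<Rightarrow> int \<times> int \<Rightarrow> bool) \<Rightarrow> bool" where
  "invariant F \<longleftrightarrow> (\<forall>\<alpha> u v. graph_automorphism X \<alpha> \<longrightarrow> u \<in> V \<longrightarrow> v \<in> V \<longrightarrow> F u v \<longrightarrow> F (\<alpha> u) (\<alpha> v))"

lemma invariant_iff:
  assumes "invariant F" "graph_automorphism X \<alpha>" "u \<in> V" "v \<in> V"
  shows "F u v \<longleftrightarrow> F (\<alpha> u) (\<alpha> v)"
proof
  assume *: "F (\<alpha> u) (\<alpha> v)"
  obtain \<beta> where \<beta>: "graph_automorphism X \<beta>" "\<forall>v\<in>V. \<beta> (\<alpha> v) = v"
    using aut_inverse[OF assms(2)] by blast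
  have "F (\<beta> (\<alpha> u)) (\<beta> (\<alpha> v))"
    using assms(1) \<beta>(1) aut_V[OF assms(2)] assms(3,4) * unfolding invariant_def by blast
  then show "F u v"
    using \<beta>(2) assms(3,4) by simp
next
  assume "F u v"
  then show "F (\<alpha> u) (\<alpha> v)"
    using assms unfolding invariant_def by blast
qed

lemma spoke_adj: "spoke u v \<Longrightarrow> adj u v"
  by (simp add: spoke_def)

lemma rigidI:
  assumes F: "invariant F" and sp: "\<And>u v. spoke u v \<Longrightarrow> F u v"
    and ns: "\<And>u v. adj u v \<Longrightarrow> \<not> spoke u v \<Longrightarrow> \<not> F u v"
    and aut: "graph_automorphism X \<alpha>"
  shows "rigid \<alpha>"
proof -
  have *: "spoke u v \<longleftrightarrow> adj u v \<and> F u v" for u v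
    using sp ns spoke_adj by blast
  have "spoke u v \<longleftrightarrow> spoke (\<alpha> u) (\<alpha> v)" if "u \<in> V" "v \<in> V" for u v
    using * invariant_iff[OF F aut that] aut_adj[OF aut that] by blast
  then show ?thesis
    using aut aut_adj[OF aut] unfolding rigid_def graph_automorphism_def verts_X by blast
qed

lemma two_layers: "q = 2 \<Longrightarrow> v \<in> V \<Longrightarrow> fst v \<in> {0, 1}"
proof -
  assume q: "q = 2" and v: "v \<in> V"
  have "fst v \<in> {0..<int q}"
    using v mem_V[of "fst v" "snd v"] by (simp del: mem_V)
  then show "fst v \<in> {0, 1}"
    using q by auto
qed

lemma spoke_unique:
  assumes "q = 2" "spoke u v" "spoke u w"
  shows "v = w"
proof -
  have "snd v = snd w" "fst u \<noteq> fst v" "fst u \<noteq> fst w"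
    using assms(2,3) spoke_layers_differ by (auto simp: spoke_def)
  moreover have "fst u \<in> {0, 1}" "fst v \<in> {0, 1}" "fst w \<in> {0, 1}"
    using two_layers[OF assms(1)] adj_D spoke_adj assms(2,3) by blast+
  ultimately show ?thesis
    by (auto simp: prod_eq_iff)
qed

lemma ex_spoke:
  assumes "u \<in> V" obtains v where "spoke u v"
proof -
  have "spoke u ((fst u + 1) mod int q, snd u)"
    using assms q_gt_1 by (cases u) (auto simp: spoke_iff)
  then show thesis
    using that by blast
qed

text \<open>With two layers each vertex has only one spoke. It therefore suffices that \<open>F\<close> fails for the
  edges of a single layer \<open>L\<close>: at a vertex of \<open>L\<close> the spoke is the only edge with \<open>F\<close>, the same holds at
  its image, and at every vertex the spoke has \<open>F\<close>.\<close>

lemma rigidI_two_layers: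
  assumes q: "q = 2" and F: "invariant F" and sp: "\<And>u v. spoke u v \<Longrightarrow> F u v"
    and L: "L \<in> {0, 1}"
    and ns: "\<And>u v. adj u v \<Longrightarrow> \<not> spoke u v \<Longrightarrow> fst u = L \<Longrightarrow> \<not> F u v"
    and aut: "graph_automorphism X \<alpha>"
  shows "rigid \<alpha>"
proof -
  obtain \<beta> where \<beta>: "graph_automorphism X \<beta>" "\<forall>v\<in>V. \<alpha> (\<beta> v) = v"
    using aut_inverse[OF aut] by blast
  have one: "spoke (\<alpha> u) (\<alpha> v)" if uv: "spoke u v" "fst u = L" for u v
  proof -
    have V: "u \<in> V" "v \<in> V"
      using uv adj_D spoke_adj by blast+
    obtain w' where w': "spoke (\<alpha> u) w'"
      using ex_spoke[OF aut_V[OF aut V(1)]] .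
    then have w'V: "w' \<in> V"
      using adj_D spoke_adj by blast
    define w where "w = \<beta> w'"
    have w: "w \<in> V" "\<alpha> w = w'"
      using \<beta> aut_V w'V by (auto simp: w_def)
    have "F u w" "adj u w"
      using sp[OF w'] spoke_adj[OF w'] invariant_iff[OF F aut V(1) w(1)] aut_adj[OF aut V(1) w(1)] w(2)
      by auto
    then have "spoke u w"
      using ns uv(2) by blast
    then have "v = w"
      using spoke_unique[OF q] uv(1) by blast
    then show ?thesis
      using w' w(2) by simp
  qed
  have two: "spoke (\<alpha> u) (\<alpha> v)" if uv: "spoke u v" for u v
  proof (cases "fst u = L")
    case False
    have "fst u \<noteq> fst v" "fst u \<in> {0, 1}" "fst v \<in> {0, 1}"
      using spoke_layers_differ[OF uv] adj_D[OF spoke_adj[OF uv]] two_layers[OF q] by blast+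
    then have "fst v = L"
      using L False by auto
    then show ?thesis
      using one[of v u] uv spoke_sym by blast
  qed (use one uv in blast)
  have "spoke u v" if uv: "u \<in> V" "v \<in> V" "spoke (\<alpha> u) (\<alpha> v)" for u v
  proof -
    obtain w where w: "spoke u w"
      using ex_spoke uv(1) by blast
    then have "\<alpha> w = \<alpha> v"
      using two[OF w] spoke_unique[OF q] uv(3) by blast
    moreover have "w \<in> V"
      using w adj_D spoke_adj by blast
    ultimately have "w = v"
      using aut_inj[OF aut _ uv(2)] by blast
    then show ?thesis
      using w by simp
  qed
  then have "spoke u v \<longleftrightarrow> spoke (\<alpha> u) (\<alpha> v)" if "u \<in> V" "v \<in> V" for u v
    using two that by blast
  then show ?thesis
    using aut aut_adj[OF aut] unfolding rigid_def graph_automorphism_def verts_X by blast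
qed

subsection \<open>Four-cycles\<close>

definition in_no_4_cycle :: "int \<times> int \<Rightarrow> int \<times> int \<Rightarrow> bool" where
  "in_no_4_cycle u v \<longleftrightarrow> \<not> (\<exists>x y. adj v x \<and> adj x y \<and> adj y u \<and> x \<noteq> u \<and> y \<noteq> v)"

lemma invariant_in_no_4_cycle: "invariant in_no_4_cycle"
  unfolding invariant_def
proof (intro allI impI)
  fix \<alpha> u v assume aut: "graph_automorphism X \<alpha>" and V: "u \<in> V" "v \<in> V" and no: "in_no_4_cycle u v"
  obtain \<beta> where \<beta>: "graph_automorphism X \<beta>" and inv: "\<forall>v\<in>V. \<beta> (\<alpha> v) = v \<and> \<alpha> (\<beta> v) = v"
    using aut_inverse[OF aut] by blast
  show "in_no_4_cycle (\<alpha> u) (\<alpha> v)"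
    unfolding in_no_4_cycle_def
  proof
    assume "\<exists>x y. adj (\<alpha> v) x \<and> adj x y \<and> adj y (\<alpha> u) \<and> x \<noteq> \<alpha> u \<and> y \<noteq> \<alpha> v"
    then obtain x y where xy: "adj (\<alpha> v) x" "adj x y" "adj y (\<alpha> u)" "x \<noteq> \<alpha> u" "y \<noteq> \<alpha> v"
      by blast
    have xyV: "x \<in> V" "y \<in> V"
      using xy adj_D by blast+
    have xy': "\<alpha> (\<beta> x) = x" "\<alpha> (\<beta> y) = y"
      using inv xyV by blast+
    have "adj (\<alpha> v) (\<alpha> (\<beta> x))" "adj (\<alpha> (\<beta> x)) (\<alpha> (\<beta> y))" "adj (\<alpha> (\<beta> y)) (\<alpha> u)"
      unfolding xy' by (rule xy)+
    moreover have \<beta>V: "\<beta> x \<in> V" "\<beta> y \<in> V"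
      using aut_V[OF \<beta>] xyV by simp_all
    ultimately have "adj v (\<beta> x)" "adj (\<beta> x) (\<beta> y)" "adj (\<beta> y) u"
      using aut_adj[OF aut V(2) \<beta>V(1)] aut_adj[OF aut \<beta>V] aut_adj[OF aut \<beta>V(2) V(1)] by simp_all
    moreover have "\<beta> x \<noteq> u" "\<beta> y \<noteq> v"
      using xy' xy(4,5) by metis+
    ultimately show False
      using no unfolding in_no_4_cycle_def by blast
  qed
qed

lemma connects_same_layer:
  assumes "connects i d" "connects i' d" "i \<in> {0..<int q}" "i' \<in> {0..<int q}"
  shows "i = i'"
proof -
  have *: False if con: "connects i d" "connects i' d" and V: "i \<in> {0..<int q}" "i' \<in> {0..<int q}" "i < i'" for i i'
  proof -
    obtain s where s: "s \<in> S" "[d = r ^ nat i * s] (mod int p)"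
      using con(1) by (auto simp: connects_def)
    obtain s' where s': "s' \<in> S" "[d = r ^ nat i' * s'] (mod int p)"
      using con(2) by (auto simp: connects_def)
    obtain s'' where s'': "s'' \<in> S" "[s' * s'' = 1] (mod int p)"
      using S_inverse[OF s'(1)] .
    define c where "c = nat i' - nat i"
    have c: "0 < c" "c < q" "nat i' = nat i + c"
      using V by (auto simp: c_def)
    have "[r ^ nat i * s = r ^ nat i * (r ^ c * s')] (mod int p)"
      using cong_trans[OF cong_sym[OF s(2)] s'(2)] c(3) by (simp add: power_add mult.assoc)
    then have 1: "[s = r ^ c * s'] (mod int p)"
      using coprime_r cong_mult_lcancel by blast
    have "[s * s'' = r ^ c * s' * s''] (mod int p)"
      by (intro cong_mult 1 cong_refl)
    also have "r ^ c * s' * s'' = r ^ c * (s' * s'')"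
      by simp
    also have "[r ^ c * (s' * s'') = r ^ c * 1] (mod int p)"
      by (intro cong_mult s''(2) cong_refl)
    finally have "[r ^ c = (s * s'') mod int p] (mod int p)"
      by (simp add: cong_def)
    then show False
      using r_power_notin_S(1)[OF c(1,2) S_mult[OF s(1) s''(1)]] by contradiction
  qed
  show ?thesis
    using *[of i i'] *[of i' i] assms by (meson linorder_neqE)
qed

text \<open>A 4-cycle through a spoke either stays in a column, which is a \<open>q\<close>-cycle or, for \<open>q = 2\<close>, a single edge, or it crosses between
  two layers by two spokes and has one edge in each of them. The latter would need a difference
  that belongs to the connection sets of both layers.\<close>

lemma spoke_in_no_4_cycle:
  assumes "spoke u v"
  shows "in_no_4_cycle u v"
proof -
  obtain i j i' where u: "u = (i, j)" and v: "v = (i', j)"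
    using assms by (cases u, cases v) (auto simp: spoke_def)
  have V: "i \<in> {0..<int q}" "i' \<in> {0..<int q}"
    using assms u v by (auto simp: spoke_iff)
  have ii': "i \<noteq> i'"
    using spoke_layers_differ[OF assms] u v by simp
  have False if xy: "adj v x" "adj x y" "adj y u" "x \<noteq> u" "y \<noteq> v" for x y
  proof -
    obtain i2 j2 where x: "x = (i2, j2)" by (cases x)
    obtain i3 j3 where y: "y = (i3, j3)" by (cases y)
    have V2: "i2 \<in> {0..<int q}" "i3 \<in> {0..<int q}" 
      using xy(2) x y by (auto simp: adj_iff)
    have a1: "j2 = j \<and> ((i' + 1) mod int q = i2 \<or> (i2 + 1) mod int q = i') \<or> i2 = i' \<and> connects i' (j2 - j)"
      using xy(1) x v by (auto simp: adj_iff)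
    have a2: "j3 = j2 \<and> ((i2 + 1) mod int q = i3 \<or> (i3 + 1) mod int q = i2) \<or> i3 = i2 \<and> connects i2 (j3 - j2)"
      using xy(2) x y by (auto simp: adj_iff)
    have a3: "j3 = j \<and> ((i + 1) mod int q = i3 \<or> (i3 + 1) mod int q = i) \<or> i3 = i \<and> connects i (j3 - j)"
      using xy(3) u y connects_minus_commute by (auto simp: adj_iff)
    have a0: "(i + 1) mod int q = i' \<or> (i' + 1) mod int q = i"
      using assms u v by (auto simp: spoke_iff)
    have n0: "\<not> connects k 0" for k
      by (rule not_connects_0)
    consider "j2 = j" "j3 = j" | "j2 \<noteq> j" "j3 = j" | "j2 = j" "j3 \<noteq> j" | "j2 \<noteq> j" "j3 \<noteq> j"
      by blast
    then show False
    proof cases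
      case 1
      have move: "\<exists>e\<in>{1, -1}. [b = a + e] (mod int q)"
        if "(a + 1) mod int q = b \<or> (b + 1) mod int q = a" for a b :: int
        using that
      proof
        assume "(a + 1) mod int q = b"
        then have "[b = a + 1] (mod int q)"
          by (auto simp: cong_def)
        then show ?thesis by blast
      next
        assume "(b + 1) mod int q = a"
        then have "[b + 1 = a] (mod int q)"
          by (auto simp: cong_def)
        then have "[b + 1 + (-1) = a + (-1)] (mod int q)"
          by (intro cong_add cong_refl)
        then show ?thesis by auto
      qed
      obtain e1 where e1: "e1 \<in> {1, -1}" "[i' = i + e1] (mod int q)"
        using move[OF a0] by blast
      have m: "(i' + 1) mod int q = i2 \<or> (i2 + 1) mod int q = i'"
          "(i2 + 1) mod int q = i3 \<or> (i3 + 1) mod int q = i2"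
          "(i3 + 1) mod int q = i \<or> (i + 1) mod int q = i3"
        using a1 a2 a3 1 n0 by auto
      obtain e2 where e2: "e2 \<in> {1, -1}" "[i2 = i' + e2] (mod int q)"
        using move[OF m(1)] by blast
      obtain e3 where e3: "e3 \<in> {1, -1}" "[i3 = i2 + e3] (mod int q)"
        using move[OF m(2)] by blast
      obtain e4 where e4: "e4 \<in> {1, -1}" "[i = i3 + e4] (mod int q)"
        using move[OF m(3)] by blast
      have s2: "[i2 = i + (e1 + e2)] (mod int q)"
        using cong_trans[OF e2(2) cong_add[OF e1(2) cong_refl[of e2]]] by (simp add: add.assoc)
      have s3: "[i3 = i' + (e2 + e3)] (mod int q)"
        using cong_trans[OF e3(2) cong_add[OF e2(2) cong_refl[of e3]]] by (simp add: add.assoc)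
      have "[i3 + e4 = i + (e1 + e2 + e3 + e4)] (mod int q)"
        using cong_add[OF cong_trans[OF e3(2) cong_add[OF s2 cong_refl[of e3]]] cong_refl[of e4]]
        by (simp add: add.assoc)
      then have "[i + 0 = i + (e1 + e2 + e3 + e4)] (mod int q)"
        using cong_trans[OF e4(2)] by simp
      then have "[0 = e1 + e2 + e3 + e4] (mod int q)"
        by (simp only: cong_add_lcancel)
      then have s4: "int q dvd e1 + e2 + e3 + e4"
        using cong_sym cong_0_iff by blast
      have dist: "\<not> int q dvd e1 + e2" "\<not> int q dvd e2 + e3"
      proof -
        have "\<not> [i2 = i] (mod int q)" "\<not> [i3 = i'] (mod int q)"
          using xy(4,5) x y u v 1 V V2 by (auto simp: cong_def)
        then show "\<not> int q dvd e1 + e2" "\<not> int q dvd e2 + e3"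
          using cong_trans[OF s2, of i] cong_trans[OF s3, of i']
          by (auto simp: cong_add_lcancel_0 cong_0_iff cong_iff_dvd_diff)
      qed
      then have "e1 = e2" "e2 = e3"
        using e1(1) e2(1) e3(1) by auto
      then have "int q dvd 2 \<or> int q dvd 4"
        using s4 e3(1) e4(1) dist by auto
      then have "int q dvd 2 * 2"
        using dvd_mult[of "int q" 2 2] by (elim disjE) simp_all
      then have "int q dvd 2"
        using q_prime prime_dvd_mult_iff[of "int q" 2 2] by simp
      then show False
        using dist e1(1) e2(1) by auto
    next
      case 2
      then show False
        using a1 a2 a3 xy(5) y v by auto
    next
      case 3
      then show False
        using a1 a2 a3 xy(4) x u by auto
    next
      case 4
      then have "i2 = i'" "i3 = i" "connects i' (j2 - j)" "connects i (j3 - j)" "j3 = j2"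
        using a1 a2 a3 ii' by auto
      then show False
        using connects_same_layer[of i' "j2 - j" i] V ii' by simp
    qed
  qed
  then show ?thesis
    unfolding in_no_4_cycle_def by blast
qed

lemma adj_shift:
  assumes "i \<in> {0..<int q}" "s \<in> S"
  shows "adj (i, x mod int p) (i, (x + r ^ nat i * s) mod int p)"
proof -
  have "[(x + r ^ nat i * s) mod int p - x mod int p = (x + r ^ nat i * s) - x] (mod int p)"
    by (intro cong_diff) (simp_all add: cong_def)
  then have "connects i ((x + r ^ nat i * s) mod int p - x mod int p)"
    using connects_power[OF assms(2), of i] connects_cong by simp
  then show ?thesis
    using assms(1) p_gt_1 by (simp add: adj_iff)
qed

text \<open>Two steps \<open>s\<close> and \<open>s'\<close> with \<open>s' \<noteq> \<plusminus> s\<close> span a parallelogram.\<close>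

lemma layer_edge_in_4_cycle:
  assumes "2 < card S" "adj u v" "\<not> spoke u v"
  shows "\<not> in_no_4_cycle u v"
proof -
  obtain i j where u: "u = (i, j)" by (cases u)
  obtain i' j' where v': "v = (i', j')" by (cases v)
  have "(i, j) \<in> V \<and> (i', j') \<in> V \<and> i = i' \<and> connects i (j' - j)"
    using assms(2,3) unfolding u v' adj_not_spoke_iff[symmetric] by blast
  then have v: "v = (i, j')" and c: "connects i (j' - j)"
    and V: "i \<in> {0..<int q}" "j \<in> {0..<int p}" "j' \<in> {0..<int p}"
    using v' by auto
  obtain s where s: "s \<in> S" "[j' - j = r ^ nat i * s] (mod int p)"
    using c by (auto simp: connects_def)
  have "\<not> S \<subseteq> {s, (- s) mod int p}"
  proof
    assume "S \<subseteq> {s, (- s) mod int p}"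
    then have "card S \<le> card {s, (- s) mod int p}"
      by (intro card_mono) auto
    also have "\<dots> \<le> 2"
      by (simp add: card_insert_if)
    finally show False
      using assms(1) by simp
  qed
  then obtain s' where s': "s' \<in> S" "s' \<noteq> s" "s' \<noteq> (- s) mod int p"
    by blast
  have cr: "\<not> int p dvd r ^ nat i * d" if "\<not> int p dvd d" for d
    using that r_not_dvd prime_int_p by (simp add: prime_dvd_mult_iff)
  have ss: "\<not> int p dvd s' - s"
    using S_cong_eq[OF s'(1) s(1)] s'(2) by (auto simp: cong_iff_dvd_diff)
  have ss': "\<not> int p dvd s' + s"
  proof
    assume "int p dvd s' + s"
    then have "[s' = - s] (mod int p)"
      by (simp add: cong_iff_dvd_diff)
    then show False
      using s'(3) S_mod[OF s'(1)] by (simp add: cong_def)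
  qed
  have "[j' - j + j = r ^ nat i * s + j] (mod int p)"
    using s(2) by (intro cong_add cong_refl)
  then have j': "j' = (j + r ^ nat i * s) mod int p"
    using V by (simp add: cong_def add.commute)
  define x y where "x = (i, (j + r ^ nat i * s + r ^ nat i * s') mod int p)" and "y = (i, (j + r ^ nat i * s') mod int p)"
  have "adj v x"
    unfolding v x_def j' using adj_shift[OF V(1) s'(1)] .
  moreover have "adj y x"
    unfolding y_def x_def using adj_shift[OF V(1) s(1), of "j + r ^ nat i * s'"] by (simp add: algebra_simps)
  moreover have "adj u y"
    unfolding y_def u using adj_shift[OF V(1) s'(1), of j] V by simp
  moreover have "x \<noteq> u"
  proof
    assume "x = u"
    then have "[j + r ^ nat i * s + r ^ nat i * s' = j] (mod int p)"
      using V by (simp add: x_def u cong_def)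
    then have "int p dvd r ^ nat i * (s' + s)"
      by (simp add: cong_iff_dvd_diff algebra_simps)
    then show False
      using cr[OF ss'] by contradiction
  qed
  moreover have "y \<noteq> v"
  proof
    assume "y = v"
    then have "[j + r ^ nat i * s' = j + r ^ nat i * s] (mod int p)"
      by (simp add: y_def v j' cong_def)
    then have "int p dvd r ^ nat i * (s' - s)"
      by (simp add: cong_iff_dvd_diff algebra_simps)
    then show False
      using cr[OF ss] by contradiction
  qed
  ultimately show ?thesis
    unfolding in_no_4_cycle_def using adj_sym by blast
qed

lemma rigid_if_card_S_gt_2:
  assumes "2 < card S" "graph_automorphism X \<alpha>"
  shows "rigid \<alpha>"
  using rigidI[OF invariant_in_no_4_cycle spoke_in_no_4_cycle layer_edge_in_4_cycle[OF assms(1)] assms(2)] .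

end

context layered
begin

subsection \<open>Longer cycles\<close>

text \<open>The \<open>n\<close> vertices of \<open>cs\<close> close the path \<open>w u v z\<close> to a cycle of length \<open>n + 4\<close>. In a generalised
  Petersen graph every edge lies in cycles of length eight; but in general only for the spokes do
  these cycles take all the ways of passing through the edge.\<close>

definition completable :: "nat \<Rightarrow> int \<times> int \<Rightarrow> int \<times> int \<Rightarrow> bool" where
  "completable n u v \<longleftrightarrow> (\<forall>w z. adj w u \<longrightarrow> w \<noteq> v \<longrightarrow> adj v z \<longrightarrow> z \<noteq> u \<longrightarrow>
     (\<exists>cs. length cs = n \<and> successively adj (z # cs @ [w]) \<and> distinct (w # u # v # z # cs)))"

lemma adj_path_in_V: "successively adj (xs @ [w]) \<Longrightarrow> set xs \<subseteq> V"
proof (induction xs)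
  case (Cons x xs)
  then have "adj x (hd (xs @ [w]))" "successively adj (xs @ [w])"
    by (cases xs; simp)+
  then show ?case
    using Cons(1) adj_D(1) by auto
qed simp

lemma invariant_completable: "invariant (completable n)"
  unfolding invariant_def
proof (intro allI impI)
  fix \<alpha> u v assume aut: "graph_automorphism X \<alpha>" and V: "u \<in> V" "v \<in> V" and c: "completable n u v"
  obtain \<beta> where \<beta>: "graph_automorphism X \<beta>" and inv: "\<forall>v\<in>V. \<beta> (\<alpha> v) = v \<and> \<alpha> (\<beta> v) = v"
    using aut_inverse[OF aut] by blast
  show "completable n (\<alpha> u) (\<alpha> v)"
    unfolding completable_def
  proof (intro allI impI)
    fix w' z' assume wz: "adj w' (\<alpha> u)" "w' \<noteq> \<alpha> v" "adj (\<alpha> v) z'" "z' \<noteq> \<alpha> u"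
    define w z where "w = \<beta> w'" and "z = \<beta> z'"
    have "w' \<in> V" "z' \<in> V"
      using wz adj_D by blast+
    then have w: "w \<in> V" "\<alpha> w = w'" and z: "z \<in> V" "\<alpha> z = z'"
      using inv aut_V[OF \<beta>] by (auto simp: w_def z_def)
    have "adj w u" "w \<noteq> v" "adj v z" "z \<noteq> u"
      using wz aut_adj[OF aut w(1) V(1)] aut_adj[OF aut V(2) z(1)] w(2) z(2) by auto
    then obtain cs where cs: "length cs = n" "successively adj (z # cs @ [w])" "distinct (w # u # v # z # cs)"
      using c unfolding completable_def by blast
    have csV: "set (z # cs) \<subseteq> V"
      using adj_path_in_V[of "z # cs" w] cs(2) by simp
    have "successively (\<lambda>x y. adj (\<alpha> x) (\<alpha> y)) (z # cs @ [w])"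
      using cs(2)
    proof (rule successively_mono)
      show "adj (\<alpha> x) (\<alpha> y)" if "adj x y" for x y
        using that aut_adj[OF aut adj_D(1)[OF that] adj_D(2)[OF that]] by simp
    qed
    then have "successively adj (map \<alpha> (z # cs @ [w]))"
      by (simp only: successively_map)
    moreover have "distinct (map \<alpha> (w # u # v # z # cs))"
    proof -
      have "inj_on \<alpha> V"
        using aut_inj[OF aut] by (auto intro: inj_onI)
      then have "inj_on \<alpha> (set (w # u # v # z # cs))"
        by (rule inj_on_subset) (use csV V w in auto)
      then show ?thesis
        using cs(3) distinct_map by blast
    qed
    ultimately show "\<exists>cs. length cs = n \<and> successively adj (z' # cs @ [w']) \<and>
        distinct (w' # \<alpha> u # \<alpha> v # z' # cs)"
      using w z cs(1) by (intro exI[of _ "map \<alpha> cs"]) simp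
  qed
qed

lemma completable_sym:
  assumes "completable n u v"
  shows "completable n v u"
  unfolding completable_def
proof (intro allI impI)
  fix w z assume wz: "adj w v" "w \<noteq> u" "adj u z" "z \<noteq> v"
  then obtain cs where cs: "length cs = n" "successively adj (w # cs @ [z])" "distinct (z # u # v # w # cs)"
    using assms adj_sym unfolding completable_def by blast
  have "successively adj (rev (w # cs @ [z]))"
    using cs(2) by (subst successively_rev) (simp add: adj_sym)
  then show "\<exists>cs. length cs = n \<and> successively adj (z # cs @ [w]) \<and> distinct (w # v # u # z # cs)"
    using cs by (intro exI[of _ "rev cs"]) auto
qed

definition N :: "int \<Rightarrow> int \<Rightarrow> int \<times> int" where
  "N l x = (l, x mod int p)"

text \<open>The step \<open>r\<^sup>l\<close> of layer \<open>l\<close>, when there are only the layers \<open>0\<close> and \<open>1\<close>.\<close>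

definition width :: "int \<Rightarrow> int" where
  "width l = (if l = 0 then 1 else r)"

lemma N_eq_iff: "N l x = N l' y \<longleftrightarrow> l = l' \<and> int p dvd x - y"
  by (auto simp: N_def mod_eq_dvd_iff)

lemma N_in_V: "q = 2 \<Longrightarrow> l \<in> {0, 1} \<Longrightarrow> N l x \<in> V"
  using p_gt_1 unfolding N_def mem_V by auto

lemma V_N:
  assumes "q = 2" "v \<in> V"
  obtains l x where "l \<in> {0, 1}" "v = N l x"
proof -
  obtain l x where v: "v = (l, x)" by (cases v)
  then have "l \<in> {0..<int q}" "x \<in> {0..<int p}"
    using assms(2) mem_V by blast+
  then have "l \<in> {0, 1}" "v = N l x"
    using assms(1) v by (auto simp: N_def)
  then show thesis
    using that by blast
qed

context
  assumes q2: "q = 2" and S2: "S = {1, (- 1) mod int p}"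
begin

lemma adj_NN:
  assumes "l \<in> {0, 1}" "l' \<in> {0, 1}"
  shows "adj (N l x) (N l' y) \<longleftrightarrow>
    l \<noteq> l' \<and> int p dvd y - x \<or> l = l' \<and> (int p dvd y - x - width l \<or> int p dvd y - x + width l)"
proof -
  have wl: "r ^ nat l = width l"
    using assms(1) by (auto simp: width_def)
  have "connects l d \<longleftrightarrow> int p dvd d - width l \<or> int p dvd d + width l" for d
  proof -
    have "connects l d \<longleftrightarrow> [d = width l * 1] (mod int p) \<or> [d = width l * ((- 1) mod int p)] (mod int p)"
      by (simp only: connects_def wl) (simp add: S2)
    also have "[d = width l * ((- 1) mod int p)] (mod int p) \<longleftrightarrow> [d = width l * (- 1)] (mod int p)"
      by (simp add: cong_def mod_mult_right_eq)
    finally show ?thesis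
      by (simp add: cong_iff_dvd_diff)
  qed
  moreover have "connects l (y mod int p - x mod int p) \<longleftrightarrow> connects l (y - x)"
    by (intro connects_cong cong_diff) (simp_all add: cong_def)
  moreover have "x mod int p = y mod int p \<longleftrightarrow> int p dvd y - x"
    by (metis mod_eq_dvd_iff)
  moreover have "((l + 1) mod int q = l' \<or> (l' + 1) mod int q = l) \<longleftrightarrow> l \<noteq> l'"
    using assms q2 by auto
  moreover have "(l, x mod int p) \<in> V" "(l', y mod int p) \<in> V"
    using N_in_V[OF q2] assms unfolding N_def by blast+
  ultimately show ?thesis
    unfolding N_def adj_iff by blast
qed

lemma spoke_NN:
  assumes "l \<in> {0, 1}" "l' \<in> {0, 1}"
  shows "spoke (N l x) (N l' y) \<longleftrightarrow> l \<noteq> l' \<and> int p dvd y - x"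
proof -
  have "snd (N l x) = snd (N l' y) \<longleftrightarrow> int p dvd y - x"
    unfolding N_def by (simp add: mod_eq_dvd_iff) (metis dvd_minus_iff minus_diff_eq)
  moreover have "\<not> int p dvd width l"
    using r_not_dvd[of 1] r_not_dvd[of 0] by (auto simp: width_def)
  then have "l = l' \<Longrightarrow> adj (N l x) (N l' y) \<Longrightarrow> \<not> int p dvd y - x"
    unfolding adj_NN[OF assms] by (metis dvd_diff_right_iff dvd_add_right_iff)
  ultimately show ?thesis
    unfolding spoke_def using adj_NN[OF assms] by blast
qed

lemma neighbours_N:
  assumes l: "l \<in> {0, 1}" and e: "e \<in> {1, -1}" and adj: "adj (N l x) v"
  shows "v = N (1 - l) x \<or> v = N l (x + e * width l) \<or> v = N l (x - e * width l)"
proof -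
  obtain l' y where v: "l' \<in> {0, 1}" "v = N l' y"
    using V_N[OF q2 adj_D(2)[OF adj]] by blast
  have "l \<noteq> l' \<and> int p dvd y - x \<or> l = l' \<and> (int p dvd y - x - width l \<or> int p dvd y - x + width l)"
    using adj unfolding v(2) adj_NN[OF l v(1)] .
  then show ?thesis
    using l e v(1) unfolding v(2) N_eq_iff by (auto simp: algebra_simps)
qed

lemma spoke_N:
  assumes "spoke u v"
  obtains l x where "l \<in> {0, 1}" "u = N l x" "v = N (1 - l) x"
proof -
  have V: "u \<in> V" "v \<in> V"
    using assms adj_D spoke_adj by blast+
  obtain l x where u: "l \<in> {0, 1}" "u = N l x"
    using V_N[OF q2 V(1)] by blast
  obtain l' y where v: "l' \<in> {0, 1}" "v = N l' y"
    using V_N[OF q2 V(2)] by blast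
  have "l \<noteq> l' \<and> int p dvd y - x"
    using assms spoke_NN[OF u(1) v(1)] u v by simp
  then have "v = N (1 - l) x"
    using u v by (auto simp: N_eq_iff)
  then show thesis
    using that u by blast
qed

lemma layer_edge_N:
  assumes "adj u v" "\<not> spoke u v" "fst u = l"
  obtains x e where "l \<in> {0, 1}" "e \<in> {1, -1}" "u = N l x" "v = N l (x + e * width l)"
proof -
  obtain x where u: "l \<in> {0, 1}" "u = N l x"
    using V_N[OF q2 adj_D(1)[OF assms(1)]] assms(3) by (metis N_def fst_conv)
  have "spoke u (N (1 - l) x)"
    using u spoke_NN[of l "1 - l" x x] by auto
  then have "v \<noteq> N (1 - l) x"
    using assms(2) by auto
  then have "v = N l (x + 1 * width l) \<or> v = N l (x + (-1) * width l)"
    using neighbours_N[OF u(1), of 1 x v] assms(1) u(2) by auto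
  then show thesis
    using that u by blast
qed

lemma width_bounds:
  assumes r: "\<not> int p dvd r - 1" "\<not> int p dvd r + 1" and l: "l \<in> {0, 1}" and e: "e \<in> {1, -1}" "e' \<in> {1, -1}"
  shows "\<not> int p dvd e * width l" "\<not> int p dvd e * width l + e' * width (1 - l)"
    "\<not> int p dvd e * width l - e' * width (1 - l)"
proof -
  have "\<not> int p dvd 1" "\<not> int p dvd r"
    using r_not_dvd[of 0] r_not_dvd[of 1] by simp_all
  moreover have eq: "1 - r = - (r - 1)" "- 1 - r = - (r + 1)" "1 + r = r + 1" "- 1 + r = r - 1"
      "- r - 1 = - (r + 1)" "- r + 1 = - (r - 1)"
    by simp_all
  have "\<not> int p dvd 1 - r" "\<not> int p dvd - 1 - r" "\<not> int p dvd 1 + r" "\<not> int p dvd - 1 + r"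
      "\<not> int p dvd - r - 1" "\<not> int p dvd - r + 1"
    unfolding eq dvd_minus_iff using r by simp_all
  ultimately show "\<not> int p dvd e * width l" "\<not> int p dvd e * width l + e' * width (1 - l)"
    "\<not> int p dvd e * width l - e' * width (1 - l)"
    using r l e by (auto simp: width_def)
qed

text \<open>The closed walk with the steps \<open>a, b, -a, -b\<close>, where \<open>a\<close> is taken in one layer and \<open>b\<close> in the other,
  becomes a cycle of length eight when the spokes between the steps are inserted.\<close>

lemma spoke_completable_4:
  assumes r: "\<not> int p dvd r - 1" "\<not> int p dvd r + 1" and "spoke u v"
  shows "completable 4 u v"
proof -
  obtain l x where u: "l \<in> {0, 1}" "u = N l x" "v = N (1 - l) x"
    using spoke_N[OF assms(3)] by blast
  have l': "1 - l \<in> {0, 1}"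
    using u(1) by auto
  show ?thesis
    unfolding completable_def
  proof (intro allI impI)
    fix w z assume wz: "adj w u" "w \<noteq> v" "adj v z" "z \<noteq> u"
    have "w = N l (x + 1 * width l) \<or> w = N l (x - 1 * width l)"
      using neighbours_N[OF u(1), of 1 x w] wz(1,2) u adj_sym by blast
    then obtain e where e: "e \<in> {1, -1}" "w = N l (x + e * width l)"
      by (metis insertCI add_uminus_conv_diff mult_minus_left)
    have "z = N (1 - l) (x + 1 * width (1 - l)) \<or> z = N (1 - l) (x - 1 * width (1 - l))"
      using neighbours_N[OF l', of 1 x z] wz(3,4) u by simp
    then obtain e' where e': "e' \<in> {1, -1}" "z = N (1 - l) (x + e' * width (1 - l))"
      by (metis insertCI add_uminus_conv_diff mult_minus_left)
    define a b where "a = e * width l" and "b = e' * width (1 - l)"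
    have ab: "\<not> int p dvd a" "\<not> int p dvd b" "\<not> int p dvd a + b" "\<not> int p dvd a - b"
      using width_bounds[OF r u(1) e(1) e'(1)] width_bounds[OF r l' e'(1) e(1)] by (auto simp: a_def b_def)
    define cs where "cs = [N l (x + b), N l (x + b + a), N (1 - l) (x + b + a), N (1 - l) (x + a)]"
    have wl: "width l = e * a" "width (1 - l) = e' * b"
      using e e' by (auto simp: a_def b_def)
    have "successively adj (z # cs @ [w])"
      using u(1) l' e(1) e'(1) unfolding cs_def e(2) e'(2) a_def[symmetric] b_def[symmetric]
      by (auto simp: adj_NN wl)
    moreover have "distinct (w # u # v # z # cs)"
      using u(1) ab ab(1-4)[unfolded dvd_minus_iff[symmetric, of _ a] dvd_minus_iff[symmetric, of _ b]
          dvd_minus_iff[symmetric, of _ "a - b"] dvd_minus_iff[symmetric, of _ "a + b"]]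
      unfolding cs_def e(2) e'(2) u(2,3) a_def[symmetric] b_def[symmetric]
      by (auto simp: N_eq_iff algebra_simps)
    ultimately show "\<exists>cs. length cs = 4 \<and> successively adj (z # cs @ [w]) \<and> distinct (w # u # v # z # cs)"
      by (intro exI[of _ cs]) (simp add: cs_def)
  qed
qed

text \<open>The path of three steps \<open>a\<close> inside layer \<open>L\<close>, with end vertices \<open>w\<close> and \<open>z\<close>, would have to be closed
  by five more steps. The four cases say whether the first step from \<open>z\<close> and the last step to \<open>w\<close>
  are spokes. In each of them adding up the steps leaves a relation \<open>3 a \<plusminus> 3 d\<close>, \<open>4 a\<close>, \<open>4 a \<plusminus> 2 d\<close>,
  \<open>5 a \<plusminus> d\<close>, \<open>6 a\<close> or \<open>8 a = 0\<close> modulo \<open>p\<close>, where \<open>d\<close> is the step of the other layer, or else the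
  eight vertices are not distinct.\<close>

lemma layer_edge_not_completable_4:
  assumes L: "L \<in> {0, 1}" and p: "5 < p"
    and h: "\<And>f. f \<in> {width (1 - L), - width (1 - L)} \<Longrightarrow>
      \<not> int p dvd width L + f \<and> \<not> int p dvd 2 * width L + f \<and> \<not> int p dvd 5 * width L + f"
    and uv: "adj u v" "\<not> spoke u v" "fst u = L"
  shows "\<not> completable 4 u v"
proof
  assume comp: "completable 4 u v"
  obtain x e where e: "e \<in> {1, -1}" and u: "u = N L x" and v: "v = N L (x + e * width L)"
    using layer_edge_N[OF uv] by blast
  have L': "1 - L \<in> {0, 1}"
    using L by auto
  define a d where "a = e * width L" and "d = width (1 - L)"
  have wa: "e * width L = a" "width L = e * a"
    using e by (auto simp: a_def)
  have h': "\<not> int p dvd a + f" "\<not> int p dvd 2 * a + f" "\<not> int p dvd 5 * a + f" if "f \<in> {d, -d}" for f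
  proof -
    have f: "f \<in> {d, - d}" "- f \<in> {d, - d}"
      using that by auto
    have "\<not> int p dvd a + f \<and> \<not> int p dvd 2 * a + f \<and> \<not> int p dvd 5 * a + f"
    proof (cases "e = 1")
      case True
      then show ?thesis
        using h[of f] f(1) by (simp add: a_def d_def)
    next
      case False
      then have "a = - width L"
        using e by (simp add: a_def)
      then have eq: "a + f = - (width L + - f)" "2 * a + f = - (2 * width L + - f)" "5 * a + f = - (5 * width L + - f)"
        by simp_all
      show ?thesis
        unfolding eq dvd_minus_iff using h[of "- f"] f(2) unfolding d_def by blast
    qed
    then show "\<not> int p dvd a + f" "\<not> int p dvd 2 * a + f" "\<not> int p dvd 5 * a + f"
      by simp_all
  qed
  have wL: "\<not> int p dvd width L"
    using r_not_dvd[of 1] r_not_dvd[of 0] by (auto simp: width_def)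
  have small: "\<not> int p dvd 2" "\<not> int p dvd 3"
    using p by (auto dest: zdvd_imp_le)
  have pa: "\<not> int p dvd a"
    using wL e by (auto simp: a_def)
  have pm: "int p dvd m * n \<longleftrightarrow> int p dvd m \<or> int p dvd n" for m n
    using prime_int_p prime_dvd_mult_iff by blast
  have m6: "\<not> int p dvd 2 * a" "\<not> int p dvd 3 * a" "\<not> int p dvd 2 * 2 * a" "\<not> int p dvd 2 * 3 * a" "\<not> int p dvd 2 * 2 * 2 * a"
    unfolding pm using small pa by simp_all
  define w z where "w = N L (x - a)" and "z = N L (x + 2 * a)"
  have "adj w u" "adj v z"
    unfolding w_def z_def u v wa(1) adj_NN[OF L L] using e by (auto simp: wa(2))
  moreover have "w \<noteq> v" "z \<noteq> u"
    unfolding w_def z_def u v wa(1) N_eq_iff using m6(1) dvd_minus_iff[of "int p" "2 * a"] by auto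
  ultimately obtain cs where cs: "length cs = 4" "successively adj (z # cs @ [w])" "distinct (w # u # v # z # cs)"
    using comp unfolding completable_def by blast
  obtain A B C D where ABCD: "cs = [A, B, C, D]"
    using cs(1) by (auto simp: length_Suc_conv numeral_eq_Suc)
  have adj: "adj z A" "adj A B" "adj B C" "adj D C" "adj w D"
    using cs(2) adj_sym by (auto simp: ABCD)
  have ne: "A \<noteq> v" "D \<noteq> u" "B \<noteq> z" "C \<noteq> w" "A \<noteq> C" "B \<noteq> D"
    using cs(3) by (auto simp: ABCD)
  have nbL: "t = N (1 - L) y \<or> t = N L (y + a) \<or> t = N L (y - a)" if "adj (N L y) t" for y t
    using neighbours_N[OF L e that] wa(1) by simp
  have nbO: "t = N L y \<or> (\<exists>f\<in>{d, -d}. t = N (1 - L) (y + f))" if "adj (N (1 - L) y) t" for y t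
    using neighbours_N[OF L', of 1 y t] that by (auto simp: d_def)
  have A: "A = N (1 - L) (x + 2 * a) \<or> A = N L (x + 3 * a)"
    using nbL[of "x + 2 * a" A] adj(1) ne(1) unfolding z_def v wa(1) by (auto simp: algebra_simps)
  have D: "D = N (1 - L) (x - a) \<or> D = N L (x - 2 * a)"
    using nbL[of "x - a" D] adj(5) ne(2) unfolding w_def u by (auto simp: algebra_simps)
  have B: "(\<exists>f\<in>{d, -d}. B = N (1 - L) (x + 2 * a + f))" if "A = N (1 - L) (x + 2 * a)"
    using nbO[of "x + 2 * a" B] adj(2) ne(3) unfolding that z_def by auto
  have C: "(\<exists>g\<in>{d, -d}. C = N (1 - L) (x - a + g))" if "D = N (1 - L) (x - a)"
    using nbO[of "x - a" C] adj(4) ne(4) unfolding that w_def by auto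
  have B': "B = N (1 - L) (x + 3 * a) \<or> B = N L (x + 4 * a)" if "A = N L (x + 3 * a)"
    using nbL[of "x + 3 * a" B] adj(2) ne(3) unfolding that z_def by (auto simp: algebra_simps)
  have C': "C = N (1 - L) (x - 2 * a) \<or> C = N L (x - 3 * a)" if "D = N L (x - 2 * a)"
    using nbL[of "x - 2 * a" C] adj(4) ne(4) unfolding that w_def by (auto simp: algebra_simps)
  have OO: "\<exists>k\<in>{d, -d}. int p dvd y' - y + k" if "adj (N (1 - L) y) (N (1 - L) y')" for y y'
    using that unfolding adj_NN[OF L' L'] d_def by auto
  have LO: "int p dvd y' - y" if "adj (N L y) (N (1 - L) y') \<or> adj (N (1 - L) y) (N L y')" for y y'
    using that L unfolding adj_NN[OF L L'] adj_NN[OF L' L] by auto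
  have LL: "int p dvd y' - y + a \<or> int p dvd y' - y - a" if "adj (N L y) (N L y')" for y y'
    using that e unfolding adj_NN[OF L L] wa(2) by auto
  have neg: "\<not> int p dvd t \<Longrightarrow> t' = - t \<Longrightarrow> \<not> int p dvd t'" for t t'
    by simp
  from A D show False
  proof (elim disjE)
    assume AD: "A = N (1 - L) (x + 2 * a)" "D = N (1 - L) (x - a)"
    obtain f where f: "f \<in> {d, -d}" "B = N (1 - L) (x + 2 * a + f)"
      using B[OF AD(1)] by blast
    obtain g where g: "g \<in> {d, -d}" "C = N (1 - L) (x - a + g)"
      using C[OF AD(2)] by blast
    obtain k where k: "k \<in> {d, -d}" "int p dvd (x - a + g) - (x + 2 * a + f) + k"
      using OO adj(3) f(2) g(2) by blast
    have k': "int p dvd - (3 * a) + g - f + k"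
      using k(2) by (simp add: algebra_simps)
    have 1: "\<not> int p dvd - (3 * a) + g"
      using ne(5) unfolding AD(1) g(2) N_eq_iff by (auto simp: algebra_simps dvd_diff_commute)
    have 2: "\<not> int p dvd - (3 * a) - f"
      using ne(6) neg[of "3 * a + f" "- (3 * a) - f"] unfolding AD(2) f(2) N_eq_iff by (auto simp: algebra_simps)
    have 3: "\<not> int p dvd 3 * (a + - g)"
      unfolding pm using small h'(1)[of "- g"] g(1) by auto
    have "- (3 * a) + g - f + k = - (3 * a) + g \<or> - (3 * a) + g - f + k = - (3 * a) - f \<or>
        - (3 * a) + g - f + k = - (3 * (a + - g))"
      using f(1) g(1) k(1) by auto
    then show False
      using k' 1 2 3 dvd_minus_iff by metis
  next
    assume AD: "A = N (1 - L) (x + 2 * a)" "D = N L (x - 2 * a)"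
    obtain f where f: "f \<in> {d, -d}" "B = N (1 - L) (x + 2 * a + f)"
      using B[OF AD(1)] by blast
    from C'[OF AD(2)] show False
    proof
      assume C: "C = N (1 - L) (x - 2 * a)"
      obtain k where k: "k \<in> {d, -d}" "int p dvd (x - 2 * a) - (x + 2 * a + f) + k"
        using OO adj(3) f(2) C by blast
      have "(x - 2 * a) - (x + 2 * a + f) + k = - (2 * 2 * a) \<or> (x - 2 * a) - (x + 2 * a + f) + k = - (2 * (2 * a + f))"
        using f(1) k(1) by auto
      moreover have "\<not> int p dvd 2 * (2 * a + f)"
        unfolding pm using small h'(2)[OF f(1)] by (simp add: pm)
      ultimately show False
        using k(2) m6(3) dvd_minus_iff by metis
    next
      assume C: "C = N L (x - 3 * a)"
      have "int p dvd (x - 3 * a) - (x + 2 * a + f)"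
        using LO adj(3) f(2) C by blast
      moreover have "(x - 3 * a) - (x + 2 * a + f) = - (5 * a + f)"
        by simp
      ultimately show False
        using h'(3)[OF f(1)] dvd_minus_iff by metis
    qed
  next
    assume AD: "A = N L (x + 3 * a)" "D = N (1 - L) (x - a)"
    obtain g where g: "g \<in> {d, -d}" "C = N (1 - L) (x - a + g)"
      using C[OF AD(2)] by blast
    have g': "- g \<in> {d, -d}"
      using g(1) by auto
    from B'[OF AD(1)] show False
    proof
      assume B: "B = N (1 - L) (x + 3 * a)"
      obtain k where k: "k \<in> {d, -d}" "int p dvd (x - a + g) - (x + 3 * a) + k"
        using OO adj(3) g(2) B by blast
      have "(x - a + g) - (x + 3 * a) + k = - (2 * 2 * a) \<or> (x - a + g) - (x + 3 * a) + k = - (2 * (2 * a + - g))"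
        using g(1) k(1) by auto
      moreover have "\<not> int p dvd 2 * (2 * a + - g)"
        unfolding pm using small h'(2)[OF g'] by (simp add: pm)
      ultimately show False
        using k(2) m6(3) dvd_minus_iff by metis
    next
      assume B: "B = N L (x + 4 * a)"
      have "int p dvd (x - a + g) - (x + 4 * a)"
        using LO adj(3) g(2) B by blast
      moreover have "(x - a + g) - (x + 4 * a) = - (5 * a + - g)"
        by simp
      ultimately show False
        using h'(3)[OF g'] dvd_minus_iff by metis
    qed
  next
    assume AD: "A = N L (x + 3 * a)" "D = N L (x - 2 * a)"
    from B'[OF AD(1)] C'[OF AD(2)] show False
    proof (elim disjE)
      assume BC: "B = N (1 - L) (x + 3 * a)" "C = N (1 - L) (x - 2 * a)"
      obtain k where k: "k \<in> {d, -d}" "int p dvd (x - 2 * a) - (x + 3 * a) + k"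
        using OO adj(3) BC by blast
      have "(x - 2 * a) - (x + 3 * a) + k = - (5 * a + - k)" "- k \<in> {d, -d}"
        using k(1) by auto
      then show False
        using h'(3)[of "- k"] k(2) dvd_minus_iff by metis
    next
      assume BC: "B = N (1 - L) (x + 3 * a)" "C = N L (x - 3 * a)"
      have "int p dvd (x - 3 * a) - (x + 3 * a)"
        using LO adj(3) BC by blast
      moreover have "(x - 3 * a) - (x + 3 * a) = - (2 * 3 * a)"
        by simp
      ultimately show False
        using m6 dvd_minus_iff by metis
    next
      assume BC: "B = N L (x + 4 * a)" "C = N (1 - L) (x - 2 * a)"
      have "int p dvd (x - 2 * a) - (x + 4 * a)"
        using LO adj(3) BC by blast
      moreover have "(x - 2 * a) - (x + 4 * a) = - (2 * 3 * a)"
        by simp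
      ultimately show False
        using m6 dvd_minus_iff by metis
    next
      assume BC: "B = N L (x + 4 * a)" "C = N L (x - 3 * a)"
      have "int p dvd (x - 3 * a) - (x + 4 * a) + a \<or> int p dvd (x - 3 * a) - (x + 4 * a) - a"
        using LL adj(3) BC by blast
      moreover have "(x - 3 * a) - (x + 4 * a) + a = - (2 * 3 * a)" "(x - 3 * a) - (x + 4 * a) - a = - (2 * 2 * 2 * a)"
        by simp_all
      ultimately show False
        using m6 dvd_minus_iff by metis
    qed
  qed
qed

text \<open>In \<open>GP(13,5)\<close> the edges of both layers have property \<open>completable 4\<close>, because \<open>5\<close> is its own inverse
  up to sign. Here the cycles of length seven help, which come from \<open>3 + 2 \<cdot> 5 = 13\<close> and
  \<open>3 \<cdot> 5 - 2 = 13\<close>.\<close>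

lemma spoke_completable_3:
  assumes p: "p = 13" and r: "r = 5 \<or> r = 8" and "spoke u v"
  shows "completable 3 u v"
proof -
  have pd: "int p dvd t \<longleftrightarrow> 13 dvd t" for t
    by (simp add: p)
  have *: "completable 3 (N 0 x) (N 1 x)" for x
    unfolding completable_def
  proof (intro allI impI)
    fix w z assume wz: "adj w (N 0 x)" "w \<noteq> N 1 x" "adj (N 1 x) z" "z \<noteq> N 0 x"
    have "w = N 0 (x + 1) \<or> w = N 0 (x - 1)"
      using neighbours_N[of 0 1 x w] wz(1,2) adj_sym by (auto simp: width_def)
    then obtain e where e: "e = 1 \<or> e = -1" "w = N 0 (x + e)"
      by (metis add_uminus_conv_diff)
    have "z = N 1 (x + r) \<or> z = N 1 (x - r)"
      using neighbours_N[of 1 1 x z] wz(3,4) by (auto simp: width_def)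
    moreover have "N 1 (x + 8) = N 1 (x - 5)" "N 1 (x - 8) = N 1 (x + 5)"
      by (simp_all add: N_eq_iff pd)
    ultimately have "z = N 1 (x + 5) \<or> z = N 1 (x - 5)"
      using r by auto
    then consider "z = N 1 (x + 5 * e)" | "z = N 1 (x - 5 * e)"
      using e(1) by fastforce
    then show "\<exists>cs. length cs = 3 \<and> successively adj (z # cs @ [w]) \<and> distinct (w # N 0 x # N 1 x # z # cs)"
    proof cases
      case 1
      show ?thesis
        using e r unfolding 1
        by (intro exI[of _ "[N 1 (x + 10 * e), N 1 (x + 2 * e), N 0 (x + 2 * e)]"])
          (auto simp: adj_NN N_eq_iff width_def pd)
    next
      case 2
      show ?thesis
        using e r unfolding 2
        by (intro exI[of _ "[N 1 (x + 3 * e), N 0 (x + 3 * e), N 0 (x + 2 * e)]"])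
          (auto simp: adj_NN N_eq_iff width_def pd)
    qed
  qed
  obtain l x where "l \<in> {0, 1}" "u = N l x" "v = N (1 - l) x"
    using spoke_N[OF assms(3)] by blast
  then show ?thesis
    using *[of x] completable_sym[OF *[of x]] by auto
qed

text \<open>The path that fails is the one through the spokes at both ends of the edge: four inner steps
  \<open>\<plusminus> 5\<close> never add up to \<open>\<plusminus> 1\<close> modulo 13.\<close>

lemma outer_edge_not_completable_3:
  assumes p: "p = 13" and r: "r = 5 \<or> r = 8" and uv: "adj u v" "\<not> spoke u v" "fst u = 0"
  shows "\<not> completable 3 u v"
proof
  assume comp: "completable 3 u v"
  obtain x e where e: "e \<in> {1, -1}" and u: "u = N 0 x" and v': "v = N 0 (x + e * width 0)"
    using layer_edge_N[OF uv] by blast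
  have v: "v = N 0 (x + e)"
    using v' by (simp add: width_def)
  have "adj (N 1 x) u" "N 1 x \<noteq> v" "adj v (N 1 (x + e))" "N 1 (x + e) \<noteq> u"
    unfolding u v by (simp_all add: adj_NN N_eq_iff)
  then obtain cs where cs: "length cs = 3" "successively adj (N 1 (x + e) # cs @ [N 1 x])"
      "distinct (N 1 x # u # v # N 1 (x + e) # cs)"
    using comp unfolding completable_def by blast
  obtain A B C where ABC: "cs = [A, B, C]"
    using cs(1) by (auto simp: length_Suc_conv numeral_eq_Suc)
  have adj: "adj (N 1 (x + e)) A" "adj A B" "adj C B" "adj (N 1 x) C"
    using cs(2) adj_sym by (auto simp: ABC)
  have ne: "A \<noteq> N 0 (x + e)" "C \<noteq> N 0 x" "A \<noteq> C" "B \<noteq> N 1 (x + e)" "B \<noteq> N 1 x"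
    using cs(3) by (auto simp: ABC u v)
  have nb: "t = N 0 y \<or> (\<exists>f\<in>{r, -r}. t = N 1 (y + f))" if "adj (N 1 y) t" for y t
    using neighbours_N[of 1 1 y t] that by (auto simp: width_def)
  obtain f where f: "f \<in> {r, -r}" "A = N 1 (x + e + f)"
    using nb[OF adj(1)] ne(1) by blast
  obtain g where g: "g \<in> {r, -r}" "C = N 1 (x + g)"
    using nb[OF adj(4)] ne(2) by blast
  have AB: "B = N 0 (x + e + f) \<or> (\<exists>f'\<in>{r, -r}. B = N 1 (x + e + f + f'))"
    using nb adj(2) unfolding f(2) by blast
  have CB: "B = N 0 (x + g) \<or> (\<exists>g'\<in>{r, -r}. B = N 1 (x + g + g'))"
    using nb adj(3) unfolding g(2) by blast
  from AB CB show False
  proof (elim disjE bexE)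
    assume "B = N 0 (x + e + f)" "B = N 0 (x + g)"
    then have "A = C"
      unfolding f(2) g(2) by (metis N_eq_iff)
    then show False
      using ne by simp
  next
    fix f' g' assume "f' \<in> {r, -r}" "B = N 1 (x + e + f + f')" "g' \<in> {r, -r}" "B = N 1 (x + g + g')"
    then have "int p dvd (x + e + f + f') - (x + g + g')"
      by (metis N_eq_iff)
    then have "int p dvd e + f + f' - g - g'"
      by (simp add: algebra_simps)
    then show False
      using e f(1) g(1) \<open>f' \<in> {r, -r}\<close> \<open>g' \<in> {r, -r}\<close> r unfolding p by auto
  qed (auto simp: N_eq_iff)
qed

text \<open>Outer edges can be completed to cycles of length eight only if \<open>r = \<plusminus> 5\<close>, inner edges only if
  \<open>5 r = \<plusminus> 1\<close>. Both together force \<open>25 = \<plusminus> 1\<close> modulo \<open>p\<close>, hence \<open>p = 13\<close>.\<close>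

lemma rigid_if_generalised_Petersen:
  assumes p: "11 < p"
    and r: "\<And>e. e \<in> {1, -1} \<Longrightarrow> \<not> int p dvd r + e \<and> \<not> int p dvd r + 2 * e \<and> \<not> int p dvd 2 * r + e"
    and r13: "p = 13 \<Longrightarrow> r = 5 \<or> r = 8"
    and aut: "graph_automorphism X \<alpha>"
  shows "rigid \<alpha>"
proof -
  have r': "\<not> int p dvd r - 1" "\<not> int p dvd r + 1"
    using r[of 1] r[of "-1"] by auto
  have flip: "int p dvd e * t \<longleftrightarrow> int p dvd t" if "e \<in> {1, -1}" for e t
    using that by auto
  consider "p = 13" | "p \<noteq> 13" "\<And>e. e \<in> {1, -1} \<Longrightarrow> \<not> int p dvd r + 5 * e"
    | "p \<noteq> 13" "\<And>e. e \<in> {1, -1} \<Longrightarrow> \<not> int p dvd 5 * r + e"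
  proof (cases "p = 13 \<or> (\<forall>e\<in>{1, -1}. \<not> int p dvd r + 5 * e)")
    case False
    then obtain e where e: "e \<in> {1, -1}" "int p dvd r + 5 * e" and p13: "p \<noteq> 13"
      by blast
    have "\<not> int p dvd 5 * r + e'" if e': "e' \<in> {1, -1}" for e'
    proof
      assume "int p dvd 5 * r + e'"
      then have "int p dvd 5 * (r + 5 * e) - (5 * r + e')"
        using e(2) by (intro dvd_diff dvd_mult)
      moreover have "5 * (r + 5 * e) - (5 * r + e') \<in> {24, 26, -24, -26}"
        using e(1) e' by auto
      ultimately have "int p dvd 24 \<or> int p dvd 26"
        by auto
      then have "p dvd 24 \<or> p dvd 26"
        using int_dvd_int_iff[of p 24] int_dvd_int_iff[of p 26] by simp
      moreover have "(24::nat) = 2 * 2 * 2 * 3" "(26::nat) = 2 * 13"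
        by simp_all
      ultimately have "p dvd 2 \<or> p dvd 3 \<or> p dvd 13"
        using p_prime prime_dvd_mult_iff by metis
      then have "p \<le> 3 \<or> p = 13"
        using primes_dvd_imp_eq[OF p_prime, of 13] by (auto dest: dvd_imp_le)
      then show False
        using p p13 by simp
    qed
    then show ?thesis
      using that(3) p13 by blast
  qed (use that in blast)
  then show ?thesis
  proof cases
    case 1
    show ?thesis
    proof (rule rigidI_two_layers[OF q2 invariant_completable[of 3] _ _ _ aut, where L = 0])
      show "completable 3 u v" if "spoke u v" for u v
        using spoke_completable_3[OF 1 r13[OF 1] that] .
      show "(0::int) \<in> {0, 1}"
        by simp
      show "\<not> completable 3 u v" if "adj u v" "\<not> spoke u v" "fst u = 0" for u v
        using outer_edge_not_completable_3[OF 1 r13[OF 1] that] by simp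
    qed
  next
    case 2
    have h: "\<not> int p dvd width 0 + f \<and> \<not> int p dvd 2 * width 0 + f \<and> \<not> int p dvd 5 * width 0 + f"
      if f: "f \<in> {width (1 - 0), - width (1 - 0)}" for f
    proof -
      have "f = 1 * r \<or> f = (-1) * r"
        using f by (auto simp: width_def)
      then obtain e where e: "e \<in> {1, -1}" "f = e * r"
        by blast
      have "1 + f = e * (r + e)" "2 + f = e * (r + 2 * e)" "5 + f = e * (r + 5 * e)"
        using e by (auto simp: algebra_simps)
      then show ?thesis
        using flip[OF e(1)] r[OF e(1)] 2(2)[OF e(1)] by (simp add: width_def)
    qed
    show ?thesis
    proof (rule rigidI_two_layers[OF q2 invariant_completable[of 4] _ _ _ aut, where L = 0])
      show "completable 4 u v" if "spoke u v" for u v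
        using spoke_completable_4[OF r' that] .
      show "(0::int) \<in> {0, 1}"
        by simp
      show "\<not> completable 4 u v" if "adj u v" "\<not> spoke u v" "fst u = 0" for u v
        using layer_edge_not_completable_4[OF _ _ h that] p by simp
    qed
  next
    case 3
    have h: "\<not> int p dvd width 1 + f \<and> \<not> int p dvd 2 * width 1 + f \<and> \<not> int p dvd 5 * width 1 + f"
      if f: "f \<in> {width (1 - 1), - width (1 - 1)}" for f
    proof -
      have "f \<in> {1, -1}"
        using f by (auto simp: width_def)
      then show ?thesis
        using r[of f] 3(2)[of f] by (simp add: width_def)
    qed
    show ?thesis
    proof (rule rigidI_two_layers[OF q2 invariant_completable[of 4] _ _ _ aut, where L = 1])
      show "completable 4 u v" if "spoke u v" for u v
        using spoke_completable_4[OF r' that] .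
      show "(1::int) \<in> {0, 1}"
        by simp
      show "\<not> completable 4 u v" if "adj u v" "\<not> spoke u v" "fst u = 1" for u v
        using layer_edge_not_completable_4[OF _ _ h that] p by simp
    qed
  qed
qed

end

end

section \<open>Hamilton cycles in generalised Petersen graphs\<close>

lemma successively_concat:
  assumes "\<And>xs. xs \<in> set xss \<Longrightarrow> xs \<noteq> [] \<and> successively P xs"
    and "successively (\<lambda>xs ys. P (last xs) (hd ys)) xss"
  shows "successively P (concat xss)"
  using assms
proof (induction xss)
  case (Cons xs xss)
  have "successively (\<lambda>xs ys. P (last xs) (hd ys)) xss"
    using Cons.prems(2) by (cases xss) auto
  then have IH: "successively P (concat xss)"
    using Cons.IH Cons.prems(1) by simp
  show ?case
  proof (cases xss)
    case (Cons ys yss)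
    then have "ys \<noteq> []" "P (last xs) (hd ys)"
      using Cons.prems by auto
    then show ?thesis
      using IH Cons.prems(1)[of xs] Cons by (auto simp: successively_append_iff)
  qed (use Cons.prems in simp)
qed simp

lemma hd_concat_nonempty: "xss \<noteq> [] \<Longrightarrow> hd xss \<noteq> [] \<Longrightarrow> hd (concat xss) = hd (hd xss)"
  by (cases xss) auto

lemma last_concat_nonempty: "xss \<noteq> [] \<Longrightarrow> last xss \<noteq> [] \<Longrightarrow> last (concat xss) = last (last xss)"
  by (induction xss rule: rev_induct) auto

lemma last_upto: "a \<le> b \<Longrightarrow> last [a..b] = b"
  by (subst upto_rec2) auto

lemma hd_upto: "a \<le> b \<Longrightarrow> hd [a..b] = a"
  by (subst upto.simps) auto

lemma successively_upto: "successively (\<lambda>x y. y = x + 1) [a..b]"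
proof (induction a b rule: upto.induct)
  case (1 a b)
  then show ?case
    by (cases "a + 1 \<le> b"; subst upto.simps) (auto simp: successively_Cons hd_upto)
qed

text \<open>The graph \<open>GP(n,\<kappa>)\<close> in coordinates in which both rims have step 1: the vertices \<open>(False, x)\<close> form
  the outer rim, the vertices \<open>(True, y)\<close> the inner one, and a spoke joins \<open>(False, x)\<close> to \<open>(True, y)\<close>
  if \<open>x = \<kappa> y\<close>. Coordinates are integers that matter modulo \<open>n\<close>. In this form the exchange of the two
  rims replaces \<open>\<kappa>\<close> by its inverse, and the reflection of one rim replaces it by \<open>- \<kappa>\<close>.\<close>

definition gp_adj :: "int \<Rightarrow> int \<Rightarrow> bool \<times> int \<Rightarrow> bool \<times> int \<Rightarrow> bool" where
  "gp_adj n \<kappa> u v \<longleftrightarrow>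
    fst u = fst v \<and> ([snd v = snd u + 1] (mod n) \<or> [snd v = snd u - 1] (mod n)) \<or>
    fst u \<noteq> fst v \<and> (if fst u then [snd v = \<kappa> * snd u] (mod n) else [snd u = \<kappa> * snd v] (mod n))"

definition gp_hamiltonian :: "int \<Rightarrow> int \<Rightarrow> bool" where
  "gp_hamiltonian n \<kappa> \<longleftrightarrow> (\<exists>W. int (length W) = 2 * n \<and> successively (gp_adj n \<kappa>) W \<and>
     gp_adj n \<kappa> (last W) (hd W) \<and> (\<forall>l x. \<exists>y. (l, y) \<in> set W \<and> [x = y] (mod n)))"

lemma gp_hamiltonian_transfer:
  assumes "gp_hamiltonian n \<kappa>" "0 < n"
    and adj: "\<And>u v. gp_adj n \<kappa> u v \<Longrightarrow> gp_adj n \<kappa>' (h u) (h v)"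
    and onto: "\<And>l x. \<exists>l' x'. \<forall>y. [x' = y] (mod n) \<longrightarrow> fst (h (l', y)) = l \<and> [x = snd (h (l', y))] (mod n)"
  shows "gp_hamiltonian n \<kappa>'"
proof -
  obtain W where W: "int (length W) = 2 * n" "successively (gp_adj n \<kappa>) W" "gp_adj n \<kappa> (last W) (hd W)"
    "\<And>l x. \<exists>y. (l, y) \<in> set W \<and> [x = y] (mod n)"
    using assms(1) by (auto simp: gp_hamiltonian_def)
  have "W \<noteq> []"
    using W(1) assms(2) by auto
  have "successively (gp_adj n \<kappa>') (map h W)"
    unfolding successively_map using W(2) by (rule successively_mono) (rule adj)
  moreover have "gp_adj n \<kappa>' (last (map h W)) (hd (map h W))"
    using adj[OF W(3)] \<open>W \<noteq> []\<close> by (simp add: last_map hd_map)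
  moreover have "\<exists>y. (l, y) \<in> set (map h W) \<and> [x = y] (mod n)" for l x
  proof -
    obtain l' x' where h: "\<And>y. [x' = y] (mod n) \<Longrightarrow> fst (h (l', y)) = l \<and> [x = snd (h (l', y))] (mod n)"
      using onto by metis
    obtain y where y: "(l', y) \<in> set W" "[x' = y] (mod n)"
      using W(4) by blast
    have "h (l', y) = (l, snd (h (l', y)))"
      using h[OF y(2)] by (simp add: prod_eq_iff)
    then have "(l, snd (h (l', y))) \<in> set (map h W)"
      using y(1) by (metis image_eqI list.set_map)
    then show ?thesis
      using h[OF y(2)] by blast
  qed
  ultimately show ?thesis
    using W(1) unfolding gp_hamiltonian_def by (intro exI[of _ "map h W"]) simp
qed

lemma gp_hamiltonian_swap:
  assumes "gp_hamiltonian n \<kappa>" "0 < n" "[\<kappa> * \<kappa>' = 1] (mod n)"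
  shows "gp_hamiltonian n \<kappa>'"
proof (rule gp_hamiltonian_transfer[OF assms(1,2), of _ "\<lambda>(l, x). (\<not> l, x)"])
  have *: "[y = \<kappa>' * x] (mod n)" if "[x = \<kappa> * y] (mod n)" for x y
  proof -
    have "[\<kappa>' * x = \<kappa>' * (\<kappa> * y)] (mod n)"
      by (intro cong_mult cong_refl that)
    also have "\<kappa>' * (\<kappa> * y) = (\<kappa> * \<kappa>') * y"
      by simp
    also have "[(\<kappa> * \<kappa>') * y = 1 * y] (mod n)"
      by (intro cong_mult cong_refl assms(3))
    finally show ?thesis
      by (simp add: cong_sym)
  qed
  show "gp_adj n \<kappa>' (case u of (l, x) \<Rightarrow> (\<not> l, x)) (case v of (l, x) \<Rightarrow> (\<not> l, x))" if "gp_adj n \<kappa> u v" for u v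
    using that * by (cases u, cases v) (auto simp: gp_adj_def split: if_splits)
  show "\<exists>l' x'. \<forall>y. [x' = y] (mod n) \<longrightarrow> fst (case (l', y) of (l, x) \<Rightarrow> (\<not> l, x)) = l \<and>
      [x = snd (case (l', y) of (l, x) \<Rightarrow> (\<not> l, x))] (mod n)" for l x
    by (intro exI[of _ "\<not> l"] exI[of _ x]) auto
qed

lemma gp_hamiltonian_uminus:
  assumes "gp_hamiltonian n \<kappa>" "0 < n"
  shows "gp_hamiltonian n (- \<kappa>)"
proof (rule gp_hamiltonian_transfer[OF assms, of _ "\<lambda>(l, x). (l, if l then - x else x)"])
  have *: "[- y = - x - 1] (mod n)" if "[y = x + 1] (mod n)" for x y
    using that by (simp add: cong_iff_dvd_diff) (metis add.commute diff_minus_eq_add dvd_minus_iff minus_diff_eq diff_diff_eq2 diff_diff_add uminus_add_conv_diff)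
  have **: "[- y = - x + 1] (mod n)" if "[y = x - 1] (mod n)" for x y
    using that by (simp add: cong_iff_dvd_diff) (metis add.commute diff_minus_eq_add dvd_minus_iff minus_diff_eq diff_diff_eq2 diff_diff_add uminus_add_conv_diff)
  show "gp_adj n (- \<kappa>) (case u of (l, x) \<Rightarrow> (l, if l then - x else x)) (case v of (l, x) \<Rightarrow> (l, if l then - x else x))"
    if "gp_adj n \<kappa> u v" for u v
    using that * ** by (cases u, cases v) (auto simp: gp_adj_def split: if_splits)
  show "\<exists>l' x'. \<forall>y. [x' = y] (mod n) \<longrightarrow> fst (case (l', y) of (l, x) \<Rightarrow> (l, if l then - x else x)) = l \<and>
      [x = snd (case (l', y) of (l, x) \<Rightarrow> (l, if l then - x else x))] (mod n)" for l x
  proof (intro exI[of _ l] exI[of _ "if l then - x else x"] allI impI)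
    fix y assume "[(if l then - x else x) = y] (mod n)"
    then show "fst (case (l, y) of (l, x) \<Rightarrow> (l, if l then - x else x)) = l \<and>
      [x = snd (case (l, y) of (l, x) \<Rightarrow> (l, if l then - x else x))] (mod n)"
      using cong_minus_minus_iff[of "- x" y n] by auto
  qed
qed

lemma gp_hamiltonian_cong:
  assumes "gp_hamiltonian n \<kappa>" "0 < n" "[\<kappa> = \<kappa>'] (mod n)"
  shows "gp_hamiltonian n \<kappa>'"
proof (rule gp_hamiltonian_transfer[OF assms(1,2), of _ "\<lambda>u. u"])
  have "[\<kappa> * x = \<kappa>' * x] (mod n)" for x
    by (intro cong_mult assms(3) cong_refl)
  then have "[y = \<kappa> * x] (mod n) \<Longrightarrow> [y = \<kappa>' * x] (mod n)" for x y
    using cong_trans by blast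
  then show "gp_adj n \<kappa>' u v" if "gp_adj n \<kappa> u v" for u v
    using that by (auto simp: gp_adj_def split: if_splits)
  show "\<exists>l' x'. \<forall>y. [x' = y] (mod n) \<longrightarrow> fst (l', y) = l \<and> [x = snd (l', y)] (mod n)" for l x
    by auto
qed

subsection \<open>Cycles given by arcs\<close>

text \<open>The flag of an arc tells whether the interval is traversed upwards. It is kept apart from the
  end points so that the intervals of a rim can be compared with a partition of the rim, which does
  not depend on the direction.\<close>

type_synonym arc = "bool \<times> int \<times> int \<times> bool"

fun arc_start :: "arc \<Rightarrow> int" where
  "arc_start (l, lo, hi, asc) = (if asc then lo else hi)"

fun arc_end :: "arc \<Rightarrow> int" where
  "arc_end (l, lo, hi, asc) = (if asc then hi else lo)"

fun arc_vertices :: "arc \<Rightarrow> (bool \<times> int) list" where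
  "arc_vertices (l, lo, hi, asc) = map (Pair l) (if asc then [lo..hi] else rev [lo..hi])"

fun arc_interval :: "arc \<Rightarrow> bool \<times> int \<times> int" where
  "arc_interval (l, lo, hi, asc) = (l, lo, hi)"

definition linked :: "int \<Rightarrow> int \<Rightarrow> arc \<Rightarrow> arc \<Rightarrow> bool" where
  "linked n \<kappa> A B \<longleftrightarrow> fst A \<noteq> fst B \<and>
    (if fst A then [arc_start B = \<kappa> * arc_end A] (mod n) else [arc_end A = \<kappa> * arc_start B] (mod n))"

fun tiles :: "int \<Rightarrow> (int \<times> int) list \<Rightarrow> int \<Rightarrow> bool" where
  "tiles c [] d \<longleftrightarrow> c = d"
| "tiles c ((lo, hi) # ts) d \<longleftrightarrow> lo = c \<and> lo \<le> hi \<and> tiles (hi + 1) ts d"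

lemma tiles_cover: "tiles c ts d \<Longrightarrow> c \<le> x \<Longrightarrow> x < d \<Longrightarrow> \<exists>(lo, hi)\<in>set ts. lo \<le> x \<and> x \<le> hi"
proof (induction c ts d rule: tiles.induct)
  case (2 c lo hi ts d)
  then show ?case
    by (cases "x \<le> hi") auto
qed simp

text \<open>The arcs of each rim cover it, and their lengths add up to the number of vertices; so a closed
  walk that runs through all of them once is a Hamilton cycle.\<close>

lemma gp_hamiltonian_arcs:
  assumes n: "0 < n" and ne: "As \<noteq> []"
    and links: "successively (linked n \<kappa>) As" "linked n \<kappa> (last As) (hd As)"
    and valid: "\<forall>(l, lo, hi, asc)\<in>set As. lo \<le> hi"
    and total: "(\<Sum>(l, lo, hi, asc)\<leftarrow>As. hi - lo + 1) = 2 * n"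
    and outer: "tiles c ts (c + n)" "Pair False ` set ts \<subseteq> arc_interval ` set As"
    and inner: "tiles c' ts' (c' + n)" "Pair True ` set ts' \<subseteq> arc_interval ` set As"
  shows "gp_hamiltonian n \<kappa>"
proof -
  define W where "W = concat (map arc_vertices As)"
  have vert: "arc_vertices A \<noteq> [] \<and> hd (arc_vertices A) = (fst A, arc_start A) \<and>
      last (arc_vertices A) = (fst A, arc_end A) \<and> successively (gp_adj n \<kappa>) (arc_vertices A)" if "A \<in> set As" for A
  proof -
    obtain l lo hi asc where A: "A = (l, lo, hi, asc)" by (cases A)
    have le: "lo \<le> hi"
      using valid that A by auto
    then have ne: "[lo..hi] \<noteq> []"
      by simp
    have asc: "successively (\<lambda>x y. gp_adj n \<kappa> (l, x) (l, y)) [lo..hi]"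
      using successively_upto by (rule successively_mono) (simp add: gp_adj_def)
    have down: "successively (\<lambda>x y. gp_adj n \<kappa> (l, y) (l, x)) [lo..hi]"
      using successively_upto by (rule successively_mono) (simp add: gp_adj_def)
    show ?thesis
      using le ne asc down unfolding A
      by (auto simp: hd_map last_map hd_upto last_upto hd_rev last_rev successively_map)
  qed
  have link: "gp_adj n \<kappa> (last (arc_vertices A)) (hd (arc_vertices B))"
    if "linked n \<kappa> A B" "A \<in> set As" "B \<in> set As" for A B
    using that(1) vert[OF that(2)] vert[OF that(3)] by (auto simp: linked_def gp_adj_def)
  have "successively (gp_adj n \<kappa>) W"
    unfolding W_def
  proof (rule successively_concat)
    show "xs \<noteq> [] \<and> successively (gp_adj n \<kappa>) xs" if "xs \<in> set (map arc_vertices As)" for xs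
      using that vert by auto
    show "successively (\<lambda>xs ys. gp_adj n \<kappa> (last xs) (hd ys)) (map arc_vertices As)"
      unfolding successively_map using links(1) by (rule successively_mono) (use link in blast)
  qed
  moreover have "gp_adj n \<kappa> (last W) (hd W)"
  proof -
    have "hd W = hd (arc_vertices (hd As))" "last W = last (arc_vertices (last As))"
      unfolding W_def using ne vert[of "hd As"] vert[of "last As"]
      by (simp_all add: hd_concat_nonempty last_concat_nonempty hd_map last_map)
    then show ?thesis
      using link[OF links(2)] ne by simp
  qed
  moreover have "int (length W) = 2 * n"
  proof -
    have "int (length (arc_vertices A)) = (case A of (l, lo, hi, asc) \<Rightarrow> hi - lo + 1)" if "A \<in> set As" for A
      using valid that by (cases A) fastforce
    then have "(\<Sum>A\<leftarrow>As. int (length (arc_vertices A))) = 2 * n"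
      using total by (metis (mono_tags, lifting) map_eq_conv)
    moreover have "int (length W) = (\<Sum>A\<leftarrow>As. int (length (arc_vertices A)))"
      unfolding W_def by (induction As) simp_all
    ultimately show ?thesis by simp
  qed
  moreover have "\<exists>y. (l, y) \<in> set W \<and> [x = y] (mod n)" for l x
  proof -
    have cov: "\<exists>y. (l, y) \<in> set W \<and> [x = y] (mod n)"
      if t: "tiles c ts (c + n)" "Pair l ` set ts \<subseteq> arc_interval ` set As" for c ts
    proof -
      define y where "y = c + (x - c) mod n"
      have y: "c \<le> y" "y < c + n"
        using n by (auto simp: y_def)
      have "[c + (x - c) mod n = c + (x - c)] (mod n)"
        by (intro cong_add cong_refl) (simp add: cong_def)
      then have xy: "[x = y] (mod n)"
        by (simp add: y_def cong_sym)
      obtain lo hi where "(lo, hi) \<in> set ts" "lo \<le> y" "y \<le> hi"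
        using tiles_cover[OF t(1) y] by blast
      moreover obtain asc where "(l, lo, hi, asc) \<in> set As"
        using t(2) \<open>(lo, hi) \<in> set ts\<close> by (fastforce simp: image_subset_iff)
      ultimately have "(l, y) \<in> set W"
        unfolding W_def by force
      then show ?thesis
        using xy by blast
    qed
    show ?thesis
    proof (cases l)
      case True
      show ?thesis
        by (rule cov[of c' ts']) (use True inner in simp_all)
    next
      case False
      show ?thesis
        by (rule cov[of c ts]) (use False outer in simp_all)
    qed
  qed
  ultimately show ?thesis
    unfolding gp_hamiltonian_def by blast
qed

subsection \<open>Cycles made of squares\<close>

text \<open>If a Hamilton cycle uses the spokes over a set \<open>B\<close> of outer coordinates, then the outer edges
  that it misses form a perfect matching of \<open>B\<close>, and so do the inner edges that it misses, which
  join coordinates with difference \<open>\<kappa>\<close>. The simplest sets \<open>B\<close> with both matchings are unions of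
  squares \<open>{x, x + 1, x + \<kappa>, x + \<kappa> + 1}\<close>. Whether the arcs that remain form a single cycle depends
  only on the cyclic order of \<open>B\<close> on either rim. One or two squares never give a single cycle, but
  three or four suitably placed ones do. Below, a square is named after its least corner.\<close>

text \<open>Here the coordinates \<open>u a b\<close> on the outer rim and \<open>v a b\<close> on the inner rim belong to the same
  spoke, and for small \<open>a\<close> and \<open>b\<close> the rims order the pairs \<open>(a, b)\<close> lexicographically, with \<open>b\<close>
  first on the outer rim and \<open>a\<close> first on the inner one. The squares are those at \<open>(0, 0)\<close>,
  \<open>(2, 0)\<close> and \<open>(0, 2)\<close>.\<close>

lemma gp_hamiltonian_pos_grid:
  fixes n k M :: int
  assumes k: "4 \<le> k" and M: "4 \<le> M" and n: "k * M = n + 1"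
  shows "gp_hamiltonian n k"
proof -
  define u v where "u a b = a + b * k" and "v a b = a * M + b" for a b
  have n': "n = k * M - 1"
    using n by simp
  have uv: "[u a b = k * v a b] (mod n)" for a b
  proof -
    have "u a b - k * v a b = n * (- a)"
      unfolding u_def v_def n' by (simp add: algebra_simps)
    then show ?thesis
      by (simp add: cong_iff_dvd_diff)
  qed
  have uv': "[n + u 0 0 = k * (n + v 0 0)] (mod n)"
    by (simp add: u_def v_def cong_iff_dvd_diff)
  have le: "4 * M \<le> n + 1" "4 * k \<le> n + 1"
    using mult_mono[of 4 k M M] mult_mono[of k k 4 M] k M n by linarith+
  note arith = u_def v_def
  show ?thesis
  proof (rule gp_hamiltonian_arcs)
    let ?As = "[(False, u 1 3, n + u 0 0, False), (True, v 1 3, v 2 0, True),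
      (False, u 1 0, u 2 0, False), (True, v 0 3, v 1 0, False),
      (False, u 1 2, u 0 3, False), (True, v 1 1, v 1 2, False),
      (False, u 1 1, u 2 1, True), (True, v 2 1, v 3 0, True),
      (False, u 3 0, u 0 1, True), (True, v 0 1, v 0 2, True),
      (False, u 3 1, u 0 2, False), (True, v 3 1, n + v 0 0, True)]"
    let ?ts = "[(u 1 0, u 2 0), (u 3 0, u 0 1), (u 1 1, u 2 1), (u 3 1, u 0 2),
      (u 1 2, u 0 3), (u 1 3, n + u 0 0)]"
    let ?ts' = "[(v 0 1, v 0 2), (v 0 3, v 1 0), (v 1 1, v 1 2), (v 1 3, v 2 0),
      (v 2 1, v 3 0), (v 3 1, n + v 0 0)]"
    show "successively (linked n k) ?As" "linked n k (last ?As) (hd ?As)"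
      using uv uv' by (simp_all add: linked_def)
    show "\<forall>(l, lo, hi, asc)\<in>set ?As. lo \<le> hi"
      using le k M by (simp add: arith)
    show "(\<Sum>(l, lo, hi, asc)\<leftarrow>?As. hi - lo + 1) = 2 * n"
      by (simp add: arith)
    show "tiles 1 ?ts (1 + n)" "tiles 1 ?ts' (1 + n)"
      using le k M by (simp_all add: arith)
    show "Pair False ` set ?ts \<subseteq> arc_interval ` set ?As" "Pair True ` set ?ts' \<subseteq> arc_interval ` set ?As"
      by simp_all
  qed (use le k in simp_all)
qed

text \<open>Now the inner rim runs through the pairs with the same \<open>a\<close> in the order of decreasing \<open>b\<close>. The
  squares are those at \<open>(0, 0)\<close>, \<open>(2, 0)\<close>, \<open>(4, 1)\<close> and \<open>(2, 2)\<close>.\<close>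

lemma gp_hamiltonian_neg_grid:
  fixes n k M :: int
  assumes k: "6 \<le> k" and M: "4 \<le> M" and n: "k * M = n - 1"
  shows "gp_hamiltonian n (- k)"
proof -
  define u v where "u a b = a + b * k" and "v a b = a * M - b" for a b
  have n': "n = k * M + 1"
    using n by simp
  have uv: "[u a b = - k * v a b] (mod n)" for a b
  proof -
    have "u a b - (- k * v a b) = n * a"
      unfolding u_def v_def n' by (simp add: algebra_simps)
    then show ?thesis
      by (simp add: cong_iff_dvd_diff)
  qed
  have uv': "[n + u 0 0 = - k * v 0 0] (mod n)" "[u 0 1 = - k * (n + v 0 1)] (mod n)"
    by (simp_all add: u_def v_def cong_iff_dvd_diff algebra_simps)
  have le: "6 * M \<le> n - 1" "4 * k \<le> n - 1"
    using mult_mono[of 6 k M M] mult_mono[of k k 4 M] k M n by linarith+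
  note arith = u_def v_def
  show ?thesis
  proof (rule gp_hamiltonian_arcs)
    let ?As = "[(False, u 3 3, n + u 0 0, False), (True, v 2 0, v 3 3, False),
      (False, u 1 0, u 2 0, False), (True, v 1 0, v 2 3, True),
      (False, u 5 2, u 2 3, False), (True, v 4 1, v 5 2, False),
      (False, u 3 1, u 4 1, False), (True, v 3 2, v 3 1, False),
      (False, u 3 2, u 4 2, True), (True, v 3 0, v 4 2, False),
      (False, u 3 0, u 0 1, True), (True, v 5 1, n + v 0 1, False),
      (False, u 5 1, u 2 2, True), (True, v 2 2, v 2 1, True),
      (False, u 1 1, u 2 1, False), (True, v 0 0, v 1 1, False)]"
    let ?ts = "[(u 1 0, u 2 0), (u 3 0, u 0 1), (u 1 1, u 2 1), (u 3 1, u 4 1),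
      (u 5 1, u 2 2), (u 3 2, u 4 2), (u 5 2, u 2 3), (u 3 3, n + u 0 0)]"
    let ?ts' = "[(v 0 0, v 1 1), (v 1 0, v 2 3), (v 2 2, v 2 1), (v 2 0, v 3 3),
      (v 3 2, v 3 1), (v 3 0, v 4 2), (v 4 1, v 5 2), (v 5 1, n + v 0 1)]"
    show "successively (linked n (- k)) ?As" "linked n (- k) (last ?As) (hd ?As)"
      using uv uv' by (simp_all add: linked_def)
    show "\<forall>(l, lo, hi, asc)\<in>set ?As. lo \<le> hi"
      using le k M by (simp add: arith)
    show "(\<Sum>(l, lo, hi, asc)\<leftarrow>?As. hi - lo + 1) = 2 * n"
      by (simp add: arith)
    show "tiles 1 ?ts (1 + n)" "tiles 0 ?ts' (0 + n)"
      using le k M by (simp_all add: arith)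
    show "Pair False ` set ?ts \<subseteq> arc_interval ` set ?As" "Pair True ` set ?ts' \<subseteq> arc_interval ` set ?As"
      by simp_all
  qed (use le k in simp_all)
qed

text \<open>In the next three lemmas the squares are those at \<open>0\<close>, \<open>b\<close> and \<open>c\<close>, and their upper sides lie in
  one row, their lower sides in the next. The unknowns \<open>A\<close>, \<open>B\<close>, \<open>B'\<close>, \<open>C\<close>, \<open>C'\<close> are the inner
  coordinates of \<open>1\<close>, \<open>b\<close>, \<open>b + 1\<close>, \<open>c\<close>, \<open>c + 1\<close>. Since the inner coordinate of \<open>x + K\<close> follows that
  of \<open>x\<close>, their order determines the cycle; three of the orders that give a single cycle are treated.\<close>

lemma gp_hamiltonian_strip_nested:
  fixes n K b c A B B' C C' :: int
  assumes bc: "1 \<le> b" "b < c" "c < K" "K + c < n"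
    and spokes: "[1 = K * A] (mod n)" "[b = K * B] (mod n)" "[b + 1 = K * B'] (mod n)"
      "[c = K * C] (mod n)" "[c + 1 = K * C'] (mod n)"
    and order: "0 < A" "A < C" "C < B" "B < C'" "C' < B'" "B' < n"
  shows "gp_hamiltonian n K"
proof -
  have below: "[K + x = K * (y + 1)] (mod n)" if "[x = K * y] (mod n)" for x y
    using cong_add[OF cong_refl[of K] that] by (simp add: algebra_simps)
  have wrap: "[n = K * n] (mod n)"
    by (simp add: cong_def)
  note spokes' = spokes spokes[THEN below] wrap
  show ?thesis
  proof (rule gp_hamiltonian_arcs)
    let ?As = "[(False, K + (c + 1), n, False), (True, C' + 1, B', True),
      (False, b + 1, c, True), (True, A + 1, C, False),
      (False, K + 1, K + b, True), (True, B + 1, C', True),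
      (False, c + 1, K, True), (True, 1, A, True), (False, 1, b, True),
      (True, C + 1, B, False), (False, K + (b + 1), K + c, False),
      (True, B' + 1, n, True)]"
    let ?ts = "[(1, b), (b + 1, c), (c + 1, K), (K + 1, K + b), (K + (b + 1), K + c),
      (K + (c + 1), n)]"
    let ?ts' = "[(1, A), (A + 1, C), (C + 1, B), (B + 1, C'), (C' + 1, B'), (B' + 1, n)]"
    show "successively (linked n K) ?As" "linked n K (last ?As) (hd ?As)"
      using spokes' by (simp_all only: linked_def successively.simps arc_start.simps arc_end.simps fst_conv
          if_True if_False simp_thms list.sel last.simps list.distinct mult_1_right cong_refl)
    show "\<forall>(l, lo, hi, asc)\<in>set ?As. lo \<le> hi"
      using bc order by simp
    show "(\<Sum>(l, lo, hi, asc)\<leftarrow>?As. hi - lo + 1) = 2 * n"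
      by simp
    show "tiles 1 ?ts (1 + n)" "tiles 1 ?ts' (1 + n)"
      using bc order by simp_all
    show "Pair False ` set ?ts \<subseteq> arc_interval ` set ?As" "Pair True ` set ?ts' \<subseteq> arc_interval ` set ?As"
      by simp_all
  qed (use bc in simp_all)
qed

lemma gp_hamiltonian_strip_cyclic:
  fixes n K b c A B B' C C' :: int
  assumes bc: "1 \<le> b" "b < c" "c < K" "K + c < n"
    and spokes: "[1 = K * A] (mod n)" "[b = K * B] (mod n)" "[b + 1 = K * B'] (mod n)"
      "[c = K * C] (mod n)" "[c + 1 = K * C'] (mod n)"
    and order: "0 < B" "B < C'" "C' < A" "A < B'" "B' < C" "C < n"
  shows "gp_hamiltonian n K"
proof -
  have below: "[K + x = K * (y + 1)] (mod n)" if "[x = K * y] (mod n)" for x y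
    using cong_add[OF cong_refl[of K] that] by (simp add: algebra_simps)
  have wrap: "[n = K * n] (mod n)"
    by (simp add: cong_def)
  note spokes' = spokes spokes[THEN below] wrap
  show ?thesis
  proof (rule gp_hamiltonian_arcs)
    let ?As = "[(False, K + (c + 1), n, False), (True, C' + 1, A, True),
      (False, 1, b, True), (True, 1, B, False), (False, c + 1, K, False),
      (True, B + 1, C', False), (False, K + 1, K + b, False),
      (True, A + 1, B', True), (False, b + 1, c, True), (True, B' + 1, C, False),
      (False, K + (b + 1), K + c, True), (True, C + 1, n, True)]"
    let ?ts = "[(1, b), (b + 1, c), (c + 1, K), (K + 1, K + b), (K + (b + 1), K + c),
      (K + (c + 1), n)]"
    let ?ts' = "[(1, B), (B + 1, C'), (C' + 1, A), (A + 1, B'), (B' + 1, C), (C + 1, n)]"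
    show "successively (linked n K) ?As" "linked n K (last ?As) (hd ?As)"
      using spokes' by (simp_all only: linked_def successively.simps arc_start.simps arc_end.simps fst_conv
          if_True if_False simp_thms list.sel last.simps list.distinct mult_1_right cong_refl)
    show "\<forall>(l, lo, hi, asc)\<in>set ?As. lo \<le> hi"
      using bc order by simp
    show "(\<Sum>(l, lo, hi, asc)\<leftarrow>?As. hi - lo + 1) = 2 * n"
      by simp
    show "tiles 1 ?ts (1 + n)" "tiles 1 ?ts' (1 + n)"
      using bc order by simp_all
    show "Pair False ` set ?ts \<subseteq> arc_interval ` set ?As" "Pair True ` set ?ts' \<subseteq> arc_interval ` set ?As"
      by simp_all
  qed (use bc in simp_all)
qed

lemma gp_hamiltonian_strip_shuffled:
  fixes n K b c A B B' C C' :: int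
  assumes bc: "1 \<le> b" "b < c" "c < K" "K + c < n"
    and spokes: "[1 = K * A] (mod n)" "[b = K * B] (mod n)" "[b + 1 = K * B'] (mod n)"
      "[c = K * C] (mod n)" "[c + 1 = K * C'] (mod n)"
    and order: "0 < C" "C < B" "B < A" "A < C'" "C' < B'" "B' < n"
  shows "gp_hamiltonian n K"
proof -
  have below: "[K + x = K * (y + 1)] (mod n)" if "[x = K * y] (mod n)" for x y
    using cong_add[OF cong_refl[of K] that] by (simp add: algebra_simps)
  have wrap: "[n = K * n] (mod n)"
    by (simp add: cong_def)
  note spokes' = spokes spokes[THEN below] wrap
  show ?thesis
  proof (rule gp_hamiltonian_arcs)
    let ?As = "[(False, K + (c + 1), n, False), (True, C' + 1, B', True),
      (False, b + 1, c, True), (True, 1, C, False), (False, c + 1, K, False),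
      (True, A + 1, C', False), (False, K + 1, K + b, True),
      (True, B + 1, A, True), (False, 1, b, True), (True, C + 1, B, False),
      (False, K + (b + 1), K + c, False), (True, B' + 1, n, True)]"
    let ?ts = "[(1, b), (b + 1, c), (c + 1, K), (K + 1, K + b), (K + (b + 1), K + c),
      (K + (c + 1), n)]"
    let ?ts' = "[(1, C), (C + 1, B), (B + 1, A), (A + 1, C'), (C' + 1, B'), (B' + 1, n)]"
    show "successively (linked n K) ?As" "linked n K (last ?As) (hd ?As)"
      using spokes' by (simp_all only: linked_def successively.simps arc_start.simps arc_end.simps fst_conv
          if_True if_False simp_thms list.sel last.simps list.distinct mult_1_right cong_refl)
    show "\<forall>(l, lo, hi, asc)\<in>set ?As. lo \<le> hi"
      using bc order by simp
    show "(\<Sum>(l, lo, hi, asc)\<leftarrow>?As. hi - lo + 1) = 2 * n"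
      by simp
    show "tiles 1 ?ts (1 + n)" "tiles 1 ?ts' (1 + n)"
      using bc order by simp_all
    show "Pair False ` set ?ts \<subseteq> arc_interval ` set ?As" "Pair True ` set ?ts' \<subseteq> arc_interval ` set ?As"
      by simp_all
  qed (use bc in simp_all)
qed

text \<open>For \<open>\<kappa> = \<plusminus> 3\<close> there is no room for three squares next to each other. There the missing edges
  form a hexagon if \<open>\<kappa> = -3\<close>, and a hexagon together with a square if \<open>\<kappa> = 3\<close>. The cycles for
  \<open>GP(13,5)\<close> and \<open>GP(17,4)\<close> are single solutions.\<close>

lemma gp_hamiltonian_13_5: "gp_hamiltonian 13 5"
proof (rule gp_hamiltonian_arcs)
  let ?As = "[(False, 9, 13, False), (True, 7, 8, True), (False, 1, 2, True),
    (True, 1, 3, False), (False, 5, 6, True), (True, 9, 11, True),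
    (False, 3, 4, True), (True, 4, 6, False), (False, 7, 8, True),
    (True, 12, 13, True)] :: arc list"
  let ?ts = "[(1, 2), (3, 4), (5, 6), (7, 8), (9, 13)] :: (int \<times> int) list"
  let ?ts' = "[(1, 3), (4, 6), (7, 8), (9, 11), (12, 13)] :: (int \<times> int) list"
  show "successively (linked 13 5) ?As" "linked 13 5 (last ?As) (hd ?As)"
    by (simp_all add: linked_def cong_iff_dvd_diff)
  show "\<forall>(l, lo, hi, asc)\<in>set ?As. lo \<le> hi"
    by simp
  show "(\<Sum>(l, lo, hi, asc)\<leftarrow>?As. hi - lo + 1) = 2 * 13"
    by simp
  show "tiles 1 ?ts (1 + 13)" "tiles 1 ?ts' (1 + 13)"
    by simp_all
  show "Pair False ` set ?ts \<subseteq> arc_interval ` set ?As" "Pair True ` set ?ts' \<subseteq> arc_interval ` set ?As"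
    by simp_all
qed simp_all

lemma gp_hamiltonian_17_4: "gp_hamiltonian 17 4"
proof (rule gp_hamiltonian_arcs)
  let ?As = "[(False, 16, 17, False), (True, 4, 5, True), (False, 3, 4, True),
    (True, 1, 3, True), (False, 10, 12, False), (True, 11, 13, True),
    (False, 1, 2, True), (True, 9, 10, True), (False, 5, 6, False),
    (True, 14, 15, True), (False, 7, 9, False), (True, 6, 8, True),
    (False, 13, 15, False), (True, 16, 17, True)] :: arc list"
  let ?ts = "[(1, 2), (3, 4), (5, 6), (7, 9), (10, 12), (13, 15), (16, 17)] :: (int \<times> int) list"
  let ?ts' = "[(1, 3), (4, 5), (6, 8), (9, 10), (11, 13), (14, 15), (16, 17)] :: (int \<times> int) list"
  show "successively (linked 17 4) ?As" "linked 17 4 (last ?As) (hd ?As)"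
    by (simp_all add: linked_def cong_iff_dvd_diff)
  show "\<forall>(l, lo, hi, asc)\<in>set ?As. lo \<le> hi"
    by simp
  show "(\<Sum>(l, lo, hi, asc)\<leftarrow>?As. hi - lo + 1) = 2 * 17"
    by simp
  show "tiles 1 ?ts (1 + 17)" "tiles 1 ?ts' (1 + 17)"
    by simp_all
  show "Pair False ` set ?ts \<subseteq> arc_interval ` set ?As" "Pair True ` set ?ts' \<subseteq> arc_interval ` set ?As"
    by simp_all
qed simp_all

lemma gp_hamiltonian_neg_3:
  fixes n M :: int
  assumes "4 \<le> M" "3 * M = n - 1"
  shows "gp_hamiltonian n (- 3)"
proof -
  have cong3: "[a = (- 3) * b] (mod n)" if "a - (- 3) * b = n * s" for a b s
    using that by (simp add: cong_iff_dvd_diff)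
  note spokes = cong3[of "5" "2 * M - 1" "2"]
      cong3[of "1" "M" "1"]
      cong3[of "2" "2 * M" "2"]
      cong3[of "3" "n - 1" "3"]
      cong3[of "4" "M - 1" "1"]
      cong3[of "n" "0" "1"]
  show ?thesis
  proof (rule gp_hamiltonian_arcs)
    let ?As = "[(False, 5, n, False), (True, M, 2 * M - 1, False), (False, 1, 2, True),
      (True, 2 * M, n - 1, True), (False, 3, 4, True), (True, 0, M - 1, False)] :: arc list"
    let ?ts = "[(1, 2), (3, 4), (5, n)] :: (int \<times> int) list"
    let ?ts' = "[(0, M - 1), (M, 2 * M - 1), (2 * M, n - 1)] :: (int \<times> int) list"
    show "successively (linked n (- 3)) ?As" "linked n (- 3) (last ?As) (hd ?As)"
      using spokes assms by (simp_all add: linked_def)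
    show "\<forall>(l, lo, hi, asc)\<in>set ?As. lo \<le> hi"
      using assms by simp
    show "(\<Sum>(l, lo, hi, asc)\<leftarrow>?As. hi - lo + 1) = 2 * n"
      using assms by simp
    show "tiles 1 ?ts (1 + n)" "tiles 0 ?ts' (0 + n)"
      using assms by simp_all
    show "Pair False ` set ?ts \<subseteq> arc_interval ` set ?As" "Pair True ` set ?ts' \<subseteq> arc_interval ` set ?As"
      by simp_all
  qed (use assms in simp_all)
qed

lemma gp_hamiltonian_pos_3:
  fixes n M :: int
  assumes "4 \<le> M" "3 * M = n + 1"
  shows "gp_hamiltonian n 3"
proof -
  have cong3: "[a = 3 * b] (mod n)" if "a - 3 * b = n * s" for a b s
    using that by (simp add: cong_iff_dvd_diff)
  note spokes = cong3[of "10" "M + 3" "-1"]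
      cong3[of "5" "2 * M + 1" "-2"]
      cong3[of "4" "M + 1" "-1"]
      cong3[of "7" "M + 2" "-1"]
      cong3[of "6" "2" "0"]
      cong3[of "3" "1" "0"]
      cong3[of "1" "M" "-1"]
      cong3[of "9" "3" "0"]
      cong3[of "8" "2 * M + 2" "-2"]
      cong3[of "n" "n" "-2"]
  show ?thesis
  proof (rule gp_hamiltonian_arcs)
    let ?As = "[(False, 10, n, False), (True, M + 3, 2 * M + 1, True), (False, 4, 5, False),
      (True, M + 1, M + 2, True), (False, 6, 7, False), (True, 1, 2, False),
      (False, 1, 3, False), (True, 3, M, False), (False, 8, 9, False),
      (True, 2 * M + 2, n, True)] :: arc list"
    let ?ts = "[(1, 3), (4, 5), (6, 7), (8, 9), (10, n)] :: (int \<times> int) list"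
    let ?ts' = "[(1, 2), (3, M), (M + 1, M + 2), (M + 3, 2 * M + 1), (2 * M + 2, n)] :: (int \<times> int) list"
    show "successively (linked n 3) ?As" "linked n 3 (last ?As) (hd ?As)"
      using spokes assms by (simp_all add: linked_def)
    show "\<forall>(l, lo, hi, asc)\<in>set ?As. lo \<le> hi"
      using assms by simp
    show "(\<Sum>(l, lo, hi, asc)\<leftarrow>?As. hi - lo + 1) = 2 * n"
      using assms by simp
    show "tiles 1 ?ts (1 + n)" "tiles 1 ?ts' (1 + n)"
      using assms by simp_all
    show "Pair False ` set ?ts \<subseteq> arc_interval ` set ?As" "Pair True ` set ?ts' \<subseteq> arc_interval ` set ?As"
      by simp_all
  qed (use assms in simp_all)
qed

subsection \<open>Generalised Petersen graphs of prime order\<close>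

lemma not_prime_int_mult:
  fixes a b :: int
  assumes "1 < a" "1 < b"
  shows "\<not> prime (a * b)"
proof
  assume "prime (a * b)"
  then have "is_unit a \<or> is_unit b"
    by (intro irreducibleD[of "a * b"] prime_elem_imp_irreducible) auto
  then show False
    using assms by auto
qed

text \<open>The inner coordinate \<open>Y x\<close> of \<open>x\<close> satisfies \<open>k * Y x = \<tau> x + n * j x\<close>, so for \<open>0 \<le> x < k\<close> the inner rim
  runs through the columns \<open>x\<close> in the order of the residues \<open>j x = g x mod k\<close>. It remains to find
  columns \<open>b\<close> and \<open>c\<close> such that the residues of \<open>0, 1, b, b + 1, c, c + 1\<close> are in one of the three good
  orders. For \<open>k > 3 g\<close> take \<open>b = 2\<close> and let \<open>c - b\<close> be the number of steps \<open>g\<close> in one turn modulo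
  \<open>k\<close>; for \<open>2 g + 1 < k < 3 g\<close> take \<open>b = 3\<close> and \<open>j c = k - 1\<close>; for \<open>k = 2 g + 1\<close> take \<open>b = 3\<close> and
  \<open>c = 5\<close>.\<close>

lemma gp_hamiltonian_strip:
  fixes n k M g \<tau> :: int
  assumes k: "7 \<le> k" "2 * k < n" and g: "2 \<le> g" "2 * g < k"
    and \<tau>: "\<tau> \<in> {1, -1}" and kM: "k * M = g * n + \<tau>"
  shows "gp_hamiltonian n k"
proof -
  define Y j where "Y x = M * x - n * ((g * x) div k)" and "j x = (g * x) mod k" for x
  define K where "K = (if \<tau> = 1 then k else n - k)"
  have n: "0 < n" "0 < k"
    using k by simp_all
  have kY: "k * Y x = \<tau> * x + n * j x" for x
  proof -
    have "k * Y x = (k * M) * x - n * (k * ((g * x) div k))"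
      by (simp add: Y_def algebra_simps)
    also have "k * ((g * x) div k) = g * x - j x"
      unfolding j_def by (simp add: minus_mod_eq_mult_div)
    finally show ?thesis
      unfolding kM by (simp add: algebra_simps)
  qed
  have spoke: "[x = K * Y x] (mod n)" for x
  proof -
    have "[K * Y x = (\<tau> * k) * Y x] (mod n)"
      using \<tau> by (intro cong_mult cong_refl) (auto simp: K_def cong_iff_dvd_diff)
    also have "(\<tau> * k) * Y x = \<tau> * (k * Y x)"
      by simp
    also have "\<tau> * (k * Y x) = x + n * (\<tau> * j x)"
      using \<tau> unfolding kY by (auto simp: algebra_simps)
    finally have "[K * Y x = x + n * (\<tau> * j x)] (mod n)" .
    moreover have "[x + n * (\<tau> * j x) = x] (mod n)"
      by (simp add: cong_def)
    ultimately show ?thesis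
      using cong_sym cong_trans by blast
  qed
  have less: "Y x < Y x'" if "j x < j x'" "0 \<le> x" "x < k" "0 \<le> x'" "x' < k" for x x'
  proof -
    have "k * (Y x' - Y x) = \<tau> * (x' - x) + n * (j x' - j x)"
      using kY[of x] kY[of x'] by (simp add: algebra_simps)
    moreover have "n * 1 \<le> n * (j x' - j x)"
      using n that(1) by (intro mult_left_mono) auto
    moreover have "- k < \<tau> * (x' - x)"
      using \<tau> that by auto
    ultimately have "0 < k * (Y x' - Y x)"
      using k by linarith
    then show ?thesis
      using n by (simp add: zero_less_mult_iff)
  qed
  have pos: "0 < Y x" if "0 < j x" "0 \<le> x" "x < k" for x
    using less[of 0 x] that n by (simp add: Y_def j_def)
  have less_n: "Y x < n" if "0 \<le> x" "x < k" for x
  proof -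
    have "j x \<le> k - 1"
      using n by (simp add: j_def)
    then have "n * j x \<le> n * (k - 1)"
      using n by (intro mult_left_mono) auto
    moreover have "\<tau> * x < k"
      using \<tau> that by auto
    ultimately have "k * Y x < k * n"
      unfolding kY using k by (simp add: algebra_simps)
    then show ?thesis
      using n by simp
  qed
  have jI: "j x = s" if "g * x = k * t + s" "0 \<le> s" "s < k" for x t s
    unfolding j_def that(1) using that(2,3) by simp
  have not_dvd: "\<not> g dvd k"
  proof
    assume "g dvd k"
    then have "g dvd k * M - g * n"
      by simp
    then have "g dvd \<tau>"
      unfolding kM by simp
    then show False
      using \<tau> g zdvd_imp_le[of g 1] by auto
  qed
  have "gp_hamiltonian n K"
  proof -
    consider "3 * g < k" | "2 * g + 2 \<le> k" "k < 3 * g" | "k = 2 * g + 1"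
      using g not_dvd by fastforce
    then show ?thesis
    proof cases
      case 1
      define \<delta> \<rho> where "\<delta> = k div g" and "\<rho> = k mod g"
      have \<delta>: "g * \<delta> + \<rho> = k"
        by (simp add: \<delta>_def \<rho>_def)
      have \<rho>: "0 < \<rho>" "\<rho> < g"
        using not_dvd g pos_mod_bound[of g k] pos_mod_sign[of g k]
        by (auto simp: \<rho>_def dvd_eq_mod_eq_0 order_less_le simp del: pos_mod_bound pos_mod_sign)
      have "2 * \<delta> \<le> g * \<delta>"
        using g n by (intro mult_right_mono) (auto simp: \<delta>_def pos_imp_zdiv_nonneg_iff)
      then have \<delta>': "\<delta> + 4 \<le> k"
        using \<delta> \<rho> k by linarith
      have "2 < \<delta>"
      proof (rule ccontr)
        assume "\<not> 2 < \<delta>"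
        then have "g * \<delta> \<le> g * 2"
          using g by (intro mult_left_mono) auto
        then show False
          using \<delta> \<rho> 1 by linarith
      qed
      have j: "j 1 = g" "j 2 = 2 * g" "j (2 + 1) = 3 * g"
        "j (2 + \<delta>) = 2 * g - \<rho>" "j (2 + \<delta> + 1) = 3 * g - \<rho>"
      proof -
        show "j 1 = g" "j 2 = 2 * g" "j (2 + 1) = 3 * g"
          by (rule jI[of _ 0], use 1 g in simp_all)+
        show "j (2 + \<delta>) = 2 * g - \<rho>"
          by (rule jI[of _ 1]) (use 1 g \<delta> \<rho> in \<open>simp_all add: algebra_simps\<close>)
        show "j (2 + \<delta> + 1) = 3 * g - \<rho>"
          by (rule jI[of _ 1]) (use 1 g \<delta> \<rho> in \<open>simp_all add: algebra_simps\<close>)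
      qed
      show ?thesis
        by (rule gp_hamiltonian_strip_nested[of 2 "2 + \<delta>" K n "Y 1" "Y 2" "Y (2 + 1)" "Y (2 + \<delta>)" "Y (2 + \<delta> + 1)"];
            (rule spoke less pos less_n)?)
          (use \<open>2 < \<delta>\<close> \<delta>' \<rho> g k j in \<open>auto simp: K_def\<close>)
    next
      case 2
      have "coprime g k"
      proof (rule coprimeI)
        fix d assume "d dvd g" "d dvd k"
        then have "d dvd k * M - g * n"
          by simp
        then show "is_unit d"
          using \<tau> unfolding kM by auto
      qed
      then obtain c0 where c0: "[g * c0 = 1] (mod k)"
        using cong_solve_coprime_int by blast
      define c where "c = (- c0) mod k"
      have c: "0 \<le> c" "c < k"
        using n by (simp_all add: c_def)
      have "[g * c = g * (- c0)] (mod k)"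
        by (intro cong_mult cong_refl) (simp add: c_def cong_def)
      then have "[g * c + 1 = g * (- c0) + 1] (mod k)"
        by (intro cong_add cong_refl)
      moreover have "[g * (- c0) + 1 = 0] (mod k)"
        using c0 by (simp add: cong_iff_dvd_diff dvd_diff_commute)
      ultimately have "k dvd g * c + 1"
        using cong_0_iff cong_trans by blast
      then obtain t where t: "g * c + 1 = k * t"
        by (auto simp: dvd_def)
      have c5: "5 \<le> c \<and> c \<le> k - 2"
      proof (rule ccontr)
        assume "\<not> ?thesis"
        then consider "c = 0" | "c = 1" | "c = 2" | "c = 3" | "c = 4" | "c = k - 1"
          using c by fastforce
        then show False
        proof cases
          case 1
          then show ?thesis using t k by (auto simp: zmult_eq_1_iff dest!: sym[of 1])
        next
          case 2
          then have "k dvd g + 1" using t by simp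
          then show ?thesis using zdvd_imp_le[of k "g + 1"] g by simp
        next
          case 3
          then have "k dvd 2 * g + 1" using t by (simp add: mult.commute)
          then show ?thesis using zdvd_imp_le[of k "2 * g + 1"] g \<open>2 * g + 2 \<le> k\<close> by simp
        next
          case 4
          then have "k dvd (3 * g + 1) - k" using t by (simp add: mult.commute)
          then show ?thesis using zdvd_imp_le[of k "3 * g + 1 - k"] g 2 by simp
        next
          case 5
          then have t4: "4 * g + 1 = k * t" using t by (simp add: mult.commute)
          have "k * 1 < k * t"
            using 2 g t4 by linarith
          moreover have "k * t < k * 3"
            using 2 g t4 by linarith
          ultimately have "t = 2"
            using mult_less_cancel_left_pos[OF n(2), of 1 t] mult_less_cancel_left_pos[OF n(2), of t 3]
            by linarith
          then show ?thesis using t4 by presburger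
        next
          case 6
          then have "g * (k - 1) + 1 = k * t"
            using t by simp
          moreover have "g * (k - 1) = k * g - g"
            by (simp add: right_diff_distrib mult.commute)
          ultimately have "k * g - (g - 1) = k * t"
            by linarith
          then have "k dvd k * g - (g - 1)"
            by simp
          then have "k dvd g - 1"
            by (simp add: dvd_diff_right_iff)
          then show ?thesis using zdvd_imp_le[of k "g - 1"] g by simp
        qed
      qed
      have j: "j 1 = g" "j 3 = 3 * g - k" "j (3 + 1) = 4 * g - k" "j c = k - 1" "j (c + 1) = g - 1"
      proof -
        show "j 1 = g"
          by (rule jI[of _ 0]) (use 2 g in simp_all)
        show "j 3 = 3 * g - k" "j (3 + 1) = 4 * g - k"
          by (rule jI[of _ 1], use 2 g in simp_all)+
        show "j c = k - 1"
          by (rule jI[of _ "t - 1"]) (use t n in \<open>simp_all add: algebra_simps\<close>)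
        show "j (c + 1) = g - 1"
          by (rule jI[of _ t]) (use t g in \<open>simp_all add: algebra_simps\<close>)
      qed
      show ?thesis
        by (rule gp_hamiltonian_strip_cyclic[of 3 c K n "Y 1" "Y 3" "Y (3 + 1)" "Y c" "Y (c + 1)"];
            (rule spoke less pos less_n)?)
          (use c5 g k j 2 in \<open>auto simp: K_def\<close>)
    next
      case 3
      have j: "j 1 = g" "j 3 = g - 1" "j (3 + 1) = 2 * g - 1" "j 5 = g - 2" "j (5 + 1) = 2 * g - 2"
      proof -
        show "j 1 = g"
          by (rule jI[of _ 0]) (use 3 g in simp_all)
        show "j 3 = g - 1" "j (3 + 1) = 2 * g - 1"
          by (rule jI[of _ 1], use 3 g in simp_all)+
        show "j 5 = g - 2" "j (5 + 1) = 2 * g - 2"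
          by (rule jI[of _ 2], use 3 g in simp_all)+
      qed
      show ?thesis
        by (rule gp_hamiltonian_strip_shuffled[of 3 5 K n "Y 1" "Y 3" "Y (3 + 1)" "Y 5" "Y (5 + 1)"];
            (rule spoke less pos less_n)?)
          (use g k j 3 in \<open>auto simp: K_def\<close>)
    qed
  qed
  then have "gp_hamiltonian n (\<tau> * k)"
    by (rule gp_hamiltonian_cong[OF _ n(1)]) (use \<tau> in \<open>auto simp: K_def cong_iff_dvd_diff\<close>)
  then show ?thesis
    using \<tau> gp_hamiltonian_uminus[of n "- k"] n by auto
qed

text \<open>Up to sign \<open>M\<close> is the inverse of \<open>k\<close>, so the exchange of the rims relates the two graphs.\<close>

lemma gp_hamiltonian_exchange:
  fixes n k M g \<tau> :: int
  assumes "gp_hamiltonian n M" "0 < n" and \<tau>: "\<tau> \<in> {1, -1}" and kM: "k * M = g * n + \<tau>"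
  shows "gp_hamiltonian n k"
proof -
  have "gp_hamiltonian n (\<tau> * M)"
    using \<tau> assms(1,2) gp_hamiltonian_uminus by auto
  then show ?thesis
  proof (rule gp_hamiltonian_swap[OF _ assms(2)])
    have "\<tau> * M * k = \<tau> * (k * M)"
      by simp
    also have "\<dots> = 1 + n * (\<tau> * g)"
      unfolding kM using \<tau> by (auto simp: algebra_simps)
    finally show "[\<tau> * M * k = 1] (mod n)"
      by (simp add: cong_iff_dvd_diff)
  qed
qed

text \<open>For \<open>g = 1\<close> the columns are met in their natural order and no strip of squares works; then
  \<open>n = k M \<mp> 1\<close> is almost a \<open>k \<times> M\<close> grid, and the lattice patterns apply. For \<open>g \<ge> 2\<close> a strip
  works for \<open>k\<close> or for \<open>M\<close>, whichever is at least 7.\<close>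

lemma gp_hamiltonian_reduced:
  fixes n k M g \<tau> :: int
  assumes n: "prime n" "10 < n" and k: "3 \<le> k" "2 * k < n" and M: "3 \<le> M" "2 * M < n"
    and \<tau>: "\<tau> \<in> {1, -1}" and kM: "k * M = g * n + \<tau>"
  shows "gp_hamiltonian n k"
proof -
  have Mk: "M * k = g * n + \<tau>"
    using kM by (simp add: mult.commute)
  have ex: "gp_hamiltonian n M \<Longrightarrow> gp_hamiltonian n k"
    using gp_hamiltonian_exchange[OF _ _ \<tau> kM] n by simp
  have neg: "gp_hamiltonian n (- t) \<Longrightarrow> gp_hamiltonian n t" for t
    using gp_hamiltonian_uminus[of n "- t"] n by simp
  have "9 \<le> k * M"
    using mult_mono[of 3 k 3 M] k M by simp
  have g1: "1 \<le> g"
  proof (rule ccontr)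
    assume "\<not> 1 \<le> g"
    then have "g * n \<le> 0 * n"
      using n by (intro mult_right_mono) auto
    then show False
      using \<open>9 \<le> k * M\<close> kM \<tau> by auto
  qed
  show ?thesis
  proof (cases "g = 1")
    case True
    show ?thesis
    proof (cases "\<tau> = 1")
      case tau: True
      have kM1: "k * M = n + 1" "M * k = n + 1"
        using kM Mk True tau by simp_all
      consider "4 \<le> k" "4 \<le> M" | "k = 3" | "M = 3"
        using k M by linarith
      then show ?thesis
      proof cases
        case 1
        then show ?thesis using gp_hamiltonian_pos_grid kM1 by blast
      next
        case 2
        then show ?thesis using gp_hamiltonian_pos_3[of M n] kM1 n by simp
      next
        case 3
        then show ?thesis using gp_hamiltonian_pos_3[of k n] kM1 n ex by simp
      qed
    next
      case False
      then have kM1: "k * M = n - 1" "M * k = n - 1"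
        using kM Mk True \<tau> by auto
      consider "6 \<le> k" "4 \<le> M" | "4 \<le> k" "6 \<le> M" | "k = 3" | "M = 3" | "k \<in> {4, 5}" "M \<in> {4, 5}"
        using k M by fastforce
      then show ?thesis
      proof cases
        case 1
        then show ?thesis using gp_hamiltonian_neg_grid kM1 neg by blast
      next
        case 2
        then show ?thesis using gp_hamiltonian_neg_grid kM1 neg ex by blast
      next
        case 3
        then show ?thesis using gp_hamiltonian_neg_3[of M n] kM1 n neg[of 3] by simp
      next
        case 4
        then show ?thesis using gp_hamiltonian_neg_3[of k n] kM1 n neg[of 3] ex by simp
      next
        case 5
        then have "n = 17 \<and> k = 4 \<or> n = 3 * 7 \<or> n = 2 * 13"
          using kM1 by auto
        moreover have "\<not> prime (3 * 7 :: int)" "\<not> prime (2 * 13 :: int)"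
          by (intro not_prime_int_mult; simp)+
        ultimately show ?thesis
          using gp_hamiltonian_17_4 n by auto
      qed
    qed
  next
    case False
    then have g2: "2 \<le> g"
      using g1 by simp
    have large: "2 * g < t" if "t * s = g * n + \<tau>" "2 * s < n" "3 \<le> s" for t s
    proof (rule ccontr)
      assume "\<not> 2 * g < t"
      then have "t * s \<le> 2 * g * s"
        using that by (intro mult_right_mono) auto
      moreover have "g * (2 * s + 1) \<le> g * n"
        using that g2 by (intro mult_left_mono) auto
      ultimately show False
        using that(1) g2 \<tau> by (auto simp: algebra_simps)
    qed
    have gk: "2 * g < k" and gM: "2 * g < M"
      using large[OF kM M(2,1)] large[OF Mk k(2,1)] by blast+
    consider "7 \<le> k" | "7 \<le> M" | "k \<in> {5, 6}" "M \<in> {5, 6}"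
      using gk gM g2 by fastforce
    then show ?thesis
    proof cases
      case 1
      then show ?thesis using gp_hamiltonian_strip[OF 1 k(2) g2 gk \<tau> kM] by blast
    next
      case 2
      then show ?thesis using gp_hamiltonian_strip[OF 2 M(2) g2 gM \<tau> Mk] ex by blast
    next
      case 3
      then have "g = 2"
        using gk g2 by auto
      then have "n = 13 \<and> k = 5 \<or> 2 * n = 24 \<or> 2 * n = 35 \<or> 2 * n = 37 \<or> 2 * n = 29 \<or> 2 * n = 31"
        using kM 3 \<tau> by auto
      moreover have "2 * n \<noteq> 35" "2 * n \<noteq> 37" "2 * n \<noteq> 29" "2 * n \<noteq> 31"
        by presburger+
      moreover have "\<not> prime (2 * 6 :: int)"
        by (intro not_prime_int_mult; simp)
      ultimately show ?thesis
        using gp_hamiltonian_13_5 n by auto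
    qed
  qed
qed

text \<open>The excluded ratios are those of the graphs \<open>GP(p,1)\<close> and \<open>GP(p,2)\<close>.\<close>

theorem gp_hamiltonian_prime:
  fixes n \<kappa> :: int
  assumes n: "prime n" "10 < n" and \<kappa>: "\<not> n dvd \<kappa>"
    and ratio: "\<And>e. e \<in> {1, -1} \<Longrightarrow> \<not> n dvd \<kappa> + e \<and> \<not> n dvd \<kappa> + 2 * e \<and> \<not> n dvd 2 * \<kappa> + e"
  shows "gp_hamiltonian n \<kappa>"
proof -
  have rep: "\<exists>k e. e \<in> {1, -1} \<and> 0 < k \<and> 2 * k < n \<and> [t = e * k] (mod n)" if "\<not> n dvd t" for t
  proof -
    define s where "s = t mod n"
    have s: "0 < s" "s < n" "[t = s] (mod n)"
      using that n pos_mod_bound[of n t] pos_mod_sign[of n t]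
      by (auto simp: s_def cong_def dvd_eq_mod_eq_0 order_less_le simp del: pos_mod_bound pos_mod_sign)
    have "n \<noteq> 2 * s"
      using n not_prime_int_mult[of 2 s] s(1) by (cases "s = 1") auto
    then consider "2 * s < n" | "n < 2 * s"
      by linarith
    then show ?thesis
    proof cases
      case 1
      then show ?thesis
        using s by (intro exI[of _ s] exI[of _ 1]) auto
    next
      case 2
      have "[t = - 1 * (n - s)] (mod n)"
        using s(3) dvd_add[of n "t - s" n] by (simp add: cong_iff_dvd_diff algebra_simps)
      then show ?thesis
        using 2 s by (intro exI[of _ "n - s"] exI[of _ "-1"]) auto
    qed
  qed
  obtain k e where k: "e \<in> {1, -1}" "0 < k" "2 * k < n" "[\<kappa> = e * k] (mod n)"
    using rep[OF \<kappa>] by blast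
  have "coprime \<kappa> n"
    using n(1) \<kappa> prime_imp_coprime coprime_commute by blast
  then obtain \<mu> where \<mu>: "[\<kappa> * \<mu> = 1] (mod n)"
    using cong_solve_coprime_int by blast
  have "\<not> n dvd \<mu>"
  proof
    assume "n dvd \<mu>"
    then have "n dvd 1"
      using \<mu> cong_dvd_iff[of "\<kappa> * \<mu>" 1 n] by simp
    then show False
      using n by simp
  qed
  then obtain M e' where M: "e' \<in> {1, -1}" "0 < M" "2 * M < n" "[\<mu> = e' * M] (mod n)"
    using rep by blast
  have ne: "[\<kappa> * (e' * M) = 1] (mod n)"
    using cong_trans[OF cong_sym[OF cong_mult[OF cong_refl[of \<kappa>] M(4)]] \<mu>] .
  have k3: "3 \<le> k"
  proof -
    have "k \<noteq> 1"
      using k(1,4) ratio[of "- e"] by (auto simp: cong_iff_dvd_diff)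
    moreover have "k \<noteq> 2"
      using k(1,4) ratio[of "- e"] by (auto simp: cong_iff_dvd_diff)
    ultimately show ?thesis
      using k(2) by linarith
  qed
  have M3: "3 \<le> M"
  proof -
    have "M \<noteq> 1"
    proof
      assume "M = 1"
      then have "n dvd e' * (\<kappa> * e' - 1)"
        using ne by (simp add: cong_iff_dvd_diff)
      moreover have "e' * (\<kappa> * e' - 1) = \<kappa> + - e'"
        using M(1) by (auto simp: algebra_simps)
      ultimately show False
        using ratio[of "- e'"] M(1) by auto
    qed
    moreover have "M \<noteq> 2"
    proof
      assume "M = 2"
      then have "n dvd e' * (\<kappa> * (e' * 2) - 1)"
        using ne by (simp add: cong_iff_dvd_diff)
      moreover have "e' * (\<kappa> * (e' * 2) - 1) = 2 * \<kappa> + - e'"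
        using M(1) by (auto simp: algebra_simps)
      ultimately show False
        using ratio[of "- e'"] M(1) by auto
    qed
    ultimately show ?thesis
      using M(2) by linarith
  qed
  have "[(e * k) * (e' * M) = \<kappa> * (e' * M)] (mod n)"
    by (intro cong_mult cong_refl cong_sym[OF k(4)])
  then have "n dvd (e * k) * (e' * M) - 1"
    using cong_trans[OF _ ne] by (auto simp: cong_iff_dvd_diff)
  then have "n dvd (e * e') * ((e * k) * (e' * M) - 1)"
    by (rule dvd_mult)
  moreover have "(e * e') * ((e * k) * (e' * M) - 1) = k * M - e * e'"
    using k(1) M(1) by auto
  ultimately have "n dvd k * M - e * e'"
    by metis
  then obtain g where "k * M - e * e' = n * g"
    by (rule dvdE)
  then have g: "k * M = g * n + e * e'"
    by (simp add: algebra_simps)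
  have "gp_hamiltonian n k"
    using gp_hamiltonian_reduced[OF n k3 k(3) M3 M(3) _ g] k(1) M(1) by auto
  then have "gp_hamiltonian n (e * k)"
    using k(1) gp_hamiltonian_uminus n by auto
  then show ?thesis
    using gp_hamiltonian_cong[OF _ _ cong_sym[OF k(4)]] n by simp
qed

section \<open>Hamilton cycles in layered graphs\<close>

context layered
begin

lemma hamilton_cycleI:
  assumes len: "length W = p * q" and cover: "V \<subseteq> set W"
    and path: "successively adj W" and closing: "adj (last W) (hd W)"
  shows "hamilton_cycle X W"
proof -
  have cV: "card V = p * q"
    by (simp add: V_def card_cartesian_product mult.commute)
  have "card V \<le> card (set W)"
    using cover by (intro card_mono) auto
  moreover have "card (set W) \<le> length W"
    by (rule card_length)
  ultimately have c: "card (set W) = length W" "card (set W) = card V"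
    using cV len by simp_all
  have dist: "distinct W"
    using c(1) by (rule card_distinct)
  have "V = set W"
    using cover c(2) by (intro card_subset_eq) auto
  have "2 * 2 \<le> p * q"
    using p_gt_1 q_gt_1 by (intro mult_le_mono) auto
  then have len3: "3 \<le> length W"
    using len by simp
  have "{W ! i, W ! ((i + 1) mod length W)} \<in> edges X" if i: "i < length W" for i
  proof (cases "Suc i < length W")
    case True
    then have "adj (W ! i) (W ! Suc i)"
      using path by (simp add: successively_conv_nth)
    then show ?thesis
      using True by (simp add: adj_def)
  next
    case False
    then have "Suc i = length W"
      using i by simp
    then have "i = length W - 1" "(i + 1) mod length W = 0"
      by simp_all
    moreover have "W \<noteq> []"
      using len3 by auto
    ultimately show ?thesis
      using closing by (simp add: adj_def last_conv_nth hd_conv_nth)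
  qed
  then show ?thesis
    using len3 dist \<open>V = set W\<close> by (simp add: hamilton_cycle_def verts_X)
qed

lemma hamilton_cycle_generalised_Petersen:
  assumes q2: "q = 2" and gp: "gp_hamiltonian (int p) r"
  shows "\<exists>C. hamilton_cycle X C"
proof -
  obtain W where W: "int (length W) = 2 * int p" "successively (gp_adj (int p) r) W"
      "gp_adj (int p) r (last W) (hd W)" "\<And>l x. \<exists>y. (l, y) \<in> set W \<and> [x = y] (mod int p)"
    using gp by (auto simp: gp_hamiltonian_def)
  define h where "h u = (if fst u then N 1 (r * snd u) else N 0 (snd u))" for u :: "bool \<times> int"
  have Ncong: "N l x = N l y" if "[x = y] (mod int p)" for l x y
    using that by (simp add: N_def cong_def)
  have plus: "adj (N l x) (N l (x + width l))" if "l \<in> {0, 1}" for l x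
  proof -
    have "adj (l, x mod int p) (l, (x + r ^ nat l * 1) mod int p)"
      by (rule adj_shift) (use that q2 S_one in auto)
    then show ?thesis
      using that by (auto simp: N_def width_def)
  qed
  have spoke: "adj (N 0 x) (N 1 x)" for x
    using N_in_V[OF q2] q2 unfolding N_def adj_iff by auto
  have adj: "adj (h u) (h v)" if uv: "gp_adj (int p) r u v" for u v
  proof -
    obtain l x where u: "u = (l, x)" by (cases u)
    obtain l' y where v: "v = (l', y)" by (cases v)
    consider "l = l'" "[y = x + 1] (mod int p)" | "l = l'" "[y = x - 1] (mod int p)"
      | "l" "\<not> l'" "[y = r * x] (mod int p)" | "\<not> l" "l'" "[x = r * y] (mod int p)"
      using uv by (cases l; cases l') (auto simp: u v gp_adj_def)
    then show ?thesis
    proof cases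
      case 1
      have "[r * y = r * (x + 1)] (mod int p)"
        by (intro cong_mult 1(2) cong_refl)
      then show ?thesis
        using plus[of 0 x] plus[of 1 "r * x"] Ncong[OF 1(2), of 0] Ncong[of "r * y" "r * (x + 1)" 1] 1(1)
        by (simp add: h_def u v width_def algebra_simps)
    next
      case 2
      have "[r * y = r * (x - 1)] (mod int p)"
        by (intro cong_mult 2(2) cong_refl)
      then have "adj (h v) (h u)"
        using plus[of 0 "x - 1"] plus[of 1 "r * (x - 1)"] Ncong[OF 2(2), of 0] Ncong[of "r * y" "r * (x - 1)" 1] 2(1)
        by (simp add: h_def u v width_def algebra_simps)
      then show ?thesis
        using adj_sym by blast
    next
      case 3
      then have "adj (h v) (h u)"
        using spoke[of y] Ncong[OF 3(3), of 1] by (simp add: h_def u v)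
      then show ?thesis
        using adj_sym by blast
    next
      case 4
      then show ?thesis
        using spoke[of x] Ncong[OF 4(3), of 1] by (simp add: h_def u v)
    qed
  qed
  have "W \<noteq> []"
    using W(1) p_gt_1 by auto
  have "hamilton_cycle X (map h W)"
  proof (rule hamilton_cycleI)
    show "length (map h W) = p * q"
      using W(1) q2 by simp
    show "successively adj (map h W)"
      unfolding successively_map using W(2) by (rule successively_mono) (rule adj)
    show "adj (last (map h W)) (hd (map h W))"
      using adj[OF W(3)] \<open>W \<noteq> []\<close> by (simp add: last_map hd_map)
    show "V \<subseteq> set (map h W)"
    proof
      fix v assume "v \<in> V"
      then obtain l j where v: "l \<in> {0, 1}" "v = N l j"
        using V_N[OF q2] by blast
      show "v \<in> set (map h W)"
      proof (cases "l = 0")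
        case True
        obtain y where y: "(False, y) \<in> set W" "[j = y] (mod int p)"
          using W(4) by blast
        then have "v = h (False, y)"
          using Ncong[OF y(2), of 0] True v by (simp add: h_def)
        then show ?thesis
          using y(1) by simp
      next
        case False
        obtain z where z: "[r ^ 1 * z = 1] (mod int p)"
          using coprime_r cong_solve_coprime_int by blast
        obtain y where y: "(True, y) \<in> set W" "[z * j = y] (mod int p)"
          using W(4) by blast
        have "[r * y = r * (z * j)] (mod int p)"
          by (intro cong_mult cong_refl cong_sym[OF y(2)])
        also have "r * (z * j) = r ^ 1 * z * j"
          by simp
        also have "[r ^ 1 * z * j = 1 * j] (mod int p)"
          by (intro cong_mult z cong_refl)
        finally have "v = h (True, y)"
          using Ncong[of "r * y" j 1] False v by (simp add: h_def)
        then show ?thesis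
          using y(1) by simp
      qed
    qed
  qed
  then show ?thesis
    by blast
qed

definition run :: "nat \<Rightarrow> int \<Rightarrow> int \<Rightarrow> nat \<Rightarrow> (int \<times> int) list" where
  "run i s a m = map (\<lambda>t. (int i, (s + int t * a) mod int p)) [0..<m]"

lemma run_props:
  assumes "0 < m"
  shows "run i s a m \<noteq> []" "hd (run i s a m) = (int i, s mod int p)"
    "last (run i s a m) = (int i, (s + (int m - 1) * a) mod int p)" "length (run i s a m) = m"
  using assms by (simp_all add: run_def hd_map last_map hd_upt last_upt of_nat_diff)

lemma run_path:
  assumes "i < q" "connects (int i) a"
  shows "successively adj (run i s a m)"
proof -
  have "adj (int i, (s + int t * a) mod int p) (int i, (s + int (Suc t) * a) mod int p)" for t
  proof -
    have "[(s + int (Suc t) * a) mod int p - (s + int t * a) mod int p = (s + int (Suc t) * a) - (s + int t * a)] (mod int p)"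
      by (intro cong_diff) (simp_all add: cong_def)
    moreover have "(s + int (Suc t) * a) - (s + int t * a) = a"
      by (simp add: algebra_simps)
    ultimately have "[(s + int (Suc t) * a) mod int p - (s + int t * a) mod int p = a] (mod int p)"
      by simp
    then have "connects (int i) ((s + int (Suc t) * a) mod int p - (s + int t * a) mod int p)"
      using assms(2) by (subst connects_cong)
    then show ?thesis
      using assms(1) p_gt_1 by (simp add: adj_iff)
  qed
  then show ?thesis
    by (simp add: run_def successively_conv_nth)
qed

lemma run_mem:
  assumes "t < m" "[x = s + int t * a] (mod int p)" "x \<in> {0..<int p}"
  shows "(int i, x) \<in> set (run i s a m)"
proof -
  have "x = (s + int t * a) mod int p"
    using assms(2,3) by (simp add: cong_def)
  then show ?thesis
    using assms(1) by (auto simp: run_def)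
qed

lemma successively_map_upt:
  assumes "\<And>i. a \<le> i \<Longrightarrow> Suc i < b \<Longrightarrow> P (f i) (f (Suc i))"
  shows "successively P (map f [a..<b])"
  using assms by (simp add: successively_conv_nth)

text \<open>For odd \<open>q\<close> the cycle visits every layer twice. It leaves layer \<open>0\<close> at two neighbouring
  vertices; in every other layer two vertices \<open>x\<close> and \<open>x + 1\<close> are entered and, after the two paths
  with the step \<open>a\<close> that start there, the vertices \<open>x + 1 - a\<close> and \<open>x - a\<close> are left. The order of the
  two is reversed once per layer, and as \<open>q\<close> is odd the two rounds join up to a single cycle. The
  steps can be chosen with a sum that does not vanish, and this sum fixes the place where layer
  \<open>0\<close> is cut.\<close>

lemma hamilton_cycle_odd:
  assumes "odd q"
  shows "\<exists>C. hamilton_cycle X C"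
proof -
  have q3: "3 \<le> q"
    using assms q_gt_1 by presburger
  have two: "\<not> int p dvd 2 * r"
  proof -
    have "\<not> int p dvd 2"
      using q3 q_less_p zdvd_imp_le[of "int p" 2] by auto
    then show ?thesis
      using r_not_dvd[of 1] prime_int_p by (simp add: prime_dvd_mult_iff)
  qed
  obtain \<epsilon> :: int where \<epsilon>: "\<epsilon> \<in> {1, -1}" "\<not> int p dvd \<epsilon> * r + (\<Sum>k\<in>{2..<q}. r ^ k)"
  proof (rule ccontr)
    assume "\<not> thesis"
    then have "int p dvd 1 * r + (\<Sum>k\<in>{2..<q}. r ^ k)" "int p dvd (-1) * r + (\<Sum>k\<in>{2..<q}. r ^ k)"
      using that by blast+
    then have "int p dvd (1 * r + (\<Sum>k\<in>{2..<q}. r ^ k)) - ((-1) * r + (\<Sum>k\<in>{2..<q}. r ^ k))"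
      by (rule dvd_diff)
    then show False
      using two by simp
  qed
  define a where "a i = (if i = 1 then \<epsilon> * r else r ^ i)" for i :: nat
  define P where "P i = (\<Sum>k\<in>{i..<q}. a k)" for i
  have Pq: "P q = 0"
    by (simp add: P_def)
  have PSuc: "P i = a i + P (Suc i)" if "i < q" for i
    using that by (simp add: P_def sum.atLeast_Suc_lessThan)
  define y where "y = nat (P 1 mod int p)"
  have P1: "P 1 = \<epsilon> * r + (\<Sum>k\<in>{2..<q}. r ^ k)"
    using q3 by (subst PSuc) (auto simp: P_def a_def numeral_2_eq_2 intro!: sum.cong)
  have y: "0 < y" "y < p" "[P 1 = int y] (mod int p)"
  proof -
    have "P 1 mod int p \<noteq> 0"
      using \<epsilon>(2) P1 by (simp add: dvd_eq_mod_eq_0)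
    moreover have "0 \<le> P 1 mod int p" "P 1 mod int p < int p"
      using p_gt_1 by auto
    ultimately show "0 < y" "y < p" "[P 1 = int y] (mod int p)"
      by (auto simp: y_def cong_def)
  qed
  have con: "connects (int i) (a i)" if "0 < i" "i < q" for i
  proof (cases "i = 1")
    case True
    have "connects 1 r"
      using connects_power[OF S_one, of 1] by simp
    then show ?thesis
      using \<epsilon>(1) connects_uminus[of 1 r] True by (auto simp: a_def)
  next
    case False
    then show ?thesis
      using connects_power[OF S_one, of "int i"] by (simp add: a_def)
  qed
  have con0: "connects 0 1" "connects 0 (- 1)"
    using connects_power[OF S_one, of 0] connects_uminus[of 0 1] by simp_all
  have "\<exists>k. 0 < k \<and> k < p \<and> [a i * int k = 1] (mod int p)" if "0 < i" for i
  proof -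
    have "\<not> int p dvd a i"
      using \<epsilon>(1) r_not_dvd[of 1] r_not_dvd[of i] by (auto simp: a_def)
    then have "coprime (a i) (int p)"
      using prime_int_p prime_imp_coprime coprime_commute by blast
    then obtain z where z: "[a i * z = 1] (mod int p)"
      using cong_solve_coprime_int by blast
    define k where "k = nat (z mod int p)"
    have k: "int k = z mod int p"
      using p_gt_1 by (simp add: k_def)
    have "[a i * int k = a i * z] (mod int p)"
      unfolding k by (intro cong_mult cong_refl) (simp add: cong_def)
    then have 1: "[a i * int k = 1] (mod int p)"
      using z cong_trans by blast
    have "int k < int p"
      unfolding k using p_gt_1 by simp
    moreover have "k \<noteq> 0"
    proof
      assume "k = 0"
      then have "[0 = 1] (mod int p)"
        using 1 by simp
      then show False
        using p_gt_1 by (simp add: cong_def)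
    qed
    ultimately show ?thesis
      using 1 by auto
  qed
  then obtain k where k: "\<And>i. 0 < i \<Longrightarrow> 0 < k i \<and> k i < p \<and> [a i * int (k i) = 1] (mod int p)"
    by metis
  define f where "f i = (if odd i then run i (P i + 1) (a i) (p - k i) else run i (P i) (a i) (k i))" for i
  define g where "g i = (if odd i then run i (P i) (a i) (k i) else run i (P i + 1) (a i) (p - k i))" for i
  have pos: "0 < k i" "0 < p - k i" if "0 < i" for i
    using k[OF that] by auto
  have short_end: "[P i + (int (k i) - 1) * a i = P (Suc i) + 1] (mod int p)" if "0 < i" "i < q" for i
  proof -
    have "[P i + (int (k i) - 1) * a i = P i - a i + a i * int (k i)] (mod int p)"
      by (simp add: algebra_simps)
    also have "[P i - a i + a i * int (k i) = P i - a i + 1] (mod int p)"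
      using k[OF that(1)] by (intro cong_add cong_refl) blast
    also have "P i - a i + 1 = P (Suc i) + 1"
      using PSuc[OF that(2)] by simp
    finally show ?thesis .
  qed
  have long_end: "[P i + 1 + (int (p - k i) - 1) * a i = P (Suc i)] (mod int p)" if "0 < i" "i < q" for i
  proof -
    have "P i + 1 + (int (p - k i) - 1) * a i = (P i + 1 - a i - a i * int (k i)) + int p * a i"
      using pos(2)[OF that(1)] by (simp add: of_nat_diff algebra_simps)
    also have "[\<dots> = P i + 1 - a i - a i * int (k i)] (mod int p)"
      by (simp add: cong_def)
    also have "[P i + 1 - a i - a i * int (k i) = P i + 1 - a i - 1] (mod int p)"
      using k[OF that(1)] by (intro cong_diff cong_refl) blast
    also have "P i + 1 - a i - 1 = P (Suc i)"
      using PSuc[OF that(2)] by simp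
    finally show ?thesis .
  qed
  have f: "f i \<noteq> []" "hd (f i) = (int i, (if odd i then P i + 1 else P i) mod int p)"
      "last (f i) = (int i, (if odd i then P (Suc i) else P (Suc i) + 1) mod int p)" "successively adj (f i)"
    and g: "g i \<noteq> []" "hd (g i) = (int i, (if odd i then P i else P i + 1) mod int p)"
      "last (g i) = (int i, (if odd i then P (Suc i) + 1 else P (Suc i)) mod int p)" "successively adj (g i)"
    and fg: "length (f i) + length (g i) = p"
    if "0 < i" "i < q" for i
    using run_props[OF pos(1)[OF that(1)]] run_props[OF pos(2)[OF that(1)]] run_path[OF that(2) con[OF that]]
      short_end[OF that] long_end[OF that] pos[OF that(1)]
    by (simp_all add: f_def g_def cong_def)
  define A B where "A = run 0 0 (- 1) (p - y)" and "B = run 0 1 1 y"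
  have A: "A \<noteq> []" "hd A = (0, 0)" "last A = (0, (int y + 1) mod int p)" "successively adj A" "length A = p - y"
  proof -
    have "[0 + (int (p - y) - 1) * (- 1) = int y + 1] (mod int p)"
      using y by (simp add: of_nat_diff cong_iff_dvd_diff)
    then show "A \<noteq> []" "hd A = (0, 0)" "last A = (0, (int y + 1) mod int p)" "successively adj A" "length A = p - y"
      using run_props[of "p - y" 0 0 "- 1"] run_path[of 0 "- 1" 0 "p - y"] y(2) con0 q_gt_1
      by (simp_all add: A_def cong_def)
  qed
  have B: "B \<noteq> []" "hd B = (0, 1)" "last B = (0, int y mod int p)" "successively adj B" "length B = y"
    using run_props[of y 0 1 1] run_path[of 0 1 1 y] y con0 q_gt_1 p_gt_1 by (simp_all add: B_def)
  have link: "adj (int i, e mod int p) (int i', s mod int p)"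
    if "[e = s] (mod int p)" "i < q" "i' < q" "(i + 1) mod q = i'" for i i' e s
  proof -
    have "(int i + 1) mod int q = int i'"
      using that(4) by (metis of_nat_1 of_nat_add of_nat_mod)
    then show ?thesis
      using that(1-3) p_gt_1 by (simp add: adj_iff cong_def)
  qed
  define xss where "xss = A # map f [1..<q] @ B # map g [1..<q]"
  have qe: "even (q - 1)" "Suc (q - 1) = q" "0 < q - 1" "q - 1 < q"
    using assms q3 by auto
  have upt: "[1..<q] \<noteq> []" "hd [1..<q] = 1" "last [1..<q] = q - 1"
    using q3 by (auto simp: hd_upt last_upt)
  have "[int y + 1 = P 1 + 1] (mod int p)"
    by (intro cong_add cong_refl cong_sym[OF y(3)])
  then have Af: "adj (last A) (hd (f 1))"
    using link[of "int y + 1" "P 1 + 1" 0 1] A(3) f(2)[of 1] q3 by simp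
  have fB: "adj (last (f (q - 1))) (hd B)"
    using link[of 1 1 "q - 1" 0] f(3)[OF qe(3,4)] qe Pq B(2) p_gt_1 by simp
  have Bg: "adj (last B) (hd (g 1))"
    using link[of "int y" "P 1" 0 1] B(3) g(2)[of 1] q3 cong_sym[OF y(3)] by simp
  have gA: "adj (last (g (q - 1))) (hd A)"
    using link[of 0 0 "q - 1" 0] g(3)[OF qe(3,4)] qe Pq A(2) p_gt_1 by simp
  have ff: "adj (last (f i)) (hd (f (Suc i)))" "adj (last (g i)) (hd (g (Suc i)))" if "1 \<le> i" "Suc i < q" for i
    using link[of "P (Suc i)" "P (Suc i)" i "Suc i"] link[of "P (Suc i) + 1" "P (Suc i) + 1" i "Suc i"]
      f(3)[of i] f(2)[of "Suc i"] g(3)[of i] g(2)[of "Suc i"] that by simp_all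
  have "hamilton_cycle X (concat xss)"
  proof (rule hamilton_cycleI)
    have "length (concat xss) = p + (\<Sum>i\<leftarrow>[1..<q]. length (f i) + length (g i))"
      using A(5) B(5) y(2) by (simp add: xss_def length_concat comp_def sum_list_addf)
    also have "(\<Sum>i\<leftarrow>[1..<q]. length (f i) + length (g i)) = (\<Sum>i\<leftarrow>[1..<q]. p)"
      using fg by (intro arg_cong[of _ _ sum_list] map_cong) auto
    also have "p + (\<Sum>i\<leftarrow>[1..<q]. p) = p * q"
      using q3 by (simp add: sum_list_triv mult.commute algebra_simps)
    finally show "length (concat xss) = p * q" .
    show "successively adj (concat xss)"
    proof (rule successively_concat)
      show "xs \<noteq> [] \<and> successively adj xs" if "xs \<in> set xss" for xs
        using that A B f g by (auto simp: xss_def)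
      have "successively (\<lambda>xs ys. adj (last xs) (hd ys)) (map f [1..<q])"
        "successively (\<lambda>xs ys. adj (last xs) (hd ys)) (map g [1..<q])"
        using ff by (auto intro!: successively_map_upt)
      then show "successively (\<lambda>xs ys. adj (last xs) (hd ys)) xss"
        using Af fB Bg upt by (simp add: xss_def successively_Cons successively_append_iff hd_append hd_map last_map)
    qed
    show "adj (last (concat xss)) (hd (concat xss))"
    proof -
      have "last xss = g (q - 1)" "hd xss = A" "xss \<noteq> []"
        using upt by (simp_all add: xss_def last_map)
      then show ?thesis
        using gA A(1) g(1)[OF qe(3,4)] by (simp add: last_concat_nonempty hd_concat_nonempty)
    qed
    show "V \<subseteq> set (concat xss)"
    proof
      fix v assume v: "v \<in> V"
      obtain l x where vx: "v = (l, x)" by (cases v)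
      define i where "i = nat l"
      have x: "x \<in> {0..<int p}" and i: "l = int i" "i < q"
        using v vx by (auto simp: i_def)
      show "v \<in> set (concat xss)"
      proof (cases "i = 0")
        case True
        have "v \<in> set A \<or> v \<in> set B"
        proof (cases "0 < x \<and> x \<le> int y")
          case inB: True
          have "(int 0, x) \<in> set B"
            unfolding B_def by (rule run_mem[of "nat (x - 1)"]) (use inB x in auto)
          then show ?thesis
            using vx i True by simp
        next
          case False
          have "(int 0, x) \<in> set A"
            unfolding A_def by (rule run_mem[of "nat ((- x) mod int p)"])
              (use False x y p_gt_1 in \<open>auto simp: zmod_zminus1_eq_if cong_iff_dvd_diff nat_less_iff of_nat_diff\<close>)
          then show ?thesis
            using vx i True by simp
        qed
        then show ?thesis
          by (auto simp: xss_def)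
      next
        case False
        then have i0: "0 < i" by simp
        define t where "t = nat (((x - P i) * int (k i)) mod int p)"
        have t: "t < p" "[int t = (x - P i) * int (k i)] (mod int p)"
          using p_gt_1 by (auto simp: t_def cong_def nat_less_iff)
        have "[P i + int t * a i = P i + (x - P i) * int (k i) * a i] (mod int p)"
          by (intro cong_add cong_mult cong_refl t(2))
        also have "P i + (x - P i) * int (k i) * a i = P i + (x - P i) * (a i * int (k i))"
          by simp
        also have "[P i + (x - P i) * (a i * int (k i)) = P i + (x - P i) * 1] (mod int p)"
          using k[OF i0] by (intro cong_add cong_mult cong_refl) blast
        finally have xt: "[x = P i + int t * a i] (mod int p)"
          by (simp add: cong_sym)
        have "v \<in> set (f i) \<or> v \<in> set (g i)"
        proof (cases "t < k i")
          case True
          have "(int i, x) \<in> set (run i (P i) (a i) (k i))"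
            using run_mem[OF True xt x] .
          then show ?thesis
            using vx i by (auto simp: f_def g_def)
        next
          case False
          have "P i + int t * a i = P i + a i * int (k i) + int (t - k i) * a i"
            using False by (simp add: of_nat_diff algebra_simps)
          also have "[\<dots> = P i + 1 + int (t - k i) * a i] (mod int p)"
            using k[OF i0] by (intro cong_add cong_refl) blast
          finally have "[x = P i + 1 + int (t - k i) * a i] (mod int p)"
            using xt cong_trans by blast
          then have "(int i, x) \<in> set (run i (P i + 1) (a i) (p - k i))"
            by (intro run_mem[of "t - k i"] x) (use False t in auto)
          then show ?thesis
            using vx i by (auto simp: f_def g_def)
        qed
        then show ?thesis
          using i0 i(2) by (auto simp: xss_def)
      qed
    qed
  qed
  then show ?thesis
    by blast
qed

end

section \<open>The two families\<close>

lemma hamilton_compression_eq_1: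
  assumes ham: "hamilton_cycle X C0"
    and sym: "\<And>C k. hamilton_cycle X C \<Longrightarrow> k_symmetric X C k \<Longrightarrow> 2 \<le> k \<Longrightarrow> False"
  shows "hamilton_compression X = 1"
proof -
  have "compression_factor X C = 1" if C: "hamilton_cycle X C" for C
  proof -
    have "graph_automorphism X (\<lambda>v. v)"
      using bij_betw_id[unfolded id_def] by (simp add: graph_automorphism_def)
    then have "k_symmetric X C 1"
      unfolding k_symmetric_def by (intro conjI exI[of _ "\<lambda>v. v"]) auto
    moreover have "k = 1" if k: "k_symmetric X C k" for k
    proof -
      have "k dvd length C" "0 < length C"
        using k C by (auto simp: k_symmetric_def hamilton_cycle_def)
      then have "k \<noteq> 0"
        by (auto intro!: Nat.gr0I)
      moreover have "\<not> 2 \<le> k"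
        using sym[OF C k] by blast
      ultimately show ?thesis
        by linarith
    qed
    ultimately have "{k. k_symmetric X C k} = {1}"
      by blast
    then show ?thesis
      by (simp add: compression_factor_def)
  qed
  then have "{compression_factor X C | C. hamilton_cycle X C} = {1}"
    using ham by (auto intro!: exI[of _ C0])
  then show ?thesis
    using ham by (auto simp: hamilton_compression_def)
qed

locale root_of_unity =
  fixes p q t N :: nat and r :: int
  assumes p_prime: "prime p" and q_prime: "prime q"
    and p_eq: "p = 1 + N * q ^ t" and t2: "2 \<le> t" and coprime_N: "coprime N q"
    and r_carrier: "r \<in> carrier (Zstar p)" and r_ord: "group.ord (Zstar p) r = q ^ t"
begin

lemma p_gt_1: "1 < p"
  using p_prime prime_gt_1_nat by blast

lemma q_gt_1: "1 < q"
  using q_prime prime_gt_1_nat by blast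

lemma prime_int_p: "prime (int p)"
  using p_prime by simp

lemma unit_iff: "x \<in> carrier (Zstar p) \<longleftrightarrow> 0 < x \<and> x < int p"
proof -
  interpret residues_prime p "Zmod p"
    by unfold_locales (use p_prime in auto)
  show ?thesis
    by (auto simp: units_of_carrier res_prime_units_eq)
qed

lemma r_bounds: "0 < r" "r < int p"
  using r_carrier by (simp_all add: unit_iff)

lemma Zstar_group: "group (Zstar p)"
proof -
  interpret residues_prime p "Zmod p"
    by unfold_locales (use p_prime in auto)
  show ?thesis
    by (rule units_group)
qed

lemma Zmod_pow:
  assumes "0 \<le> x" "x < int p"
  shows "x [^]\<^bsub>Zmod p\<^esub> (n::nat) = x ^ n mod int p"
proof -
  interpret residues_prime p "Zmod p"
    by unfold_locales (use p_prime in auto)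
  show ?thesis
    using pow_cong[of x n] assms by simp
qed

lemma Zstar_pow:
  assumes "x \<in> carrier (Zstar p)"
  shows "x [^]\<^bsub>Zstar p\<^esub> (n::nat) = x ^ n mod int p"
proof -
  interpret residues_prime p "Zmod p"
    by unfold_locales (use p_prime in auto)
  have "x [^]\<^bsub>Zstar p\<^esub> n = x [^]\<^bsub>Zmod p\<^esub> n"
    by (simp add: nat_pow_def units_of_def)
  then show ?thesis
    using Zmod_pow[of x n] assms by (simp add: unit_iff)
qed

text \<open>From here on the group-theoretic hypotheses on \<open>r\<close> enter only through this congruence.\<close>

lemma r_power_eq_1_iff: "[r ^ n = 1] (mod int p) \<longleftrightarrow> q ^ t dvd n"
proof -
  interpret group "Zstar p"
    by (rule Zstar_group)
  interpret P: residues_prime p "Zmod p"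
    by unfold_locales (use p_prime in auto)
  have one: "\<one>\<^bsub>Zstar p\<^esub> = 1"
    by (simp add: units_of_def P.res_one_eq)
  have "r [^]\<^bsub>Zstar p\<^esub> n = \<one>\<^bsub>Zstar p\<^esub> \<longleftrightarrow> q ^ t dvd n"
    using pow_eq_id[OF r_carrier, of n] r_ord by simp
  then show ?thesis
    unfolding one Zstar_pow[OF r_carrier] using p_gt_1 by (simp add: cong_def)
qed

lemma N_pos: "0 < N"
  using p_eq p_gt_1 by (cases N) auto

lemma q_square_le: "q * q \<le> q ^ t"
  using power_increasing[OF t2, of q] q_gt_1 by (simp add: power2_eq_square)

lemma q_less_p: "q < p"
proof -
  have "q * 1 \<le> q * q"
    using q_gt_1 by (intro mult_le_mono) auto
  also have "q * q \<le> N * q ^ t"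
    using mult_le_mono[of 1 N "q * q" "q ^ t"] N_pos q_square_le by simp
  finally show ?thesis
    using p_eq by simp
qed

lemma r_power_not_dvd: "\<not> int p dvd r ^ n"
proof
  assume "int p dvd r ^ n"
  then have "int p dvd r"
    using prime_int_p prime_dvd_power by blast
  then show False
    using r_bounds zdvd_imp_le by fastforce
qed

text \<open>The connection set in terms of congruences; \<open>e = q\<close> gives the first family and \<open>e\<close> equal to \<open>q\<close> to
  the power \<open>t - 1\<close> the second.\<close>

definition S :: "nat \<Rightarrow> int set" where
  "S e = {x. \<exists>i. x = r ^ (e * i) mod int p \<or> x = (- (r ^ (e * i))) mod int p}"

lemma pm_generate_r: "pm_generate p (r [^]\<^bsub>Zmod p\<^esub> e) = S e"
proof -
  interpret group "Zstar p"
    by (rule Zstar_group)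
  interpret P: residues_prime p "Zmod p"
    by unfold_locales (use p_prime in auto)
  define a where "a = r ^ e mod int p"
  have ra: "r [^]\<^bsub>Zmod p\<^esub> e = a"
    using Zmod_pow[of r e] r_bounds by (simp add: a_def)
  have a: "a \<in> carrier (Zstar p)"
  proof -
    have "a \<noteq> 0"
      using r_power_not_dvd by (simp add: a_def dvd_eq_mod_eq_0)
    then show ?thesis
      using p_gt_1 pos_mod_sign[of "int p" "r ^ e"] pos_mod_bound[of "int p" "r ^ e"]
      by (auto simp: unit_iff a_def order_less_le simp del: pos_mod_sign pos_mod_bound)
  qed
  have "finite (carrier (Zstar p))"
    by (simp add: units_of_carrier)
  then have "generate (Zstar p) {a} = {a [^]\<^bsub>Zstar p\<^esub> k | k. k \<in> (UNIV :: nat set)}"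
    using generate_pow_on_finite_carrier a by blast
  also have "\<dots> = range (\<lambda>i. r ^ (e * i) mod int p)"
    unfolding Zstar_pow[OF a] by (auto simp: a_def power_mod power_mult)
  finally have gen: "generate (Zstar p) {a} = range (\<lambda>i. r ^ (e * i) mod int p)" .
  have neg: "a_inv (Zmod p) ` range (\<lambda>i. r ^ (e * i) mod int p) = range (\<lambda>i. (- (r ^ (e * i))) mod int p)"
    by (simp add: P.res_neg_eq image_image mod_minus_eq)
  show ?thesis
    unfolding pm_generate_def ra gen neg by (auto simp: S_def)
qed

lemma S_cong:
  assumes "s \<in> S e"
  obtains \<epsilon> i where "\<epsilon> \<in> {1, -1}" "[s = \<epsilon> * r ^ (e * i)] (mod int p)"
proof -
  obtain i where "s = (1 * r ^ (e * i)) mod int p \<or> s = ((-1) * r ^ (e * i)) mod int p"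
    using assms by (auto simp: S_def)
  then show thesis
    using that[of 1 i] that[of "-1" i] by (auto simp: cong_def)
qed

lemma S_memI: "\<epsilon> \<in> {1, -1} \<Longrightarrow> (\<epsilon> * r ^ (e * i)) mod int p \<in> S e"
  by (auto simp: S_def)

text \<open>The key point is the last assumption of the locale: if \<open>(r\<^sup>c s)\<^sup>q = 1\<close> with \<open>s = \<plusminus> r\<close> to the power
  \<open>e i\<close>, then the order of \<open>r\<close>, and with it \<open>q\<^sup>2\<close>, divides \<open>2 q (c + e i)\<close>. For odd \<open>q\<close> this makes
  \<open>q\<close> a divisor of \<open>c\<close>. For \<open>q = 2\<close> the sign disappears in the square, and so does the factor 2.\<close>

lemma layered_S:
  assumes e: "q dvd e"
  shows "layered p (S e) q r"
proof unfold_locales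
  show "S e \<subseteq> {1..<int p}"
  proof
    fix s assume "s \<in> S e"
    then obtain i where i: "s = r ^ (e * i) mod int p \<or> s = (- (r ^ (e * i))) mod int p"
      by (auto simp: S_def)
    then have "s \<noteq> 0"
      using r_power_not_dvd[of "e * i"] dvd_minus_iff[of "int p" "r ^ (e * i)"] by (auto simp: dvd_eq_mod_eq_0 simp del: dvd_minus_iff)
    moreover have "0 \<le> s" "s < int p"
      using i p_gt_1 by auto
    ultimately show "s \<in> {1..<int p}"
      by simp
  qed
  show "1 \<in> S e"
    using S_memI[of 1 e 0] p_gt_1 by simp
  show "(x * y) mod int p \<in> S e" if xy: "x \<in> S e" "y \<in> S e" for x y
  proof -
    obtain \<epsilon> i where x: "\<epsilon> \<in> {1, -1}" "[x = \<epsilon> * r ^ (e * i)] (mod int p)"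
      using S_cong[OF xy(1)] .
    obtain \<epsilon>' i' where y: "\<epsilon>' \<in> {1, -1}" "[y = \<epsilon>' * r ^ (e * i')] (mod int p)"
      using S_cong[OF xy(2)] .
    have "[x * y = (\<epsilon> * r ^ (e * i)) * (\<epsilon>' * r ^ (e * i'))] (mod int p)"
      by (intro cong_mult x y)
    also have "(\<epsilon> * r ^ (e * i)) * (\<epsilon>' * r ^ (e * i')) = (\<epsilon> * \<epsilon>') * r ^ (e * (i + i'))"
      by (simp add: power_add algebra_simps)
    finally have "(x * y) mod int p = ((\<epsilon> * \<epsilon>') * r ^ (e * (i + i'))) mod int p"
      by (simp add: cong_def)
    moreover have "\<epsilon> * \<epsilon>' \<in> {1, -1}"
      using x(1) y(1) by auto
    ultimately show ?thesis
      using S_memI by simp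
  qed
  show "r \<in> {1..<int p}"
    using r_bounds by simp
  show "(- x) mod int p \<in> S e" if xS: "x \<in> S e" for x
  proof -
    obtain \<epsilon> i where x: "\<epsilon> \<in> {1, -1}" "[x = \<epsilon> * r ^ (e * i)] (mod int p)"
      using S_cong[OF xS] .
    have "(- x) mod int p = (- \<epsilon> * r ^ (e * i)) mod int p"
      using x(2) cong_minus_minus_iff[of x "\<epsilon> * r ^ (e * i)" "int p"] by (simp add: cong_def)
    then show ?thesis
      using S_memI[of "- \<epsilon>" e i] x(1) by auto
  qed
  show "\<not> [(r ^ c * s) ^ q = 1] (mod int p)" if c: "0 < c" "c < q" and s: "s \<in> S e" for c s
  proof
    assume 1: "[(r ^ c * s) ^ q = 1] (mod int p)"
    obtain \<epsilon> i where \<epsilon>: "\<epsilon> \<in> {1, -1}" "[s = \<epsilon> * r ^ (e * i)] (mod int p)"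
      using S_cong[OF s] .
    have "[(r ^ c * s) ^ q = (r ^ c * (\<epsilon> * r ^ (e * i))) ^ q] (mod int p)"
      by (intro cong_pow cong_mult cong_refl \<epsilon>(2))
    then have 2: "[(r ^ c * (\<epsilon> * r ^ (e * i))) ^ q = 1] (mod int p)"
      using 1 cong_sym cong_trans by blast
    have eq: "(r ^ c * (\<epsilon> * r ^ (e * i))) ^ q = \<epsilon> ^ q * r ^ (q * (c + e * i))"
      by (simp add: power_add power_mult_distrib power_mult[symmetric] algebra_simps)
    have 3: "\<not> q dvd c + e * i"
      using c e nat_dvd_not_less by (auto simp: dvd_add_left_iff)
    show False
    proof (cases "q = 2")
      case True
      then have "\<epsilon> ^ q = 1"
        using \<epsilon>(1) by auto
      then have "q ^ t dvd q * (c + e * i)"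
        using 2 eq r_power_eq_1_iff by simp
      then have "q * q dvd q * (c + e * i)"
        using le_imp_power_dvd[OF t2, of q] dvd_trans by (metis power2_eq_square)
      then show False
        using 3 q_gt_1 by simp
    next
      case False
      have "[(\<epsilon> ^ q * r ^ (q * (c + e * i))) ^ 2 = 1 ^ 2] (mod int p)"
        using 2 unfolding eq by (rule cong_pow)
      moreover have "(\<epsilon> ^ q * r ^ (q * (c + e * i))) ^ 2 = r ^ (q * (2 * (c + e * i)))"
        using \<epsilon>(1) by (auto simp: power_mult_distrib power_mult[symmetric] algebra_simps)
      ultimately have "q ^ t dvd q * (2 * (c + e * i))"
        using r_power_eq_1_iff by simp
      then have "q * q dvd q * (2 * (c + e * i))"
        using le_imp_power_dvd[OF t2, of q] dvd_trans by (metis power2_eq_square)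
      then have "q dvd 2 * (c + e * i)"
        using q_gt_1 by simp
      then have "q dvd 2"
        using 3 q_prime prime_dvd_mult_iff by blast
      then show False
        using False q_gt_1 by (auto dest: dvd_imp_le)
    qed
  qed
qed (use p_prime q_prime q_less_p in auto)

lemma two_if_small:
  assumes e: "e dvd q ^ (t - 1)" and S2: "S e = {1, (- 1) mod int p}"
  shows "q = 2"
proof -
  obtain i where i: "q ^ (t - 1) = e * i"
    using e by blast
  have "(1 * r ^ (e * i)) mod int p \<in> S e"
    by (rule S_memI) simp
  then have "r ^ (e * i) mod int p = 1 mod int p \<or> r ^ (e * i) mod int p = (-1) mod int p"
    using S2 p_gt_1 by auto
  then have "[r ^ (e * i) = 1] (mod int p) \<or> [r ^ (e * i) = -1] (mod int p)"
    by (simp only: cong_def)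
  then have "[(r ^ (e * i)) ^ 2 = 1] (mod int p)"
    using cong_pow[of "r ^ (e * i)" 1 "int p" 2] cong_pow[of "r ^ (e * i)" "-1" "int p" 2] by auto
  then have "[r ^ (q ^ (t - 1) * 2) = 1] (mod int p)"
    by (simp only: i power_mult)
  then have "q ^ t dvd q ^ (t - 1) * 2"
    using r_power_eq_1_iff by blast
  moreover have "q ^ t = q ^ (t - 1) * q"
    using t2 by (simp add: power_eq_if mult.commute)
  ultimately have "q dvd 2"
    using q_gt_1 by simp
  then show ?thesis
    using q_gt_1 by (auto dest: dvd_imp_le)
qed

subsection \<open>The case of two layers\<close>

text \<open>The exponent \<open>(p - 1) / 2\<close> is \<open>N\<close> times the power \<open>t - 1\<close> of 2 with \<open>N\<close> odd, so it is no multiple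
  of the order of \<open>r\<close>.\<close>

lemma not_square:
  assumes q2: "q = 2"
  shows "\<not> [r = w ^ 2] (mod int p)"
proof
  assume w: "[r = w ^ 2] (mod int p)"
  have half: "p - 1 = 2 * (N * 2 ^ (t - 1))"
    using p_eq q2 t2 by (simp add: power_eq_if)
  have "\<not> int p dvd w"
  proof
    assume "int p dvd w"
    then have "int p dvd w ^ 2"
      by (simp add: power2_eq_square)
    then have "int p dvd r ^ 1"
      using cong_dvd_iff[OF w] by simp
    then show False
      using r_power_not_dvd by blast
  qed
  then have "[w ^ (p - 1) = 1] (mod int p)"
    by (rule fermat_int[OF p_prime])
  moreover have "[r ^ (N * 2 ^ (t - 1)) = (w ^ 2) ^ (N * 2 ^ (t - 1))] (mod int p)"
    by (intro cong_pow w)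
  ultimately have "[r ^ (N * 2 ^ (t - 1)) = 1] (mod int p)"
    unfolding half power_mult[symmetric] using cong_trans by blast
  then have "2 ^ t dvd N * 2 ^ (t - 1)"
    using r_power_eq_1_iff q2 by blast
  moreover have "2 ^ t = 2 ^ (t - 1) * (2::nat)"
    using t2 by (simp add: power_eq_if mult.commute)
  ultimately have "2 ^ (t - 1) * 2 dvd 2 ^ (t - 1) * N"
    by (simp only: mult.commute)
  then have "2 dvd N"
    by simp
  then show False
    using coprime_N q2 by (simp add: coprime_commute)
qed

lemma p_large:
  assumes "q = 2" "p \<noteq> 5"
  shows "11 < p"
proof -
  have "4 dvd N * 2 ^ t"
    using le_imp_power_dvd[OF t2, of "2::nat"] by (simp add: dvd_mult)
  then obtain m where m: "p = 1 + 4 * m"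
    using p_eq assms(1) by (auto simp: dvd_def)
  have "p \<noteq> 9"
    using p_prime prime_product[of 3 3] by auto
  then have "m \<noteq> 0" "m \<noteq> 1" "m \<noteq> 2"
    using m assms(2) p_gt_1 by auto
  then show ?thesis
    using m by linarith
qed

lemma r_square_if_t_2:
  assumes "q = 2" "t = 2"
  shows "[r ^ 2 = - 1] (mod int p)"
proof -
  have "[r ^ 4 = 1] (mod int p)" "\<not> [r ^ 2 = 1] (mod int p)"
    using r_power_eq_1_iff[of 4] r_power_eq_1_iff[of 2] assms by simp_all
  moreover have "r ^ 4 - 1 = (r ^ 2 - 1) * (r ^ 2 + 1)"
    by (simp add: algebra_simps power_add[symmetric] flip: power_add)
  ultimately show ?thesis
    using prime_int_p by (auto simp: cong_iff_dvd_diff prime_dvd_mult_iff)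
qed

lemma ratios:
  assumes q2: "q = 2" and p5: "p \<noteq> 5" and \<epsilon>: "\<epsilon> \<in> {1, -1}"
  shows "\<not> int p dvd r + \<epsilon> \<and> \<not> int p dvd r + 2 * \<epsilon> \<and> \<not> int p dvd 2 * r + \<epsilon>"
proof -
  have ee: "\<epsilon> ^ 2 = 1"
    using \<epsilon> by auto
  have 1: "\<not> int p dvd r + \<epsilon>"
  proof
    assume "int p dvd r + \<epsilon>"
    then have "[r = - \<epsilon>] (mod int p)"
      by (simp add: cong_iff_dvd_diff)
    then have "[r ^ 2 = (- \<epsilon>) ^ 2] (mod int p)"
      by (rule cong_pow)
    then have "2 ^ t dvd (2::nat)"
      using r_power_eq_1_iff[of 2] q2 ee by simp
    then have "(2::nat) ^ t \<le> 2 ^ 1"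
      by (auto dest: dvd_imp_le)
    then show False
      using t2 by (subst (asm) power_increasing_iff) auto
  qed
  have "\<not> int p dvd r + 2 * \<epsilon> \<and> \<not> int p dvd 2 * r + \<epsilon>"
  proof (cases "t = 2")
    case True
    have r2: "int p dvd r ^ 2 + 1"
      using r_square_if_t_2[OF q2 True] by (simp add: cong_iff_dvd_diff)
    have "\<not> p dvd 5"
      using p5 p_prime primes_dvd_imp_eq[of p 5] by auto
    then have 5: "\<not> int p dvd 5"
      using int_dvd_int_iff[of p 5] by simp
    have "(r ^ 2 + 1) - (r + 2 * \<epsilon>) * (r - 2 * \<epsilon>) = 5"
      using \<epsilon> by (auto simp: algebra_simps power2_eq_square)
    moreover have "4 * (r ^ 2 + 1) - (2 * r + \<epsilon>) * (2 * r - \<epsilon>) = 5"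
      using \<epsilon> by (auto simp: algebra_simps power2_eq_square)
    ultimately show ?thesis
      using 5 r2 dvd_diff dvd_mult dvd_mult2 by metis
  next
    case False
    then have t3: "3 \<le> t"
      using t2 by simp
    \<comment> \<open>Now \<open>p\<close> is 1 modulo 8, and \<open>z\<close> has order 8. So \<open>2\<close> and \<open>-1\<close> are squares, while \<open>r\<close> is not.\<close>
    define z where "z = r ^ (2 ^ (t - 3))"
    have pw: "z ^ n = r ^ (2 ^ (t - 3) * n)" for n
      by (simp add: z_def power_mult)
    have t8: "(2::nat) ^ t = 2 ^ (t - 3) * 8"
      using t3 power_add[of "2::nat" "t - 3" 3] by simp
    have "[z ^ 8 = 1] (mod int p)" "\<not> [z ^ 4 = 1] (mod int p)"
      unfolding pw r_power_eq_1_iff q2 t8 by simp_all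
    moreover have "z ^ 8 - 1 = (z ^ 4 - 1) * (z ^ 4 + 1)"
      by (simp add: algebra_simps flip: power_add)
    ultimately have z4: "int p dvd z ^ 4 + 1"
      using prime_int_p by (auto simp: cong_iff_dvd_diff prime_dvd_mult_iff)
    define w where "w = z + z ^ 7"
    have "w ^ 2 - 2 = (z ^ 4 + 1) * (z ^ 10 - z ^ 6 + 2 * z ^ 4 + z ^ 2 - 2)"
      by (simp add: w_def power2_eq_square algebra_simps flip: power_add power_Suc power_Suc2)
    then have w: "[w ^ 2 = 2] (mod int p)"
      using z4 by (simp add: cong_iff_dvd_diff)
    have m1: "[(z ^ 2) ^ 2 = - 1] (mod int p)"
      using z4 by (simp add: cong_iff_dvd_diff flip: power_mult)
    have no: "\<not> [r = - \<epsilon> * x ^ 2] (mod int p)" for x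
    proof
      assume x: "[r = - \<epsilon> * x ^ 2] (mod int p)"
      show False
      proof (cases "\<epsilon> = -1")
        case True
        then show ?thesis
          using x not_square[OF q2, of x] by simp
      next
        case False
        then have "[r = (- 1) * x ^ 2] (mod int p)"
          using x \<epsilon> by simp
        also have "[(- 1) * x ^ 2 = (z ^ 2) ^ 2 * x ^ 2] (mod int p)"
          using cong_sym[OF m1] by (intro cong_mult cong_refl)
        finally show ?thesis
          using not_square[OF q2, of "z ^ 2 * x"] by (simp add: power_mult_distrib)
      qed
    qed
    have "\<not> int p dvd r + 2 * \<epsilon>"
    proof
      assume "int p dvd r + 2 * \<epsilon>"
      then have "[r = - \<epsilon> * 2] (mod int p)"
        by (simp add: cong_iff_dvd_diff mult.commute)
      also have "[- \<epsilon> * 2 = - \<epsilon> * w ^ 2] (mod int p)"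
        using cong_sym[OF w] by (intro cong_mult cong_refl)
      finally show False
        using no by blast
    qed
    moreover have "\<not> int p dvd 2 * r + \<epsilon>"
    proof
      assume d: "int p dvd 2 * r + \<epsilon>"
      have "r - - \<epsilon> * 2 * r ^ 2 = \<epsilon> * r * (2 * r + \<epsilon>)"
        using \<epsilon> by (auto simp: algebra_simps power2_eq_square)
      then have "[r = - \<epsilon> * 2 * r ^ 2] (mod int p)"
        using d by (simp add: cong_iff_dvd_diff)
      also have "[- \<epsilon> * 2 * r ^ 2 = - \<epsilon> * w ^ 2 * r ^ 2] (mod int p)"
        using cong_sym[OF w] by (intro cong_mult cong_refl)
      finally show False
        using no[of "w * r"] by (simp add: power_mult_distrib mult.assoc)
    qed
    ultimately show ?thesis
      by blast
  qed
  then show ?thesis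
    using 1 by blast
qed

lemma r_if_p_13:
  assumes q2: "q = 2" and p: "p = 13"
  shows "r = 5 \<or> r = 8"
proof -
  have "t = 2"
  proof (rule ccontr)
    assume "t \<noteq> 2"
    then have "(2::nat) ^ 3 dvd 2 ^ t"
      using t2 by (intro le_imp_power_dvd) simp
    then have "(2::nat) ^ 3 dvd N * 2 ^ t"
      by (rule dvd_mult)
    then show False
      using p_eq p q2 by simp
  qed
  then have "13 dvd r ^ 2 + 1"
    using r_square_if_t_2[OF q2] p by (simp add: cong_iff_dvd_diff)
  moreover have "r = 1 \<or> r = 2 \<or> r = 3 \<or> r = 4 \<or> r = 5 \<or> r = 6 \<or> r = 7 \<or> r = 8 \<or> r = 9 \<or> r = 10 \<or> r = 11 \<or> r = 12"
    using r_bounds p by simp presburger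
  ultimately show ?thesis
    by auto
qed

lemma hamilton_compression_S:
  assumes not_Petersen: "\<not> (q = 2 \<and> p = 5)" and e: "q dvd e" "e dvd q ^ (t - 1)"
  shows "hamilton_compression (layered_graph q p r (S e)) = 1"
proof -
  interpret L: layered p "S e" q r
    by (rule layered_S[OF e(1)])
  have rigid: "L.rigid \<alpha>" if aut: "graph_automorphism L.X \<alpha>" for \<alpha>
  proof (cases "2 < card (S e)")
    case True
    then show ?thesis
      using L.rigid_if_card_S_gt_2 aut by blast
  next
    case False
    have "(- 1) mod int p \<noteq> 1"
      using q_less_p q_gt_1 by (simp add: zmod_minus1)
    then have "card {1, (- 1) mod int p} = 2"
      by simp
    moreover have "{1, (- 1) mod int p} \<subseteq> S e"
      using L.S_one L.S_neg by blast
    ultimately have S2: "S e = {1, (- 1) mod int p}"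
      using False card_seteq[OF L.finite_S, of "{1, (- 1) mod int p}"] by simp
    have q2: "q = 2"
      using two_if_small[OF e(2) S2] .
    then have p5: "p \<noteq> 5"
      using not_Petersen by simp
    show ?thesis
      using L.rigid_if_generalised_Petersen[OF q2 S2 p_large[OF q2 p5] ratios[OF q2 p5] r_if_p_13[OF q2] aut] .
  qed
  have "\<exists>C. hamilton_cycle L.X C"
  proof (cases "q = 2")
    case True
    then have p5: "p \<noteq> 5"
      using not_Petersen by simp
    have "gp_hamiltonian (int p) r"
      using gp_hamiltonian_prime[OF prime_int_p _ _ ratios[OF True p5]] p_large[OF True p5] r_power_not_dvd[of 1]
      by simp
    then show ?thesis
      using L.hamilton_cycle_generalised_Petersen[OF True] by blast
  next
    case False
    then have "odd q"
      using q_prime prime_odd_nat[of q] q_gt_1 by auto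
    then show ?thesis
      by (rule L.hamilton_cycle_odd)
  qed
  then obtain C where "hamilton_cycle L.X C"
    by blast
  then show ?thesis
    by (rule hamilton_compression_eq_1) (use L.no_symmetric_hamilton_cycle[OF rigid] in blast)
qed

end

theorem theorem3p1:
  fixes p q t N :: nat and r :: int
  assumes "prime p" and "prime q"
    and "[p = 1] (mod q\<^sup>2)"
    and "p = 1 + N * q ^ t" and "t \<ge> 2" and "coprime N q"
    and "r \<in> carrier (Zstar p)" and "group.ord (Zstar p) r = q ^ t"
    and not_Petersen: "\<not> (q = 2 \<and> p = 5)"
  shows "hamilton_compression (Y_graph q p r) = 1 \<and>
         hamilton_compression (Z_graph q p r t) = 1"
proof -
  interpret root_of_unity p q t N r
    by unfold_locales (use assms in auto)
  have "q dvd q ^ (t - 1)"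
    using \<open>t \<ge> 2\<close> by (intro dvd_power) auto
  then show ?thesis
    using hamilton_compression_S[OF not_Petersen, of q] hamilton_compression_S[OF not_Petersen, of "q ^ (t - 1)"]
    by (simp add: Y_graph_def Z_graph_def pm_generate_r)
qed

end
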